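(* Let $\lambda=(N-1,1)$ with $N\ge2$ and let $m>0$ be an integer. The canonical pairing $(\psi,\phi)\mapsto\langle\psi(z),\phi(z)\rangle$ of the solution spaces $\mathit{KZ}(\lambda,m)$ and $\mathit{KZ}(\lambda,-m)$ is proportional to the image of the intersection pairing $(\,\cdot\,)$. More precisely, let $\sigma\in H_1(\mathbb C\smallsetminus\{z_1,\dots,z_N\})$ and $\tau\in H_1(\mathbb C,\{z_1,\dots,z_N\})$ vary with the points $z_i$ as horizontal sections for the Gauss--Manin connection. Then $$\langle\psi_\sigma(z_1,\dots,z_N),\phi_\tau(z_1,\dots,z_N)\rangle=C_N\,\frac1m\,(\sigma\cdot\tau)$$ for some constant $C_N\ne0$ depending on the normalization of the isomorphism $(W^\lambda)^*\to W^\lambda$ (and not on $m$, $\sigma$, $\tau$, $z$).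
   Context: $W^\lambda$ for $\lambda=(N-1,1)$ is the reflection representation of $S_N$: the hyperplane $x_1+\dots+x_N=0$ in $\mathbb C^N$, with $S_N$ permuting the coordinates; $\epsilon_1,\dots,\epsilon_N$ is the standard basis of $\mathbb C^N$. For an integer $k$, $\mathit{KZ}(\lambda,k)$ is the space of holomorphic functions $\psi\colon C_N\to W^\lambda$ on $C_N=\mathbb C^N\smallsetminus\bigcup_{i<j}\{z_i=z_j\}$ with $\partial_i\psi=k\sum_{j\ne i}\frac{s_{ij}+1}{z_i-z_j}\psi$, $i=1,\dots,N$, where $s_{ij}$ is the transposition of $i$ and $j$. An isomorphism of $S_N$-modules $(W^\lambda)^*\to W^\lambda$ (unique up to a scalar factor) is fixed once and for all; $\langle\ ,\ \rangle$ denotes the corresponding $S_N$-invariant non-degenerate bilinear pairing $W^\lambda\times W^\lambda\to\mathbb C$. For $\psi\in\mathit{KZ}(\lambda,m)$ and $\phi\in\mathit{KZ}(\lambda,-m)$ the number $\langle\psi(z),\phi(z)\rangle$ does not depend on $z$. For $\sigma\in H_1(\mathbb C\smallsetminus\{z_1,\dots,z_N\})$ and $\tau$ in the relative homology $H_1(\mathbb C,\{z_1,\dots,z_N\})$ set $$\psi_\sigma=\prod_{i<j}(z_i-z_j)^{2m}\,\frac1{2\pi i}\int_\sigma\prod_{i=1}^N(t-z_i)^{-m}\sum_{b=1}^N\frac{\epsilon_b}{t-z_b}\,dt,$$ $$\phi_\tau=\prod_{i<j}(z_i-z_j)^{-2m}\int_\tau\prod_{i=1}^N(t-z_i)^{m}\sum_{b=1}^N\frac{\epsilon_b}{t-z_b}\,dt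 .$$ When $\sigma,\tau$ vary horizontally with $z$, these are (local) solutions of the KZ equation with parameters $m$ and $-m$ respectively. $(\sigma\cdot\tau)\in\mathbb Z$ is the intersection pairing $H_1(\mathbb C\smallsetminus\{z_1,\dots,z_N\})\times H_1(\mathbb C,\{z_1,\dots,z_N\})\to\mathbb Z$. *)

theory Defs
  imports "HOL-Complex_Analysis.Complex_Analysis" "HOL-Homology.Homology"
begin

text \<open>
  The indices \<open>1, \<dots>, N\<close> are the elements of a finite linearly ordered type \<open>'n\<close>, so \<open>N = CARD('n)\<close>;
  points of \<open>C\<^sub>N\<close> and vectors of the reflection representation both live in \<open>complex ^ 'n\<close>.
\<close>

section \<open>The reflection representation and its invariant pairing\<close>

definition perm_act :: "('n \<Rightarrow> 'n) \<Rightarrow> complex ^ 'n \<Rightarrow> complex ^ 'n::finite" where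
  "perm_act \<pi> x = (\<chi> i. x $ inv_into UNIV \<pi> i)"

definition refl_rep :: "(complex ^ 'n::finite) set" where
  "refl_rep = {x. (\<Sum>i\<in>UNIV. x $ i) = 0}"

text \<open>
  Isomorphisms of \<open>S\<^sub>N\<close>-modules from the dual of \<open>refl_rep\<close> to \<open>refl_rep\<close> correspond to the pairings
  below; the values of \<open>B\<close> off \<open>refl_rep\<close> are irrelevant.
\<close>

definition invariant_pairing :: "(complex ^ 'n::finite \<Rightarrow> complex ^ 'n \<Rightarrow> complex) \<Rightarrow> bool" where
  "invariant_pairing B \<longleftrightarrow>
     (\<forall>x\<in>refl_rep. \<forall>y\<in>refl_rep. \<forall>u\<in>refl_rep.
        B (x + y) u = B x u + B y u \<and> B u (x + y) = B u x + B u y) \<and>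
     (\<forall>a. \<forall>x\<in>refl_rep. \<forall>y\<in>refl_rep. B (a *s x) y = a * B x y \<and> B x (a *s y) = a * B x y) \<and>
     (\<forall>\<pi>. \<pi> permutes UNIV \<longrightarrow>
        (\<forall>x\<in>refl_rep. \<forall>y\<in>refl_rep. B (perm_act \<pi> x) (perm_act \<pi> y) = B x y)) \<and>
     (\<forall>x\<in>refl_rep. (\<forall>y\<in>refl_rep. B x y = 0) \<longrightarrow> x = 0) \<and>
     (\<forall>y\<in>refl_rep. (\<forall>x\<in>refl_rep. B x y = 0) \<longrightarrow> y = 0)"


section \<open>The KZ equation\<close>

definition config :: "(complex ^ 'n::finite) set" where
  "config = {z. \<forall>i j. i \<noteq> j \<longrightarrow> z $ i \<noteq> z $ j}"

text \<open>
  Solutions on an open set \<open>U \<subseteq> config\<close> (the global solution space is \<open>KZ config k\<close>). Holomorphy is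
  complex differentiability at every point of \<open>U\<close>, and \<open>D (axis i 1)\<close> is the partial derivative
  with respect to \<open>z\<^sub>i\<close>.
\<close>

definition KZ :: "(complex ^ 'n::finite) set \<Rightarrow> int \<Rightarrow> (complex ^ 'n \<Rightarrow> complex ^ 'n) set" where
  "KZ U k = {\<psi>. \<forall>z\<in>U. \<psi> z \<in> refl_rep \<and>
     (\<exists>D. (\<psi> has_derivative D) (at z) \<and> (\<forall>a v. D (a *s v) = a *s D v) \<and>
        (\<forall>i. D (axis i 1) = of_int k *s
           (\<Sum>j\<in>UNIV - {i}. (1 / (z $ i - z $ j)) *s (perm_act (Transposition.transpose i j) (\<psi> z) + \<psi> z))))}"


section \<open>Integration over singular homology classes\<close>

text \<open>
  A class in a (relative) homology group of the library is the set of the (relative) cycles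
  representing it. The path of a singular 1-simplex runs from vertex 0 to vertex 1, in accordance
  with the sign convention of \<open>chain_boundary\<close>.
\<close>

definition simplex_path :: "((nat \<Rightarrow> real) \<Rightarrow> complex) \<Rightarrow> real \<Rightarrow> complex" where
  "simplex_path f t = f (\<lambda>i. if i = 0 then 1 - t else if i = 1 then t else 0)"

definition smooth_chain :: "complex chain \<Rightarrow> bool" where
  "smooth_chain c \<longleftrightarrow> (\<forall>f\<in>Poly_Mapping.keys c. valid_path (simplex_path f))"

definition chain_integral :: "complex chain \<Rightarrow> (complex \<Rightarrow> complex) \<Rightarrow> complex" where
  "chain_integral c g =
     (\<Sum>f\<in>Poly_Mapping.keys c.
        of_int (Poly_Mapping.lookup c f) * contour_integral (simplex_path f) g)"

definition homology_integral :: "complex chain set \<Rightarrow> (complex \<Rightarrow> complex) \<Rightarrow> complex" where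
  "homology_integral \<kappa> g = (THE v. \<exists>c\<in>\<kappa>. smooth_chain c \<and> v = chain_integral c g)"


section \<open>The intersection pairing\<close>

text \<open>
  The intersection number is the signed count of crossings of transversal piecewise smooth
  representatives. A crossing of \<open>p\<close> and \<open>q\<close> counts \<open>+1\<close> iff (velocity of \<open>p\<close>, velocity of \<open>q\<close>) is a
  positively oriented basis of the plane. Transversality forces the set of crossings to be finite.
\<close>

definition crossings :: "(real \<Rightarrow> complex) \<Rightarrow> (real \<Rightarrow> complex) \<Rightarrow> (real \<times> real) set" where
  "crossings p q = {(s, t). s \<in> {0..1} \<and> t \<in> {0..1} \<and> p s = q t}"

definition crossing_det :: "(real \<Rightarrow> complex) \<Rightarrow> (real \<Rightarrow> complex) \<Rightarrow> real \<Rightarrow> real \<Rightarrow> real" where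
  "crossing_det p q s t = Im (cnj (vector_derivative p (at s)) * vector_derivative q (at t))"

definition transversal :: "(real \<Rightarrow> complex) \<Rightarrow> (real \<Rightarrow> complex) \<Rightarrow> bool" where
  "transversal p q \<longleftrightarrow>
     (\<forall>(s, t)\<in>crossings p q. s \<in> {0<..<1} \<and> t \<in> {0<..<1} \<and>
        p differentiable at s \<and> q differentiable at t \<and> crossing_det p q s t \<noteq> 0)"

definition path_intersection :: "(real \<Rightarrow> complex) \<Rightarrow> (real \<Rightarrow> complex) \<Rightarrow> int" where
  "path_intersection p q =
     (\<Sum>(s, t)\<in>crossings p q. if crossing_det p q s t > 0 then 1 else - 1)"

definition transversal_chains :: "complex chain \<Rightarrow> complex chain \<Rightarrow> bool" where
  "transversal_chains c d \<longleftrightarrow>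
     (\<forall>f\<in>Poly_Mapping.keys c. \<forall>g\<in>Poly_Mapping.keys d.
        transversal (simplex_path f) (simplex_path g))"

definition chain_intersection :: "complex chain \<Rightarrow> complex chain \<Rightarrow> int" where
  "chain_intersection c d =
     (\<Sum>f\<in>Poly_Mapping.keys c. \<Sum>g\<in>Poly_Mapping.keys d.
        Poly_Mapping.lookup c f * Poly_Mapping.lookup d g *
        path_intersection (simplex_path f) (simplex_path g))"

definition intersection_number :: "complex chain set \<Rightarrow> complex chain set \<Rightarrow> int" where
  "intersection_number \<sigma> \<tau> =
     (THE n. \<exists>c\<in>\<sigma>. \<exists>d\<in>\<tau>. smooth_chain c \<and> smooth_chain d \<and>
        transversal_chains c d \<and> n = chain_intersection c d)"


section \<open>Horizontal families of homology classes\<close>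

definition marked :: "complex ^ 'n::finite \<Rightarrow> complex set" where
  "marked z = range (($) z)"

definition punctured_plane :: "complex ^ 'n::finite \<Rightarrow> complex topology" where
  "punctured_plane z = top_of_set (- marked z)"

text \<open>
  A local trivialization near \<open>z0\<close> of the bundle of pairs \<open>(\<complex>, {z\<^sub>1, \<dots>, z\<^sub>N})\<close>; the Gauss--Manin
  connection is the identification of nearby homology groups induced by it.
\<close>

definition local_trivialization ::
    "(complex ^ 'n::finite) set \<Rightarrow> complex ^ 'n \<Rightarrow> (complex ^ 'n \<Rightarrow> complex \<Rightarrow> complex) \<Rightarrow> bool" where
  "local_trivialization V z0 h \<longleftrightarrow>
     open V \<and> z0 \<in> V \<and> continuous_on (V \<times> UNIV) (\<lambda>(z, t). h z t) \<and> h z0 = id \<and>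
     (\<forall>z\<in>V. (\<exists>h'. homeomorphism UNIV UNIV (h z) h') \<and> (\<forall>i. h z (z0 $ i) = z $ i))"

definition horizontal_cycle ::
    "(complex ^ 'n::finite) set \<Rightarrow> (complex ^ 'n \<Rightarrow> complex chain set) \<Rightarrow> bool" where
  "horizontal_cycle U \<sigma> \<longleftrightarrow>
     (\<forall>z\<in>U. \<sigma> z \<in> carrier (homology_group 1 (punctured_plane z))) \<and>
     (\<forall>z0\<in>U. \<exists>V h. V \<subseteq> U \<and> local_trivialization V z0 h \<and>
        (\<forall>z\<in>V. \<sigma> z = hom_induced 1 (punctured_plane z0) {} (punctured_plane z) {} (h z) (\<sigma> z0)))"

definition horizontal_relcycle ::
    "(complex ^ 'n::finite) set \<Rightarrow> (complex ^ 'n \<Rightarrow> complex chain set) \<Rightarrow> bool" where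
  "horizontal_relcycle U \<tau> \<longleftrightarrow>
     (\<forall>z\<in>U. \<tau> z \<in> carrier (relative_homology_group 1 euclidean (marked z))) \<and>
     (\<forall>z0\<in>U. \<exists>V h. V \<subseteq> U \<and> local_trivialization V z0 h \<and>
        (\<forall>z\<in>V. \<tau> z =
           hom_induced 1 euclidean (marked z0) euclidean (marked z) (h z) (\<tau> z0)))"


section \<open>The integral solutions\<close>

text \<open>
  The vector-valued integrals are taken componentwise; the \<open>b\<close>-th component of
  \<open>\<Sum>b. \<epsilon>\<^sub>b / (t - z\<^sub>b)\<close> is \<open>1 / (t - z $ b)\<close>. In the second integral the integrand is a polynomial
  in \<open>t\<close> except that, for \<open>m = 1\<close>, division by zero gives it the value \<open>0\<close> at \<open>t = z $ b\<close>; a single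
  point does not affect the integrals.
\<close>

definition psi :: "nat \<Rightarrow> complex ^ 'n::{finite,linorder} \<Rightarrow> complex chain set \<Rightarrow> complex ^ 'n::{finite,linorder}" where
  "psi m z \<sigma> = (\<chi> b.
     (\<Prod>(i, j)\<in>{(i, j). i < j}. (z $ i - z $ j) powi (2 * int m)) * (1 / (2 * of_real pi * \<i>)) *
     homology_integral \<sigma> (\<lambda>t. (\<Prod>i\<in>UNIV. (t - z $ i) powi (- int m)) * (1 / (t - z $ b))))"

definition phi :: "nat \<Rightarrow> complex ^ 'n::{finite,linorder} \<Rightarrow> complex chain set \<Rightarrow> complex ^ 'n::{finite,linorder}" where
  "phi m z \<tau> = (\<chi> b.
     (\<Prod>(i, j)\<in>{(i, j). i < j}. (z $ i - z $ j) powi (- 2 * int m)) *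
     homology_integral \<tau> (\<lambda>t. (\<Prod>i\<in>UNIV. (t - z $ i) powi (int m)) * (1 / (t - z $ b))))"

end

theory Submission
  imports Defs
begin

text \<open>
  Let \<open>R t\<close> be the product of the \<open>t - z\<^sub>i\<close>. The powers of the \<open>z\<^sub>i - z\<^sub>j\<close> cancel in the pairing, and an
  invariant pairing is a multiple \<open>\<beta>\<close> of the dot product (\<open>invariant_pairing_proportional\<close>), so the number
  to be found is the integral over \<open>\<sigma>\<close> (in \<open>t\<close>) and \<open>\<tau>\<close> (in \<open>s\<close>) of \<open>(R s / R t)\<^sup>m\<close> times the sum over \<open>b\<close> of
  \<open>1 / ((t - z\<^sub>b) (s - z\<^sub>b))\<close>, divided by \<open>2 \<pi> \<i>\<close>. With \<open>L = R' / R\<close> that sum is \<open>(L s - L t) / (t - s)\<close>, and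
  therefore the integrand is \<open>(\<partial>\<^sub>s + \<partial>\<^sub>t) K / m\<close> for \<open>K = ((R s / R t)\<^sup>m - 1) / (t - s)\<close>: the operator
  \<open>\<partial>\<^sub>s + \<partial>\<^sub>t\<close> annihilates \<open>1 / (t - s)\<close>, so the summand \<open>- 1\<close> does not change the derivative, but it removes
  the pole on the diagonal. The integral of \<open>\<partial>\<^sub>t K\<close> over the closed \<open>\<sigma>\<close> is zero. If \<open>\<tau>\<close> has the boundary
  \<open>\<Sum> a\<^sub>i z\<^sub>i\<close>, the integral of \<open>\<partial>\<^sub>s K\<close> over \<open>\<tau>\<close> is the sum of the \<open>a\<^sub>i K(z\<^sub>i, t) = - a\<^sub>i / (t - z\<^sub>i)\<close>, because
  \<open>R\<close> vanishes at \<open>z\<^sub>i\<close>. What remains is \<open>- 1 / m\<close> times the sum of the \<open>a\<^sub>i W(\<sigma>, z\<^sub>i)\<close>, where \<open>W\<close> is the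
  winding number (\<open>bilinear_integrand_exact\<close>, \<open>pairing_integral\<close>).

  That sum is the intersection number: the winding number of a cycle jumps by \<open>\<plusminus>1\<close> at every crossing of a
  path, so the crossings of \<open>\<sigma>\<close> with an edge are counted by the difference of \<open>W(\<sigma>, \<cdot>)\<close> at its ends
  (\<open>winding_number_local_jump\<close>, \<open>chain_winding_jump\<close>, \<open>intersection_number_winding\<close>). Hence the constant
  is \<open>C = - \<beta>\<close>.

  The integral of a function over a homology class and the intersection number of two classes are defined
  by their values on smooth representatives, so one has to know that such representatives exist and that
  the values agree. Iterated barycentric subdivision brings all simplices into balls, where holomorphic
  functions have primitives and where edges may be replaced by segments (\<open>chain_integral_boundary\<close>,
  \<open>cycle_homologous_to_segments\<close>). A relative class is determined by its boundary, since the plane has no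
  first homology, and is represented by rays from a generic point to the \<open>z\<^sub>i\<close>
  (\<open>exists_transversal_relcycle\<close>).

  For the KZ equation, a fixed polygonal cycle represents \<open>\<sigma> z\<close> for all \<open>z\<close> near a given point, and the
  multiplicities \<open>a\<^sub>i\<close> of \<open>\<tau> z\<close> are locally constant, so that only the integrands and, for \<open>\<tau>\<close>, the end points
  of the paths vary.
  The derivative of the \<open>b\<close>-th component with respect to \<open>z\<^sub>j\<close> is a combination of the components \<open>b\<close> and \<open>j\<close>
  by partial fractions if \<open>j \<noteq> b\<close> (\<open>root_dprod_exchange\<close>); the case \<open>j = b\<close> follows from translation invariance
  (\<open>KZ_equation_at\<close>).
\<close>

section \<open>Linear functionals on singular chains\<close>

text \<open>
  The additive extension of a function on simplices to chains. Integrals, evaluations of boundaries and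
  counts of crossings all have this form.
\<close>

definition chain_sum :: "'a chain \<Rightarrow> (((nat \<Rightarrow> real) \<Rightarrow> 'a) \<Rightarrow> complex) \<Rightarrow> complex" where
  "chain_sum c F = (\<Sum>f\<in>Poly_Mapping.keys c. of_int (Poly_Mapping.lookup c f) * F f)"

lemma chain_sum_superset:
  assumes "finite K" "Poly_Mapping.keys c \<subseteq> K"
  shows "chain_sum c F = (\<Sum>f\<in>K. of_int (Poly_Mapping.lookup c f) * F f)"
  unfolding chain_sum_def
  using assms by (intro sum.mono_neutral_left) (auto simp: in_keys_iff)

lemma chain_sum_0 [simp]: "chain_sum 0 F = 0"
  by (simp add: chain_sum_def)

lemma chain_sum_of [simp]: "chain_sum (frag_of f) F = F f"
  by (simp add: chain_sum_def)

lemma chain_sum_add: "chain_sum (a + b) F = chain_sum a F + chain_sum b F"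
proof -
  let ?K = "Poly_Mapping.keys a \<union> Poly_Mapping.keys b"
  have "chain_sum (a + b) F = (\<Sum>f\<in>?K. of_int (Poly_Mapping.lookup (a + b) f) * F f)"
    by (intro chain_sum_superset) (auto simp: Poly_Mapping.keys_add)
  moreover have "chain_sum a F = (\<Sum>f\<in>?K. of_int (Poly_Mapping.lookup a f) * F f)"
    and "chain_sum b F = (\<Sum>f\<in>?K. of_int (Poly_Mapping.lookup b f) * F f)"
    by (auto intro!: chain_sum_superset)
  ultimately show ?thesis
    by (simp add: lookup_add algebra_simps sum.distrib)
qed

lemma chain_sum_cmul: "chain_sum (frag_cmul k a) F = of_int k * chain_sum a F"
proof -
  have "chain_sum (frag_cmul k a) F =
      (\<Sum>f\<in>Poly_Mapping.keys a. of_int (Poly_Mapping.lookup (frag_cmul k a) f) * F f)"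
    by (intro chain_sum_superset) (auto simp: keys_cmul)
  then show ?thesis
    by (simp add: chain_sum_def sum_distrib_left mult.assoc)
qed

lemma chain_sum_minus: "chain_sum (- a) F = - chain_sum a F"
  using chain_sum_cmul[of "-1" a F] by simp

lemma chain_sum_diff: "chain_sum (a - b) F = chain_sum a F - chain_sum b F"
  using chain_sum_add[of a "- b" F] by (simp add: chain_sum_minus)

lemma chain_sum_sum: "chain_sum (\<Sum>i\<in>I. g i) F = (\<Sum>i\<in>I. chain_sum (g i) F)"
  by (induction I rule: infinite_finite_induct) (auto simp: chain_sum_add)

lemma chain_sum_extend: "chain_sum (frag_extend b c) F = chain_sum c (\<lambda>f. chain_sum (b f) F)"
  by (simp add: frag_extend_def chain_sum_sum chain_sum_cmul chain_sum_def[of c])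

lemma chain_sum_cong:
  assumes "\<And>f. f \<in> Poly_Mapping.keys c \<Longrightarrow> F f = G f"
  shows "chain_sum c F = chain_sum c G"
  using assms by (simp add: chain_sum_def)

lemma chain_sum_linear:
  "chain_sum c (\<lambda>f. F f + G f) = chain_sum c F + chain_sum c G"
  "chain_sum c (\<lambda>f. F f - G f) = chain_sum c F - chain_sum c G"
  "chain_sum c (\<lambda>f. k * F f) = k * chain_sum c F"
  "chain_sum c (\<lambda>f. F f * k) = chain_sum c F * k"
  "chain_sum c (\<lambda>f. \<Sum>i\<in>I. H i f) = (\<Sum>i\<in>I. chain_sum c (H i))"
  by (auto simp: chain_sum_def algebra_simps sum.distrib sum_subtractf sum_distrib_left
      intro: sum.swap)

lemma chain_integral_chain_sum:
  "chain_integral c g = chain_sum c (\<lambda>f. contour_integral (simplex_path f) g)"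
  by (simp add: chain_integral_def chain_sum_def)

abbreviation vertex0 :: "nat \<Rightarrow> real" where "vertex0 \<equiv> (\<lambda>j. if j = 0 then 1 else 0)"

text \<open>
  The two faces of an edge are its ends, so that sums over the boundary of a 1-chain are sums of increments
  along its edges.
\<close>

lemma chain_sum_boundary:
  "chain_sum (chain_boundary (Suc 0) c) (\<lambda>f. Q (f vertex0)) =
     chain_sum c (\<lambda>f. Q (simplex_path f 1) - Q (simplex_path f 0))"
proof -
  have [simp]: "singular_face (Suc 0) 0 f vertex0 = simplex_path f 1"
    "singular_face (Suc 0) (Suc 0) f vertex0 = simplex_path f 0" for f :: "(nat \<Rightarrow> real) \<Rightarrow> complex"
    by (auto simp: singular_face_def simplex_path_def simplical_face_def standard_simplex_0
        intro!: arg_cong[of _ _ f])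
  show ?thesis
    by (simp add: chain_boundary_def chain_sum_extend chain_sum_diff)
qed

lemma chain_sum_ends_cycle:
  assumes "chain_boundary (Suc 0) c = 0"
  shows "chain_sum c (\<lambda>f. Q (simplex_path f 1) - Q (simplex_path f 0)) = 0"
  using chain_sum_boundary[of c Q] assms by simp

section \<open>Paths of singular 1-simplices\<close>

lemma edge_point_in_simplex:
  assumes "t \<in> {0..1::real}"
  shows "(\<lambda>i. if i = 0 then 1 - t else if i = 1 then t else 0) \<in> standard_simplex 1"
  using assms by (auto simp: standard_simplex_def)

lemma in_edge_simplex:
  assumes "x \<in> standard_simplex 1"
  shows "x = (\<lambda>i. if i = 0 then 1 - x 1 else if i = 1 then x 1 else 0)" "x 1 \<in> {0..1}"
proof -
  have x: "x 0 + x 1 = 1" "\<forall>i>1. x i = 0" "\<forall>i. 0 \<le> x i \<and> x i \<le> 1"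
    using assms by (auto simp: standard_simplex_def)
  show "x 1 \<in> {0..1}" using x(3) by auto
  show "x = (\<lambda>i. if i = 0 then 1 - x 1 else if i = 1 then x 1 else 0)"
  proof
    fix i show "x i = (if i = 0 then 1 - x 1 else if i = 1 then x 1 else 0)"
      using x by (cases "i = 0 \<or> i = 1") auto
  qed
qed

lemma simplex_path_image_subset:
  assumes "f ` standard_simplex 1 \<subseteq> V"
  shows "simplex_path f ` {0..1} \<subseteq> V"
  using assms edge_point_in_simplex unfolding simplex_path_def by blast

lemma simplex_image_eq_path_image: "f ` standard_simplex 1 = path_image (simplex_path f)"
proof
  show "f ` standard_simplex 1 \<subseteq> path_image (simplex_path f)"
  proof (rule image_subsetI)
    fix x :: "nat \<Rightarrow> real" assume x: "x \<in> standard_simplex 1"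
    have "f x = simplex_path f (x 1)"
      unfolding simplex_path_def using in_edge_simplex(1)[OF x] by simp
    then show "f x \<in> path_image (simplex_path f)"
      using in_edge_simplex(2)[OF x] by (auto simp: path_image_def)
  qed
  show "path_image (simplex_path f) \<subseteq> f ` standard_simplex 1"
    using simplex_path_image_subset[of f "f ` standard_simplex 1"] by (simp add: path_image_def)
qed

text \<open>
  A singular simplex is determined only by its values on the standard simplex, so that its path is
  controlled only on \<open>{0..1}\<close>. This lemma and the next two discard the values outside.
\<close>

lemma valid_path_cong:
  assumes "\<And>t. t \<in> {0..1} \<Longrightarrow> p t = q t" "valid_path p"
  shows "valid_path q"
proof -
  obtain S where S: "continuous_on {0..1} p" "finite S" "p C1_differentiable_on ({0..1} - S)"
    using assms(2) by (auto simp: valid_path_def piecewise_C1_differentiable_on_def)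
  then obtain D where D: "\<And>x. x \<in> {0..1} - S \<Longrightarrow> (p has_vector_derivative D x) (at x)"
    "continuous_on ({0..1} - S) D"
    unfolding C1_differentiable_on_def by blast
  have "(q has_vector_derivative D x) (at x)" if "x \<in> {0..1} - (S \<union> {0,1})" for x
    by (rule has_vector_derivative_transform_within_open[of p _ _ "{0<..<1}"])
      (use that D assms(1) in auto)
  moreover have "continuous_on ({0..1} - (S \<union> {0,1})) D"
    using D(2) by (rule continuous_on_subset) auto
  ultimately have "q C1_differentiable_on ({0..1} - (S \<union> {0,1}))"
    unfolding C1_differentiable_on_def by blast
  moreover have "continuous_on {0..1} q"
    using S(1) assms(1) continuous_on_cong[of "{0..1}" "{0..1}" p q] by auto
  ultimately show ?thesis
    unfolding valid_path_def piecewise_C1_differentiable_on_def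
    using S(2) by (meson finite.emptyI finite.insertI finite_UnI)
qed

lemma has_contour_integral_path_cong:
  assumes "\<And>t. t \<in> {0..1} \<Longrightarrow> p t = q t"
  shows "(g has_contour_integral i) p \<longleftrightarrow> (g has_contour_integral i) q"
proof -
  have "vector_derivative p (at x within {0..1}) = vector_derivative q (at x within {0..1})"
    if "x \<in> {0..1}" for x
    using assms that by (intro vector_derivative_cong_eq) auto
  then show ?thesis
    unfolding has_contour_integral_def
    using assms by (intro has_integral_cong) auto
qed

lemma contour_integral_path_cong:
  assumes "\<And>t. t \<in> {0..1} \<Longrightarrow> p t = q t"
  shows "contour_integral p g = contour_integral q g"
  using has_contour_integral_path_cong[OF assms]
  by (simp add: contour_integral_def contour_integrable_on_def)

definition segment_simplex :: "complex \<Rightarrow> complex \<Rightarrow> (nat \<Rightarrow> real) \<Rightarrow> complex" where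
  "segment_simplex u v = restrict (\<lambda>x. of_real (x 0) * u + of_real (x 1) * v) (standard_simplex 1)"

lemma simplex_path_segment:
  "t \<in> {0..1} \<Longrightarrow> simplex_path (segment_simplex u v) t = linepath u v t"
  using edge_point_in_simplex[of t]
  by (simp add: simplex_path_def segment_simplex_def linepath_def scaleR_conv_of_real)

lemma segment_simplex_image: "segment_simplex u v ` standard_simplex 1 = closed_segment u v"
  unfolding simplex_image_eq_path_image path_image_linepath[symmetric]
  unfolding path_image_def using simplex_path_segment by (intro image_cong) auto

lemma valid_path_segment_simplex: "valid_path (simplex_path (segment_simplex u v))"
  by (rule valid_path_cong[of "linepath u v"]) (auto simp: simplex_path_segment)

lemma contour_integral_segment_simplex:
  "contour_integral (simplex_path (segment_simplex u v)) g = contour_integral (linepath u v) g"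
  by (intro contour_integral_path_cong) (auto simp: simplex_path_segment)

lemma singular_simplex_segment:
  assumes "closed_segment u v \<subseteq> S"
  shows "singular_simplex (Suc 0) (top_of_set S) (segment_simplex u v)"
proof -
  have "continuous_map (subtopology (powertop_real UNIV) (standard_simplex 1)) euclidean
      (\<lambda>x. of_real (x 0) * u + of_real (x 1) * v)"
    unfolding euclidean_product_topology continuous_map_iff_continuous
    by (intro continuous_intros continuous_on_subset[OF continuous_on_product_coordinates subset_UNIV])
  then have "continuous_map (subtopology (powertop_real UNIV) (standard_simplex 1)) euclidean
      (segment_simplex u v)"
    by (rule continuous_map_eq) (auto simp: segment_simplex_def)
  moreover have "segment_simplex u v ` standard_simplex 1 \<subseteq> S"
    using assms segment_simplex_image by simp
  ultimately show ?thesis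
    by (auto simp: singular_simplex_def continuous_map_in_subtopology segment_simplex_def)
qed

section \<open>Integrals over homologous cycles\<close>

lemma restrict_id_oriented_simplex:
  "restrict id (standard_simplex p) = oriented_simplex p (\<lambda>i j. if j = i then 1 else 0)"
  by (force simp: oriented_simplex_def standard_simplex_def if_distrib [of "\<lambda>u. u * _"] cong: if_cong)

text \<open>
  One of the two edges of the barycentric subdivision of \<open>f\<close>. Both start at the midpoint, so the one that
  ends in vertex \<open>0\<close> runs backwards.
\<close>

definition half_simplex :: "nat \<Rightarrow> ((nat \<Rightarrow> real) \<Rightarrow> 'a) \<Rightarrow> (nat \<Rightarrow> real) \<Rightarrow> 'a" where
  "half_simplex k f = simplex_map (Suc 0) f
     (oriented_simplex (Suc 0) (\<lambda>i. if i = 0 then (\<lambda>j. if j \<le> Suc 0 then 1/2 else 0) else (\<lambda>j. if j = k then 1 else 0)))"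

lemma singular_subdivision_edge:
  "singular_subdivision (Suc 0) (frag_of f) = frag_of (half_simplex (Suc 0) f) - frag_of (half_simplex 0 f)"
proof -
  let ?e = "\<lambda>i j. if j = i then 1 else (0::real)"
  let ?m = "\<lambda>j::nat. if j \<le> Suc 0 then 1/2 else (0::real)"
  have b: "chain_boundary (Suc 0) (frag_of (oriented_simplex (Suc 0) ?e)) =
      frag_of (oriented_simplex 0 (\<lambda>j. ?e (Suc 0))) - frag_of (oriented_simplex 0 (\<lambda>j. ?e 0))"
  proof -
    have "singular_face (Suc 0) 0 (oriented_simplex (Suc 0) ?e) = oriented_simplex 0 (\<lambda>j. ?e (Suc 0))"
      "singular_face (Suc 0) (Suc 0) (oriented_simplex (Suc 0) ?e) = oriented_simplex 0 (\<lambda>j. ?e 0)"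
      by (simp_all add: singular_face_oriented_simplex oriented_simplex_eq)
    then show ?thesis
      by (simp add: chain_boundary_of)
  qed
  have m: "(\<lambda>i. (\<Sum>j\<le>Suc 0. simplicial_vertex j (oriented_simplex (Suc 0) ?e) i) / real (Suc (Suc 0))) = ?m"
    by (auto simp: simplicial_vertex_oriented_simplex fun_eq_iff)
  have "simplicial_subdivision (Suc 0) (frag_of (oriented_simplex (Suc 0) ?e)) =
     frag_of (oriented_simplex (Suc 0) (\<lambda>i. if i = 0 then ?m else ?e (Suc 0))) -
     frag_of (oriented_simplex (Suc 0) (\<lambda>i. if i = 0 then ?m else ?e 0))"
    unfolding simplicial_subdivision_of m
    by (simp add: b simplicial_cone_def frag_extend_diff simplex_cone)
  then show ?thesis
    unfolding singular_subdivision_def frag_extend_of restrict_id_oriented_simplex half_simplex_def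
    by (simp add: chain_map_diff eq_commute)
qed

lemma simplex_path_half_simplex:
  assumes "t \<in> {0..1}"
  shows "simplex_path (half_simplex (Suc 0) f) t = subpath (1/2) 1 (simplex_path f) t"
    and "simplex_path (half_simplex 0 f) t = subpath (1/2) 0 (simplex_path f) t"
  using edge_point_in_simplex[OF assms]
  by (auto simp: half_simplex_def simplex_path_def simplex_map_def oriented_simplex_def subpath_def
      fun_eq_iff field_simps intro!: arg_cong[of _ _ f])

lemma smooth_chain_singular_subdivision:
  assumes "smooth_chain c"
  shows "smooth_chain (singular_subdivision (Suc 0) c)"
proof -
  have "valid_path (simplex_path (half_simplex (Suc 0) f)) \<and> valid_path (simplex_path (half_simplex 0 f))"
    if "valid_path (simplex_path f)" for f
  proof -
    have "valid_path (subpath (1/2) 1 (simplex_path f))" "valid_path (subpath (1/2) 0 (simplex_path f))"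
      using that by (auto intro: valid_path_subpath)
    then show ?thesis
      using valid_path_cong[OF simplex_path_half_simplex(1)[where f=f, symmetric]]
        valid_path_cong[OF simplex_path_half_simplex(2)[where f=f, symmetric]] by simp
  qed
  moreover have "Poly_Mapping.keys (singular_subdivision (Suc 0) c) \<subseteq>
      (\<Union>f\<in>Poly_Mapping.keys c. Poly_Mapping.keys (singular_subdivision (Suc 0) (frag_of f)))"
    using keys_frag_extend[of _ c] unfolding singular_subdivision_def by simp
  moreover have "Poly_Mapping.keys (singular_subdivision (Suc 0) (frag_of f)) \<subseteq> {half_simplex (Suc 0) f, half_simplex 0 f}" for f :: "(nat \<Rightarrow> real) \<Rightarrow> complex"
    unfolding singular_subdivision_edge using keys_diff[of "frag_of (half_simplex (Suc 0) f)" "frag_of (half_simplex 0 f)"]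
    by (simp only: keys_frag_of) auto
  ultimately show ?thesis
    using assms unfolding smooth_chain_def by blast
qed

text \<open>
  The half that runs backwards enters the subdivision with a minus sign, so the two halves add up to the
  integral along the whole edge.
\<close>

lemma chain_integral_singular_subdivision:
  assumes "smooth_chain c"
    and "\<And>f. f \<in> Poly_Mapping.keys c \<Longrightarrow> g contour_integrable_on simplex_path f"
  shows "chain_integral (singular_subdivision (Suc 0) c) g = chain_integral c g"
proof -
  have "chain_integral (singular_subdivision (Suc 0) c) g =
      chain_sum c (\<lambda>f. chain_sum (singular_subdivision (Suc 0) (frag_of f))
        (\<lambda>f. contour_integral (simplex_path f) g))"
    unfolding chain_integral_chain_sum singular_subdivision_def chain_sum_extend by simp
  also have "\<dots> = chain_sum c (\<lambda>f. contour_integral (simplex_path f) g)"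
  proof (rule chain_sum_cong)
    fix f assume f: "f \<in> Poly_Mapping.keys c"
    let ?p = "simplex_path f"
    have v: "valid_path ?p" using f assms(1) by (auto simp: smooth_chain_def)
    have "contour_integral (subpath (1/2) 1 ?p) g - contour_integral (subpath (1/2) 0 ?p) g =
        contour_integral (subpath (1/2) 1 ?p) g + contour_integral (subpath 0 (1/2) ?p) g"
      using contour_integral_subpath_combine[OF assms(2)[OF f] v, of 0 "1/2" 0]
      by (simp add: add_eq_0_iff)
    also have "\<dots> = contour_integral ?p g"
      using contour_integral_subpath_combine[OF assms(2)[OF f] v, of 0 "1/2" 1]
      by (simp add: add.commute)
    finally show "chain_sum (singular_subdivision (Suc 0) (frag_of f))
        (\<lambda>f. contour_integral (simplex_path f) g) = contour_integral ?p g"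
      unfolding singular_subdivision_edge chain_sum_diff chain_sum_of
      using contour_integral_path_cong[OF simplex_path_half_simplex(1)[where f=f], where g=g]
        contour_integral_path_cong[OF simplex_path_half_simplex(2)[where f=f], where g=g] by simp
  qed
  finally show ?thesis by (simp add: chain_integral_chain_sum)
qed

lemma simplex_path_image_in_space:
  assumes "singular_chain (Suc 0) (top_of_set S) c" "f \<in> Poly_Mapping.keys c"
  shows "path_image (simplex_path f) \<subseteq> S"
proof -
  have "singular_simplex (Suc 0) (top_of_set S) f"
    using assms by (auto simp: singular_chain_def)
  then have "f ` standard_simplex (Suc 0) \<subseteq> S"
    by (auto simp: singular_simplex_def continuous_map_in_subtopology)
  then show ?thesis
    using simplex_image_eq_path_image[of f] by simp
qed

lemma holomorphic_integrable_on_smooth_chain: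
  assumes "open S" "g holomorphic_on S" "smooth_chain c" "singular_chain (Suc 0) (top_of_set S) c"
    "f \<in> Poly_Mapping.keys c"
  shows "g contour_integrable_on simplex_path f"
  using assms simplex_path_image_in_space[OF assms(4,5)]
  by (intro contour_integrable_holomorphic_simple[OF assms(2,1)]) (auto simp: smooth_chain_def)

lemma iterated_subdivision_edges:
  assumes "open S" "g holomorphic_on S" "smooth_chain c" "singular_chain (Suc 0) (top_of_set S) c"
  shows "smooth_chain ((singular_subdivision (Suc 0) ^^ n) c) \<and>
    singular_chain (Suc 0) (top_of_set S) ((singular_subdivision (Suc 0) ^^ n) c) \<and>
    chain_integral ((singular_subdivision (Suc 0) ^^ n) c) g = chain_integral c g"
proof (induction n)
  case 0 then show ?case using assms by simp
next
  case (Suc n)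
  then show ?case
    using smooth_chain_singular_subdivision[of "(singular_subdivision (Suc 0) ^^ n) c"]
      singular_chain_singular_subdivision[of "Suc 0" "top_of_set S" "(singular_subdivision (Suc 0) ^^ n) c"]
      chain_integral_singular_subdivision[of "(singular_subdivision (Suc 0) ^^ n) c" g]
      holomorphic_integrable_on_smooth_chain[OF assms(1,2), of "(singular_subdivision (Suc 0) ^^ n) c"]
    by simp
qed

lemma chain_boundary_iterated_subdivision:
  assumes "singular_chain (Suc p) X c"
  shows "chain_boundary (Suc p) ((singular_subdivision (Suc p) ^^ n) c) =
     (singular_subdivision p ^^ n) (chain_boundary (Suc p) c) \<and>
     singular_chain (Suc p) X ((singular_subdivision (Suc p) ^^ n) c)"
proof (induction n)
  case 0 then show ?case using assms by simp
next
  case (Suc n)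
  then show ?case
    using chain_boundary_singular_subdivision[of "Suc p" X "(singular_subdivision (Suc p) ^^ n) c"]
      singular_chain_singular_subdivision[of "Suc p" X "(singular_subdivision (Suc p) ^^ n) c"] by simp
qed

lemma open_balls_openin:
  "U \<in> {U. \<exists>x r. U = ball x r \<and> U \<subseteq> S} \<Longrightarrow> openin (top_of_set S) (U :: complex set)"
  by (auto intro!: open_subset)

lemma open_balls_cover:
  assumes "open (S::complex set)"
  shows "topspace (top_of_set S) \<subseteq> \<Union>{U. \<exists>x r. U = ball x r \<and> U \<subseteq> S}"
proof
  fix x assume "x \<in> topspace (top_of_set S)"
  then have "x \<in> S" by simp
  then obtain r where "r > 0" "ball x r \<subseteq> S"
    using assms by (auto simp: open_contains_ball)
  then show "x \<in> \<Union>{U. \<exists>x r. U = ball x r \<and> U \<subseteq> S}"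
    by (intro UnionI[of "ball x r"]) auto
qed

lemma subdivision_into_balls:
  assumes S: "open (S::complex set)" and c: "singular_chain p (top_of_set S) c"
  shows "\<exists>n. \<forall>m\<ge>n. \<forall>f\<in>Poly_Mapping.keys ((singular_subdivision p ^^ m) c).
    \<exists>x r. f ` standard_simplex p \<subseteq> ball x r \<and> ball x r \<subseteq> S"
proof (rule sufficient_iterated_singular_subdivision_exists[OF open_balls_openin open_balls_cover[OF S] c])
  fix n
  assume n: "\<And>m f. n \<le> m \<Longrightarrow> f \<in> Poly_Mapping.keys ((singular_subdivision p ^^ m) c) \<Longrightarrow>
      \<exists>V\<in>{U. \<exists>x r. U = ball x r \<and> U \<subseteq> S}. f \<in> standard_simplex p \<rightarrow> V"
  show ?thesis
  proof (intro exI[of _ n] allI impI ballI)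
    fix m f assume "n \<le> m" "f \<in> Poly_Mapping.keys ((singular_subdivision p ^^ m) c)"
    then obtain x r where "ball x r \<subseteq> S" "f \<in> standard_simplex p \<rightarrow> ball x r"
      using n by blast
    then show "\<exists>x r. f ` standard_simplex p \<subseteq> ball x r \<and> ball x r \<subseteq> S"
      unfolding image_subset_iff_funcset by blast
  qed
qed

text \<open>
  The bounding 2-chain is only continuous. After sufficiently many subdivisions each of its simplices
  lies in a ball on which \<open>g\<close> has a primitive \<open>G\<close>. There an edge, smooth or not, may be replaced by the segment
  between its ends: the integral along a smooth edge and the one along the segment are both the increment
  of \<open>G\<close>, and these increments cancel around each small triangle.
\<close>

lemma chain_integral_boundary:
  assumes S: "open S" "g holomorphic_on S" and c: "smooth_chain (chain_boundary (Suc (Suc 0)) D)"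
    and D: "singular_chain (Suc (Suc 0)) (top_of_set S) D"
  shows "chain_integral (chain_boundary (Suc (Suc 0)) D) g = 0"
proof -
  let ?C = "{U. \<exists>x r. U = ball x r \<and> U \<subseteq> S}" and ?c = "chain_boundary (Suc (Suc 0)) D"
  have chc: "singular_chain (Suc 0) (top_of_set S) ?c"
    using singular_chain_boundary[OF D] by simp
  obtain n1 where n1: "\<And>m f. n1 \<le> m \<Longrightarrow> f \<in> Poly_Mapping.keys ((singular_subdivision (Suc (Suc 0)) ^^ m) D)
      \<Longrightarrow> \<exists>x r. f ` standard_simplex (Suc (Suc 0)) \<subseteq> ball x r \<and> ball x r \<subseteq> S"
    using subdivision_into_balls[OF S(1) D] by blast
  obtain n2 where n2: "\<And>m f. n2 \<le> m \<Longrightarrow> f \<in> Poly_Mapping.keys ((singular_subdivision (Suc 0) ^^ m) ?c)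
      \<Longrightarrow> \<exists>x r. f ` standard_simplex (Suc 0) \<subseteq> ball x r \<and> ball x r \<subseteq> S"
    using subdivision_into_balls[OF S(1) chc] by blast
  define n where "n = max n1 n2"
  let ?c' = "(singular_subdivision (Suc 0) ^^ n) ?c"
  let ?D' = "(singular_subdivision (Suc (Suc 0)) ^^ n) D"
  let ?L = "\<lambda>f. contour_integral (linepath (simplex_path f 0) (simplex_path f 1)) g"
  have c': "smooth_chain ?c'" "chain_integral ?c' g = chain_integral ?c g"
    using iterated_subdivision_edges[OF S c chc, of n] by auto
  have D': "chain_boundary (Suc (Suc 0)) ?D' = ?c'" "singular_chain (Suc (Suc 0)) (top_of_set S) ?D'"
    using chain_boundary_iterated_subdivision[OF D, of n] by auto
  have prim: "\<exists>G. \<forall>x\<in>V. (G has_field_derivative g x) (at x within V)" if "V \<in> ?C" for V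
  proof -
    have "convex V" "open V" "g holomorphic_on V"
      using that holomorphic_on_subset[OF S(2), of V] by auto
    then show ?thesis
      by (rule holomorphic_convex_primitive') blast
  qed
  have L: "?L f = G (simplex_path f 1) - G (simplex_path f 0)"
    if "V \<in> ?C" "\<And>x. x \<in> V \<Longrightarrow> (G has_field_derivative g x) (at x within V)"
      "f ` standard_simplex (Suc 0) \<subseteq> V" for f V G
  proof -
    have "simplex_path f 0 \<in> V" "simplex_path f 1 \<in> V"
      using simplex_path_image_subset[of f V] that(3) by auto
    moreover have "convex V" using that(1) by auto
    ultimately have "closed_segment (simplex_path f 0) (simplex_path f 1) \<subseteq> V"
      by (simp add: closed_segment_subset)
    then have "(g has_contour_integral (G (pathfinish (linepath (simplex_path f 0) (simplex_path f 1))) -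
        G (pathstart (linepath (simplex_path f 0) (simplex_path f 1)))))
        (linepath (simplex_path f 0) (simplex_path f 1))"
      by (intro contour_integral_primitive[OF that(2)]) auto
    then show ?thesis
      by (simp add: contour_integral_unique)
  qed
  have "chain_integral ?c' g = chain_sum ?c' ?L"
    unfolding chain_integral_chain_sum
  proof (rule chain_sum_cong)
    fix f assume f: "f \<in> Poly_Mapping.keys ?c'"
    then obtain V where V: "V \<in> ?C" "f ` standard_simplex (Suc 0) \<subseteq> V"
      using n2[of n f] by (auto simp: n_def)
    obtain G where G: "\<And>x. x \<in> V \<Longrightarrow> (G has_field_derivative g x) (at x within V)"
      using prim[OF V(1)] by blast
    have "path_image (simplex_path f) \<subseteq> V"
      using simplex_image_eq_path_image[of f] V(2) by simp
    moreover have "valid_path (simplex_path f)"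
      using c'(1) f by (simp add: smooth_chain_def)
    ultimately have "(g has_contour_integral (G (pathfinish (simplex_path f)) -
        G (pathstart (simplex_path f)))) (simplex_path f)"
      by (intro contour_integral_primitive[OF G])
    then have "contour_integral (simplex_path f) g = G (simplex_path f 1) - G (simplex_path f 0)"
      by (simp add: contour_integral_unique pathstart_def pathfinish_def)
    then show "contour_integral (simplex_path f) g = ?L f"
      using L[OF V(1) G V(2)] by simp
  qed
  also have "\<dots> = chain_sum ?D' (\<lambda>F. chain_sum (chain_boundary (Suc (Suc 0)) (frag_of F)) ?L)"
    unfolding D'(1)[symmetric] unfolding chain_boundary_def
    by (simp add: chain_sum_extend del: sum.atMost_Suc)
  also have "\<dots> = chain_sum ?D' (\<lambda>F. 0)"
  proof (rule chain_sum_cong)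
    fix F assume F: "F \<in> Poly_Mapping.keys ?D'"
    then obtain V where V: "V \<in> ?C" "F ` standard_simplex (Suc (Suc 0)) \<subseteq> V"
      using n1[of n F] by (auto simp: n_def)
    obtain G where G: "\<And>x. x \<in> V \<Longrightarrow> (G has_field_derivative g x) (at x within V)"
      using prim[OF V(1)] by blast
    have "singular_simplex (Suc (Suc 0)) (top_of_set S) F"
      using D'(2) F by (auto simp: singular_chain_def)
    then have FV: "singular_chain (Suc (Suc 0)) (top_of_set V) (frag_of F)"
      using V by (auto simp: singular_chain_of singular_simplex_def continuous_map_in_subtopology)
    have bV: "singular_chain (Suc 0) (top_of_set V) (chain_boundary (Suc (Suc 0)) (frag_of F))"
      using singular_chain_boundary[OF FV] by simp
    have "chain_sum (chain_boundary (Suc (Suc 0)) (frag_of F)) ?L =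
        chain_sum (chain_boundary (Suc (Suc 0)) (frag_of F)) (\<lambda>f. G (simplex_path f 1) - G (simplex_path f 0))"
    proof (intro chain_sum_cong L[OF V(1) G])
      fix f assume "f \<in> Poly_Mapping.keys (chain_boundary (Suc (Suc 0)) (frag_of F))"
      then show "f ` standard_simplex (Suc 0) \<subseteq> V"
        using simplex_path_image_in_space[OF bV] simplex_image_eq_path_image[of f] by simp
    qed
    also have "\<dots> = 0"
      by (rule chain_sum_ends_cycle) (use chain_boundary_boundary[OF FV] in simp)
    finally show "chain_sum (chain_boundary (Suc (Suc 0)) (frag_of F)) ?L = 0" .
  qed
  finally show ?thesis using c'(2) by (simp add: chain_sum_def)
qed

section \<open>Representing cycles by line segments\<close>

text \<open>
  The straight-line homotopy moves the cycle into a single point, where all cycles of positive degree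
  are boundaries.
\<close>

lemma cycle_in_convex_is_boundary:
  assumes "convex (S :: complex set)" "S \<noteq> {}"
    and c: "singular_relcycle (Suc p) (top_of_set S) {} c"
  shows "singular_relboundary (Suc p) (top_of_set S) {} c"
proof -
  obtain a where a: "a \<in> S" using assms(2) by blast
  let ?X = "top_of_set S"
  have "homotopic_with (\<lambda>h. h \<in> {} \<rightarrow> {}) ?X ?X id (\<lambda>x. a)"
  proof -
    have "continuous_on ({0..1} \<times> S) (\<lambda>y. linepath (snd y) a (fst y))"
      unfolding linepath_def by (intro continuous_intros)
    moreover have "linepath x a t \<in> S" if "x \<in> S" "t \<in> {0..1}" for x t
      using that a assms(1) by (meson closed_segment_subset linepath_in_path subsetD)
    ultimately show ?thesis
      unfolding homotopic_with_def
      by (intro exI[of _ "\<lambda>y. linepath (snd y) a (fst y)"])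
        (auto simp: linepath_def subtopology_Times[symmetric] prod_topology_subtopology_eu)
  qed
  from homotopic_imp_homologous_rel_chain_maps[OF this c]
  have "homologous_rel (Suc p) ?X {} c (chain_map (Suc p) (\<lambda>x. a) c)"
    using c chain_map_ident[of "Suc p" ?X c] by (simp add: singular_relcycle_def)
  moreover have "singular_relboundary (Suc p) ?X {} (chain_map (Suc p) (\<lambda>x. a) c)"
  proof -
    have "singular_relcycle (Suc p) (top_of_set {a}) {} (chain_map (Suc p) (\<lambda>x. a) c)"
      by (rule singular_relcycle_chain_map[OF c]) auto
    then have "singular_relboundary (Suc p) (top_of_set {a}) {} (chain_map (Suc p) (\<lambda>x. a) c)"
      using singular_boundary_eq_cycle_singleton[of "top_of_set {a}" a "Suc p"] by simp
    then show ?thesis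
      using singular_boundary_mono[of "{a}" S "Suc p" euclidean] a by simp
  qed
  ultimately show ?thesis
    unfolding homologous_rel_def using singular_relboundary_add by (metis diff_add_cancel)
qed

lemma singular_relboundary_frag_extend:
  assumes "\<And>f. f \<in> Poly_Mapping.keys c \<Longrightarrow> singular_relboundary p X S (b f)"
  shows "singular_relboundary p X S (frag_extend b c)"
proof -
  have "singular_relboundary p X S (\<Sum>i\<in>I. frag_cmul (poly_mapping.lookup c i) (b i))"
    if "finite I" "I \<subseteq> Poly_Mapping.keys c" for I
    using that
    by (induction I rule: finite_induct) (auto intro!: singular_relboundary_add singular_relboundary_cmul assms)
  then show ?thesis by (simp add: frag_extend_def)
qed

lemma frag_cmul_diff2: "frag_cmul k (a - b) = frag_cmul k a - frag_cmul k b"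
  by (rule poly_mapping_eqI) (simp add: lookup_minus algebra_simps)

lemma face_vertex0:
  "singular_face (Suc 0) 0 f = restrict (\<lambda>x. simplex_path f 1) (standard_simplex 0)"
  "singular_face (Suc 0) (Suc 0) f = restrict (\<lambda>x. simplex_path f 0) (standard_simplex 0)"
  by (auto simp: singular_face_def simplex_path_def simplical_face_def standard_simplex_0
        fun_eq_iff intro!: arg_cong[of _ _ f])

lemma chain_boundary_edge:
  "chain_boundary (Suc 0) (frag_of f) =
     frag_of (restrict (\<lambda>x. simplex_path f 1) (standard_simplex 0)) -
     frag_of (restrict (\<lambda>x. simplex_path f 0) (standard_simplex 0))"
  by (simp add: chain_boundary_of face_vertex0)

lemma cycle_homologous_to_small:
  assumes S: "open (S :: complex set)" and c: "singular_relcycle p (top_of_set S) {} c"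
  shows "\<exists>d. singular_relcycle p (top_of_set S) {} d \<and> homologous_rel p (top_of_set S) {} c d \<and>
    (\<forall>f\<in>Poly_Mapping.keys d. \<exists>x r. f ` standard_simplex p \<subseteq> ball x r \<and> ball x r \<subseteq> S)"
proof (rule small_homologous_rel_relcycle_exists[OF open_balls_openin open_balls_cover[OF S] c])
  fix d
  assume d: "singular_relcycle p (top_of_set S) {} d" "homologous_rel p (top_of_set S) {} c d"
    and f: "\<And>f. f \<in> Poly_Mapping.keys d \<Longrightarrow>
        \<exists>V\<in>{U. \<exists>x r. U = ball x r \<and> U \<subseteq> S}. f \<in> standard_simplex p \<rightarrow> V"
  have "\<exists>x r. g ` standard_simplex p \<subseteq> ball x r \<and> ball x r \<subseteq> S" if g: "g \<in> Poly_Mapping.keys d" for g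
  proof -
    obtain x r where "ball x r \<subseteq> S" "g \<in> standard_simplex p \<rightarrow> ball x r"
      using f[OF g] by blast
    then show ?thesis
      unfolding image_subset_iff_funcset by blast
  qed
  with d show ?thesis by blast
qed

text \<open>
  After subdivision each edge lies in a ball. It differs from the segment with the same ends by a cycle in
  that ball, hence by a boundary.
\<close>

lemma cycle_homologous_to_segments:
  assumes S: "open (S :: complex set)" and c: "singular_relcycle (Suc 0) (top_of_set S) {} c"
  obtains c' where "homologous_rel (Suc 0) (top_of_set S) {} c c'"
    "\<And>f. f \<in> Poly_Mapping.keys c' \<Longrightarrow> \<exists>u v. f = segment_simplex u v \<and> closed_segment u v \<subseteq> S"
proof -
  let ?C = "{U. \<exists>x r. U = ball x r \<and> U \<subseteq> S}" and ?X = "top_of_set S"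
  obtain d where d: "singular_relcycle (Suc 0) ?X {} d" "homologous_rel (Suc 0) ?X {} c d"
    "\<And>f. f \<in> Poly_Mapping.keys d \<Longrightarrow> \<exists>x r. f ` standard_simplex (Suc 0) \<subseteq> ball x r \<and> ball x r \<subseteq> S"
    using cycle_homologous_to_small[OF S c] by blast
  let ?g = "\<lambda>f. segment_simplex (simplex_path f 0) (simplex_path f 1)"
  define c' where "c' = frag_extend (\<lambda>f. frag_of (?g f)) d"
  have *: "singular_relboundary (Suc 0) ?X {} (frag_of f - frag_of (?g f)) \<and>
      closed_segment (simplex_path f 0) (simplex_path f 1) \<subseteq> S" if f: "f \<in> Poly_Mapping.keys d" for f
  proof -
    obtain V where V: "V \<in> ?C" "f ` standard_simplex (Suc 0) \<subseteq> V"
      using d(3)[OF f] by auto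
    have fX: "singular_simplex (Suc 0) ?X f"
      using d(1) f by (auto simp: singular_relcycle_def singular_chain_def)
    have fV: "singular_simplex (Suc 0) (top_of_set V) f"
      using fX V by (auto simp: singular_simplex_def continuous_map_in_subtopology)
    have "simplex_path f 0 \<in> V" "simplex_path f 1 \<in> V"
      using simplex_path_image_subset[of f V] V(2) by auto
    moreover have conV: "convex V" using V(1) by auto
    ultimately have seg: "closed_segment (simplex_path f 0) (simplex_path f 1) \<subseteq> V"
      by (simp add: closed_segment_subset)
    have "simplex_path (?g f) 0 = simplex_path f 0" "simplex_path (?g f) 1 = simplex_path f 1"
      by (simp_all add: simplex_path_segment linepath_def)
    then have "chain_boundary (Suc 0) (frag_of f - frag_of (?g f)) = 0"
      by (simp add: chain_boundary_diff chain_boundary_edge)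
    moreover have "singular_chain (Suc 0) (top_of_set V) (frag_of f - frag_of (?g f))"
      using fV singular_simplex_segment[OF seg] by (intro singular_chain_diff) (auto simp: singular_chain_of)
    ultimately have "singular_relcycle (Suc 0) (top_of_set V) {} (frag_of f - frag_of (?g f))"
      by (simp add: singular_cycle)
    moreover have "V \<noteq> {}" using seg by auto
    ultimately have "singular_relboundary (Suc 0) (top_of_set V) {} (frag_of f - frag_of (?g f))"
      using cycle_in_convex_is_boundary[OF conV] by simp
    moreover have "V \<subseteq> S" using V(1) by auto
    ultimately show ?thesis
      using seg singular_boundary_mono[of V S "Suc 0" euclidean] by auto
  qed
  have "d - c' = frag_extend (\<lambda>f. frag_of f - frag_of (?g f)) d"
  proof -
    have "frag_extend (\<lambda>f. frag_of f - frag_of (?g f)) d = frag_extend frag_of d - frag_extend (\<lambda>f. frag_of (?g f)) d"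
      by (simp add: frag_extend_def frag_cmul_diff2 sum_subtractf)
    then show ?thesis by (simp add: c'_def frag_expansion[symmetric])
  qed
  moreover have "singular_relboundary (Suc 0) ?X {} (frag_extend (\<lambda>f. frag_of f - frag_of (?g f)) d)"
    by (rule singular_relboundary_frag_extend) (use * in blast)
  ultimately have "homologous_rel (Suc 0) ?X {} d c'"
    by (simp add: homologous_rel_def)
  then have "homologous_rel (Suc 0) ?X {} c c'"
    using d(2) homologous_rel_trans by blast
  moreover have "\<exists>u v. f = segment_simplex u v \<and> closed_segment u v \<subseteq> S" if "f \<in> Poly_Mapping.keys c'" for f
  proof -
    have "f \<in> (\<Union>x\<in>Poly_Mapping.keys d. Poly_Mapping.keys (frag_of (?g x)))"
      using that keys_frag_extend unfolding c'_def by fastforce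
    then show ?thesis using * by (auto simp: keys_frag_of)
  qed
  ultimately show ?thesis using that by blast
qed

lemma homologous_smooth_integral_eq:
  assumes "open S" "g holomorphic_on S" "homologous_rel (Suc 0) (top_of_set S) {} c c'"
    "smooth_chain c" "smooth_chain c'"
  shows "chain_integral c g = chain_integral c' g"
proof -
  obtain D where D: "singular_chain (Suc (Suc 0)) (top_of_set S) D" "chain_boundary (Suc (Suc 0)) D = c - c'"
    using assms(3) unfolding homologous_rel_def singular_boundary by auto
  have "smooth_chain (c - c')"
    using assms(4,5) keys_diff[of c c'] by (auto simp: smooth_chain_def)
  then have "chain_integral (c - c') g = 0"
    using chain_integral_boundary[OF assms(1,2) _ D(1)] D(2) by simp
  then show ?thesis by (simp add: chain_integral_chain_sum chain_sum_diff)
qed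

section \<open>Crossings of transversal paths\<close>

text \<open>
  Induction on the number of exceptional points in the interval: a small neighbourhood of one of them is
  cut out, and both remaining pieces contain fewer. The ends of all pieces avoid \<open>T\<close>, so that quantities
  which are undefined on \<open>T\<close> can be followed along the interval.
\<close>

lemma interval_induct_finite:
  fixes T :: "real set"
  assumes fin: "finite T"
    and empty: "\<And>a b. lo \<le> a \<Longrightarrow> a \<le> b \<Longrightarrow> b \<le> hi \<Longrightarrow> T \<inter> {a..b} = {} \<Longrightarrow> P a b"
    and add: "\<And>a b c. lo \<le> a \<Longrightarrow> a \<le> b \<Longrightarrow> b \<le> c \<Longrightarrow> c \<le> hi \<Longrightarrow> a \<notin> T \<Longrightarrow> b \<notin> T \<Longrightarrow> c \<notin> T \<Longrightarrow>
        P a b \<Longrightarrow> P b c \<Longrightarrow> P a c"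
    and loc: "\<And>t. t \<in> T \<Longrightarrow> lo < t \<Longrightarrow> t < hi \<Longrightarrow> \<exists>\<delta>>0. \<forall>\<eta>. 0 < \<eta> \<longrightarrow> \<eta> < \<delta> \<longrightarrow>
        lo \<le> t - \<eta> \<longrightarrow> t + \<eta> \<le> hi \<longrightarrow> T \<inter> {t - \<eta>..t + \<eta>} = {t} \<longrightarrow> P (t - \<eta>) (t + \<eta>)"
    and ab: "lo \<le> a" "a \<le> b" "b \<le> hi" "a \<notin> T" "b \<notin> T"
  shows "P a b"
  using ab
proof (induction "card (T \<inter> {a..b})" arbitrary: a b rule: less_induct)
  case less
  show ?case
  proof (cases "T \<inter> {a..b} = {}")
    case True then show ?thesis using empty less.prems by blast
  next
    case False
    then obtain t where t: "t \<in> T" "a < t" "t < b"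
    proof -
      obtain t where "t \<in> T" "a \<le> t" "t \<le> b" using False by auto
      moreover from this have "t \<noteq> a" "t \<noteq> b" using less.prems by auto
      ultimately show ?thesis using that by force
    qed
    obtain \<delta> where \<delta>: "\<delta> > 0" "\<And>\<eta>. 0 < \<eta> \<Longrightarrow> \<eta> < \<delta> \<Longrightarrow> lo \<le> t - \<eta> \<Longrightarrow> t + \<eta> \<le> hi \<Longrightarrow>
        T \<inter> {t - \<eta>..t + \<eta>} = {t} \<Longrightarrow> P (t - \<eta>) (t + \<eta>)"
    proof -
      have "lo < t" "t < hi" using t less.prems by auto
      then show ?thesis using loc[OF t(1)] that by blast
    qed
    obtain d where d: "d > 0" "\<And>x. x \<in> T \<Longrightarrow> x \<noteq> t \<Longrightarrow> d \<le> dist t x"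
      using finite_set_avoid[OF fin, of t] by blast
    define \<eta> where "\<eta> = min (min \<delta> d) (min (t - a) (b - t)) / 2"
    have \<eta>: "0 < \<eta>" "\<eta> < \<delta>" "\<eta> < d" "\<eta> < t - a" "\<eta> < b - t"
      using \<delta>(1) d(1) t by (auto simp: \<eta>_def min_def)
    have iso: "x = t" if "x \<in> T" "t - \<eta> \<le> x" "x \<le> t + \<eta>" for x
      using d(2)[of x] that \<eta>(3) by (force simp: dist_real_def)
    then have "T \<inter> {t - \<eta>..t + \<eta>} = {t}" using t(1) \<eta>(1) by auto
    then have mid: "P (t - \<eta>) (t + \<eta>)"
      using \<delta>(2) \<eta> less.prems by auto
    have no: "t - \<eta> \<notin> T" "t + \<eta> \<notin> T"
      using iso[of "t - \<eta>"] iso[of "t + \<eta>"] \<eta>(1) by auto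
    have "card (T \<inter> {a..t - \<eta>}) < card (T \<inter> {a..b})" "card (T \<inter> {t + \<eta>..b}) < card (T \<inter> {a..b})"
    proof -
      have "t \<in> T \<inter> {a..b}" "t \<notin> T \<inter> {a..t - \<eta>}" "t \<notin> T \<inter> {t + \<eta>..b}"
        "T \<inter> {a..t - \<eta>} \<subseteq> T \<inter> {a..b}" "T \<inter> {t + \<eta>..b} \<subseteq> T \<inter> {a..b}"
        using t \<eta> by auto
      then have "T \<inter> {a..t - \<eta>} \<subset> T \<inter> {a..b}" "T \<inter> {t + \<eta>..b} \<subset> T \<inter> {a..b}" by blast+
      then show "card (T \<inter> {a..t - \<eta>}) < card (T \<inter> {a..b})" "card (T \<inter> {t + \<eta>..b}) < card (T \<inter> {a..b})"
        using fin by (auto intro: psubset_card_mono)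
    qed
    then have "P a (t - \<eta>)" "P (t + \<eta>) b"
      using less.hyps[of a "t - \<eta>"] less.hyps[of "t + \<eta>" b] less.prems no \<eta> by auto
    moreover have "P a (t + \<eta>)"
      using add[of a "t - \<eta>" "t + \<eta>"] \<open>P a (t - \<eta>)\<close> mid less.prems no \<eta> by auto
    ultimately show ?thesis
      using add[of a "t + \<eta>" b] less.prems no \<eta> by auto
  qed
qed

lemma near_same_sign:
  assumes "\<bar>y - x\<bar> \<le> \<bar>x\<bar> / 4" "x \<noteq> (0::real)"
  shows "0 < y * x"
proof (cases "x > 0")
  case True
  then have "y > 0" using assms by linarith
  with True show ?thesis by simp
next
  case False
  then have "x < 0" "y < 0" using assms by linarith+
  then show ?thesis by (rule mult_neg_neg[rotated])
qed

text \<open>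
  Near a crossing both paths are close to their tangents. If \<open>p s - q t\<close> is a real multiple of \<open>q'\<close>, its
  component along \<open>p'\<close> vanishes, so \<open>s - s0\<close> is small against \<open>t - t0\<close>, and the multiple has the sign of
  \<open>t0 - t\<close>. Hence \<open>p s - q t\<close> avoids one of the two rays along \<open>q'\<close> after the crossing and the other one before
  it: these rays serve as branch cuts of a logarithm below.
\<close>

lemma transversal_crossing_sector:
  fixes p q :: "real \<Rightarrow> complex"
  assumes p: "(p has_vector_derivative p') (at s0)" and q: "(q has_vector_derivative q') (at t0)"
    and eq: "p s0 = q t0" and q0: "q' \<noteq> 0" and im: "Im (p' / q') \<noteq> 0"
  shows "\<exists>\<delta>>0. \<forall>s t. \<bar>s - s0\<bar> < \<delta> \<longrightarrow> \<bar>t - t0\<bar> < \<delta> \<longrightarrow>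
     (t0 < t \<longrightarrow> (p s - q t) / q' \<notin> \<real>\<^sub>\<ge>\<^sub>0) \<and> (t < t0 \<longrightarrow> (p s - q t) / q' \<notin> \<real>\<^sub>\<le>\<^sub>0) \<and>
     (t = t0 \<longrightarrow> s \<noteq> s0 \<longrightarrow> Im ((p s - q t) / q') * Im (p' / q') * (s - s0) > 0)"
proof -
  define \<alpha> where "\<alpha> = p' / q'"
  \<comment> \<open>the permitted relative deviation from the tangents, small enough for the bound \<open>\<bar>Re a\<bar> \<le> \<bar>t - t0\<bar> / 4\<close> below\<close>
  define \<kappa> where "\<kappa> = \<bar>Im \<alpha>\<bar> / (8 * (cmod \<alpha> + 1 / 2))"
  have pos: "0 < \<bar>Im \<alpha>\<bar>" "\<bar>Im \<alpha>\<bar> \<le> cmod \<alpha>" using im by (auto simp: \<alpha>_def abs_Im_le_cmod)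
  have \<kappa>: "\<kappa> > 0" using pos by (simp add: \<kappa>_def add_nonneg_pos)
  have \<kappa>2: "\<kappa> * (8 * (cmod \<alpha> + 1 / 2)) = \<bar>Im \<alpha>\<bar>"
    unfolding \<kappa>_def using pos by (simp add: field_simps)
  then have \<kappa>3: "8 * \<kappa> * cmod \<alpha> + 4 * \<kappa> = \<bar>Im \<alpha>\<bar>" by (simp add: algebra_simps)
  have \<kappa>4: "\<kappa> \<le> \<bar>Im \<alpha>\<bar> / 4" 
  proof -
    have "0 \<le> 8 * \<kappa> * cmod \<alpha>" using \<kappa> by simp
    then show ?thesis using \<kappa>3 by linarith
  qed
  have \<kappa>5: "\<kappa> \<le> 1 / 8"
  proof -
    have "8 * \<kappa> * cmod \<alpha> \<le> 1 * cmod \<alpha>" using \<kappa>3 \<kappa> pos by simp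
    then show ?thesis using pos by (subst (asm) mult_le_cancel_right) auto
  qed
  have "((\<lambda>s. (p s - p s0) / q') has_vector_derivative \<alpha>) (at s0)"
    unfolding \<alpha>_def by (auto intro!: derivative_eq_intros p)
  then have da: "((\<lambda>s. (p s - p s0) / q') has_derivative (\<lambda>h. h *\<^sub>R \<alpha>)) (at s0)"
    by (simp add: has_vector_derivative_def)
  have "((\<lambda>t. (q t - q t0) / q') has_vector_derivative q' / q') (at t0)"
    by (auto intro!: derivative_eq_intros q)
  then have db: "((\<lambda>t. (q t - q t0) / q') has_derivative (\<lambda>h. h *\<^sub>R 1)) (at t0)"
    using q0 by (simp add: has_vector_derivative_def)
  obtain d1 where d1: "d1 > 0" "\<And>s. \<bar>s - s0\<bar> < d1 \<Longrightarrow>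
      cmod ((p s - p s0) / q' - (s - s0) *\<^sub>R \<alpha>) \<le> \<kappa> * \<bar>s - s0\<bar>"
    using da \<kappa> unfolding has_derivative_at_alt by (fastforce simp: diff_divide_distrib)
  obtain d2 where d2: "d2 > 0" "\<And>t. \<bar>t - t0\<bar> < d2 \<Longrightarrow>
      cmod ((q t - q t0) / q' - (t - t0) *\<^sub>R 1) \<le> \<kappa> * \<bar>t - t0\<bar>"
    using db \<kappa> unfolding has_derivative_at_alt by (fastforce simp: diff_divide_distrib)
  show ?thesis
  proof (intro exI[of _ "min d1 d2"] conjI allI impI)
    show "min d1 d2 > 0" using d1 d2 by simp
  next
    fix s t assume st: "\<bar>s - s0\<bar> < min d1 d2" "\<bar>t - t0\<bar> < min d1 d2"
    define a where "a = (p s - p s0) / q'"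
    define b where "b = (q t - q t0) / q'"
    have ab: "(p s - q t) / q' = a - b" by (simp add: a_def b_def eq diff_divide_distrib)
    have A: "cmod (a - (s - s0) *\<^sub>R \<alpha>) \<le> \<kappa> * \<bar>s - s0\<bar>" using d1(2)[of s] st by (simp add: a_def)
    have B: "cmod (b - (t - t0) *\<^sub>R 1) \<le> \<kappa> * \<bar>t - t0\<bar>" using d2(2)[of t] st by (simp add: b_def)
    have Aim: "\<bar>Im a - (s - s0) * Im \<alpha>\<bar> \<le> \<kappa> * \<bar>s - s0\<bar>" using abs_Im_le_cmod[of "a - (s - s0) *\<^sub>R \<alpha>"] A by simp
    have Bim: "\<bar>Im b\<bar> \<le> \<kappa> * \<bar>t - t0\<bar>" using abs_Im_le_cmod[of "b - (t - t0) *\<^sub>R 1"] B by simp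
    have Bre: "\<bar>Re b - (t - t0)\<bar> \<le> \<kappa> * \<bar>t - t0\<bar>" using abs_Re_le_cmod[of "b - (t - t0) *\<^sub>R 1"] B by simp
    have Bre': "\<bar>Re b - (t - t0)\<bar> \<le> \<bar>t - t0\<bar> / 8"
      using Bre \<kappa>5 mult_right_mono[OF \<kappa>5, of "\<bar>t - t0\<bar>"] by simp
    \<comment> \<open>if \<open>p s - q t\<close> is parallel to \<open>q'\<close>, then \<open>s - s0\<close> and with it \<open>a\<close> are small against \<open>t - t0\<close>\<close>
    have real: "\<bar>Re a\<bar> \<le> \<bar>t - t0\<bar> / 4" if "Im a = Im b"
    proof -
      have "\<bar>Im \<alpha>\<bar> * \<bar>s - s0\<bar> \<le> \<kappa> * \<bar>s - s0\<bar> + \<kappa> * \<bar>t - t0\<bar>"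
        using Aim Bim that by (simp add: abs_mult[symmetric] mult.commute) 
      moreover have "\<kappa> * \<bar>s - s0\<bar> \<le> \<bar>Im \<alpha>\<bar> / 4 * \<bar>s - s0\<bar>" using \<kappa>4 by (rule mult_right_mono) simp
      moreover have "0 \<le> \<kappa> * \<bar>t - t0\<bar>" "0 \<le> \<bar>Im \<alpha>\<bar> * \<bar>s - s0\<bar>" using \<kappa> by simp_all
      ultimately have "\<bar>Im \<alpha>\<bar> * \<bar>s - s0\<bar> \<le> 2 * (\<kappa> * \<bar>t - t0\<bar>)" by linarith
      then have "(cmod \<alpha> + 1 / 2) * (\<bar>Im \<alpha>\<bar> * \<bar>s - s0\<bar>) \<le> (cmod \<alpha> + 1 / 2) * (2 * (\<kappa> * \<bar>t - t0\<bar>))"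
        by (intro mult_left_mono) auto
      also have "\<dots> = \<bar>Im \<alpha>\<bar> * (\<bar>t - t0\<bar> / 4)" unfolding \<kappa>2[symmetric] by (simp add: algebra_simps)
      finally have "\<bar>Im \<alpha>\<bar> * ((cmod \<alpha> + 1 / 2) * \<bar>s - s0\<bar>) \<le> \<bar>Im \<alpha>\<bar> * (\<bar>t - t0\<bar> / 4)"
        by (simp add: algebra_simps)
      then have 1: "(cmod \<alpha> + 1 / 2) * \<bar>s - s0\<bar> \<le> \<bar>t - t0\<bar> / 4"
        using pos(1) by (simp only: mult_le_cancel_left_pos)
      have "\<bar>Re a\<bar> \<le> cmod a" by (rule abs_Re_le_cmod)
      also have "\<dots> \<le> cmod ((s - s0) *\<^sub>R \<alpha>) + cmod (a - (s - s0) *\<^sub>R \<alpha>)"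
        using norm_triangle_ineq[of "(s - s0) *\<^sub>R \<alpha>" "a - (s - s0) *\<^sub>R \<alpha>"] by simp
      also have "\<dots> \<le> cmod \<alpha> * \<bar>s - s0\<bar> + 1 / 2 * \<bar>s - s0\<bar>"
      proof -
        have "\<kappa> * \<bar>s - s0\<bar> \<le> 1 / 2 * \<bar>s - s0\<bar>" using \<kappa>5 by (intro mult_right_mono) auto
        then show ?thesis using A by (simp add: mult.commute)
      qed
      finally show ?thesis using 1 by (simp add: algebra_simps)
    qed
    show "(p s - q t) / q' \<notin> \<real>\<^sub>\<ge>\<^sub>0" if "t0 < t"
    proof
      assume "(p s - q t) / q' \<in> \<real>\<^sub>\<ge>\<^sub>0"
      then have "Im a = Im b" "Re a \<ge> Re b" by (auto simp: ab complex_nonneg_Reals_iff)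
      then show False using real Bre' that by (simp add: abs_if split: if_splits)
    qed
    show "(p s - q t) / q' \<notin> \<real>\<^sub>\<le>\<^sub>0" if "t < t0"
    proof
      assume "(p s - q t) / q' \<in> \<real>\<^sub>\<le>\<^sub>0"
      then have "Im a = Im b" "Re a \<le> Re b" by (auto simp: ab complex_nonpos_Reals_iff)
      then show False using real Bre' that by (simp add: abs_if split: if_splits)
    qed
    show "0 < Im ((p s - q t) / q') * Im (p' / q') * (s - s0)" if "t = t0" "s \<noteq> s0"
    proof -
      have b0: "b = 0" using that by (simp add: b_def)
      let ?x = "(s - s0) * Im \<alpha>"
      have "\<kappa> * \<bar>s - s0\<bar> \<le> \<bar>Im \<alpha>\<bar> / 4 * \<bar>s - s0\<bar>" using \<kappa>4 by (rule mult_right_mono) simp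
      then have "\<bar>Im a - ?x\<bar> \<le> \<bar>?x\<bar> / 4" using Aim by (simp add: abs_mult mult.commute)
      moreover have "?x \<noteq> 0" using that pos by auto
      ultimately have "Im a * ?x > 0"
        by (rule near_same_sign)
      then show ?thesis unfolding ab b0 by (simp add: \<alpha>_def algebra_simps)
    qed
  qed
qed

lemma transversal_derivatives:
  assumes "transversal p q" "(s, t) \<in> crossings p q"
  obtains p' q' where "(p has_vector_derivative p') (at s)" "(q has_vector_derivative q') (at t)"
    "q' \<noteq> 0" "Im (p' / q') \<noteq> 0" "p s = q t" "s \<in> {0<..<1}" "t \<in> {0<..<1}"
    "(crossing_det p q s t > 0) = (Im (p' / q') < 0)"
proof -
  let ?p = "vector_derivative p (at s)" and ?q = "vector_derivative q (at t)"
  have *: "s \<in> {0<..<1}" "t \<in> {0<..<1}" "p differentiable at s" "q differentiable at t"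
    "crossing_det p q s t \<noteq> 0" "p s = q t"
    using assms by (auto simp: transversal_def crossings_def)
  have q0: "?q \<noteq> 0" using *(5) by (auto simp: crossing_det_def)
  have "crossing_det p q s t = - Im (?p / ?q) * (cmod ?q)\<^sup>2"
  proof -
    have "?p * cnj ?q = ?p / ?q * of_real ((cmod ?q)\<^sup>2)"
      unfolding complex_norm_square using q0 by simp
    then have "Im (?p * cnj ?q) = Im (?p / ?q) * (cmod ?q)\<^sup>2"
      by (simp only: Im_complex_of_real Re_complex_of_real times_complex.sel mult_zero_right add_0_left)
    then show ?thesis by (simp add: crossing_det_def algebra_simps)
  qed
  moreover have "(cmod ?q)\<^sup>2 > 0" using q0 by simp
  ultimately have "Im (?p / ?q) \<noteq> 0" "(crossing_det p q s t > 0) = (Im (?p / ?q) < 0)"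
    using *(5) by (auto simp: zero_less_mult_iff mult_less_0_iff)
  then show ?thesis
    using that[of ?p ?q] * q0 by (auto simp: vector_derivative_works)
qed

text \<open>
  A limit point of the set of crossings would be a crossing with other crossings arbitrarily close, which
  the sectors exclude.
\<close>

lemma finite_crossings:
  assumes "transversal p q" "path p" "path q"
  shows "finite (crossings p q)"
proof (rule ccontr)
  assume inf: "infinite (crossings p q)"
  have eq: "crossings p q = {x \<in> {0..1} \<times> {0..1}. p (fst x) - q (snd x) = 0}"
    by (auto simp: crossings_def)
  have "closed (crossings p q)"
  proof -
    have "continuous_on ({0..1} \<times> {0..1}) (\<lambda>x. p (fst x))" "continuous_on ({0..1} \<times> {0..1}) (\<lambda>x. q (snd x))"
      using assms(2,3) unfolding path_def
      by (auto intro!: continuous_on_compose2[OF _ continuous_on_fst[OF continuous_on_id]]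
          continuous_on_compose2[OF _ continuous_on_snd[OF continuous_on_id]])
    then show ?thesis
      unfolding eq
      by (intro continuous_closed_preimage_constant continuous_on_diff closed_Times) auto
  qed
  moreover have "bounded (crossings p q)"
    by (rule bounded_subset[of "{0..1} \<times> {0..1}"]) (auto simp: crossings_def intro: bounded_Times)
  ultimately have "compact (crossings p q)" by (simp add: compact_eq_bounded_closed)
  then obtain x where x: "x \<in> crossings p q" "x islimpt crossings p q"
    using inf unfolding compact_eq_Bolzano_Weierstrass by blast
  obtain s0 t0 where st0: "x = (s0, t0)" by force
  obtain p' q' where pq: "(p has_vector_derivative p') (at s0)" "(q has_vector_derivative q') (at t0)"
    "q' \<noteq> 0" "Im (p' / q') \<noteq> 0" "p s0 = q t0"
    using transversal_derivatives[OF assms(1), of s0 t0] x st0 by metis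
  obtain \<delta> where \<delta>: "\<delta> > 0" "\<And>s t. \<bar>s - s0\<bar> < \<delta> \<Longrightarrow> \<bar>t - t0\<bar> < \<delta> \<Longrightarrow>
     (t0 < t \<longrightarrow> (p s - q t) / q' \<notin> \<real>\<^sub>\<ge>\<^sub>0) \<and> (t < t0 \<longrightarrow> (p s - q t) / q' \<notin> \<real>\<^sub>\<le>\<^sub>0) \<and>
     (t = t0 \<longrightarrow> s \<noteq> s0 \<longrightarrow> Im ((p s - q t) / q') * Im (p' / q') * (s - s0) > 0)"
    using transversal_crossing_sector[OF pq(1,2,5,3,4)] by blast
  obtain y where y: "y \<in> crossings p q" "y \<noteq> x" "dist y x < \<delta>"
    using x(2) \<delta>(1) by (meson islimpt_approachable)
  obtain s t where st: "y = (s, t)" by force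
  have "\<bar>s - s0\<bar> < \<delta>" "\<bar>t - t0\<bar> < \<delta>"
    using y(3) dist_fst_le[of y x] dist_snd_le[of y x] by (auto simp: st st0 dist_real_def)
  from \<delta>(2)[OF this] y(1,2) show False
    by (cases t t0 rule: linorder_cases) (auto simp: st st0 crossings_def)
qed

section \<open>Jumps of winding numbers\<close>

lemma winding_number_eq_Ln:
  assumes p: "valid_path p" and u: "u \<noteq> 0"
    and cut: "\<And>x. x \<in> path_image p \<Longrightarrow> (x - w) * u \<notin> \<real>\<^sub>\<le>\<^sub>0"
  shows "winding_number p w =
    (Ln ((pathfinish p - w) * u) - Ln ((pathstart p - w) * u)) / (2 * of_real pi * \<i>)"
proof -
  have w: "w \<notin> path_image p" using cut[of w] by auto
  have "((\<lambda>x. 1 / (x - w)) has_contour_integral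
      (Ln ((pathfinish p - w) * u) - Ln ((pathstart p - w) * u))) p"
  proof (rule contour_integral_primitive[where S = "path_image p", OF _ p order_refl])
    fix x assume x: "x \<in> path_image p"
    then have "x \<noteq> w" using w by auto
    have "((\<lambda>x. (x - w) * u) has_field_derivative u) (at x within path_image p)"
      by (auto intro!: derivative_eq_intros)
    from DERIV_chain2[OF has_field_derivative_Ln[OF cut[OF x]] this]
    have "((\<lambda>x. Ln ((x - w) * u)) has_field_derivative inverse ((x - w) * u) * u) (at x within path_image p)" .
    moreover have "inverse ((x - w) * u) * u = 1 / (x - w)"
      using u \<open>x \<noteq> w\<close> by (simp add: inverse_eq_divide)
    ultimately show "((\<lambda>x. Ln ((x - w) * u)) has_field_derivative 1 / (x - w)) (at x within path_image p)"
      by (simp only:)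
  qed
  then show ?thesis
    by (simp add: winding_number_valid_path[OF p w] contour_integral_unique)
qed

lemma Ln_minus_diff:
  assumes "Im z \<noteq> 0"
  shows "Ln (- z) - Ln z = (if Im z < 0 then \<i> * of_real pi else - \<i> * of_real pi)"
  using assms Ln_minus[of z] by (auto simp: complex_eq_iff)

text \<open>
  For \<open>t\<close> on either side of \<open>t0\<close> the winding number of the short arc around \<open>q t\<close> is a difference of two
  values of a logarithm; the cuts on the two sides are opposite rays. All these values have limits as
  \<open>t\<close> tends to \<open>t0\<close>. The two branches differ by \<open>\<plusminus>\<i> \<pi>\<close>, with opposite signs at the two ends of the arc,
  because these lie on different sides of the line spanned by \<open>q'\<close>. Together this makes one full turn.
\<close>

lemma winding_number_local_jump:
  fixes p q :: "real \<Rightarrow> complex"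
  assumes vp: "valid_path p"
    and p: "(p has_vector_derivative p') (at s0)" and q: "(q has_vector_derivative q') (at t0)"
    and eq: "p s0 = q t0" and q0: "q' \<noteq> 0" and im: "Im (p' / q') \<noteq> 0"
  shows "\<exists>\<delta>>0. \<forall>\<eta>. 0 < \<eta> \<longrightarrow> \<eta> < \<delta> \<longrightarrow> 0 \<le> s0 - \<eta> \<longrightarrow> s0 + \<eta> \<le> 1 \<longrightarrow>
    ((\<lambda>\<epsilon>. winding_number (subpath (s0 - \<eta>) (s0 + \<eta>) p) (q (t0 + \<epsilon>)) -
         winding_number (subpath (s0 - \<eta>) (s0 + \<eta>) p) (q (t0 - \<epsilon>)))
      \<longlongrightarrow> (if Im (p' / q') < 0 then 1 else - 1)) (at_right 0)"
proof -
  obtain \<delta> where \<delta>: "\<delta> > 0" "\<And>s t. \<bar>s - s0\<bar> < \<delta> \<Longrightarrow> \<bar>t - t0\<bar> < \<delta> \<Longrightarrow>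
     (t0 < t \<longrightarrow> (p s - q t) / q' \<notin> \<real>\<^sub>\<ge>\<^sub>0) \<and> (t < t0 \<longrightarrow> (p s - q t) / q' \<notin> \<real>\<^sub>\<le>\<^sub>0) \<and>
     (t = t0 \<longrightarrow> s \<noteq> s0 \<longrightarrow> Im ((p s - q t) / q') * Im (p' / q') * (s - s0) > 0)"
    using transversal_crossing_sector[OF p q eq q0 im] by blast
  have "((\<lambda>\<epsilon>. winding_number (subpath (s0 - \<eta>) (s0 + \<eta>) p) (q (t0 + \<epsilon>)) -
         winding_number (subpath (s0 - \<eta>) (s0 + \<eta>) p) (q (t0 - \<epsilon>)))
      \<longlongrightarrow> (if Im (p' / q') < 0 then 1 else - 1)) (at_right 0)"
    if \<eta>: "0 < \<eta>" "\<eta> < \<delta>" "0 \<le> s0 - \<eta>" "s0 + \<eta> \<le> 1" for \<eta>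
  proof -
    let ?\<gamma> = "subpath (s0 - \<eta>) (s0 + \<eta>) p"
    let ?A = "\<lambda>t. (p (s0 + \<eta>) - q t) / q'" and ?B = "\<lambda>t. (p (s0 - \<eta>) - q t) / q'"
    have v: "valid_path ?\<gamma>" using \<eta> by (intro valid_path_subpath vp) auto
    have ends: "pathstart ?\<gamma> = p (s0 - \<eta>)" "pathfinish ?\<gamma> = p (s0 + \<eta>)" by auto
    have img: "path_image ?\<gamma> = p ` {s0 - \<eta>..s0 + \<eta>}" using \<eta> by (simp add: path_image_subpath)
    have plus: "winding_number ?\<gamma> (q t) = (Ln (- ?A t) - Ln (- ?B t)) / (2 * of_real pi * \<i>)"
      if "t0 < t" "t < t0 + \<delta>" for t
    proof -
      have "(x - q t) * (- 1 / q') \<notin> \<real>\<^sub>\<le>\<^sub>0" if x: "x \<in> path_image ?\<gamma>" for x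
      proof -
        obtain s where s: "x = p s" "\<bar>s - s0\<bar> < \<delta>" using x \<eta> unfolding img by (auto simp: abs_if)
        have "(p s - q t) / q' \<notin> \<real>\<^sub>\<ge>\<^sub>0"
          using \<delta>(2)[OF s(2), of t] \<open>t0 < t\<close> \<open>t < t0 + \<delta>\<close> by auto
        then show ?thesis unfolding s by (auto simp: complex_nonpos_Reals_iff complex_nonneg_Reals_iff)
      qed
      from winding_number_eq_Ln[OF v _ this] show ?thesis using q0 by (simp add: ends)
    qed
    have minus: "winding_number ?\<gamma> (q t) = (Ln (?A t) - Ln (?B t)) / (2 * of_real pi * \<i>)"
      if "t < t0" "t0 - \<delta> < t" for t
    proof -
      have "(x - q t) * (1 / q') \<notin> \<real>\<^sub>\<le>\<^sub>0" if x: "x \<in> path_image ?\<gamma>" for x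
      proof -
        obtain s where s: "x = p s" "\<bar>s - s0\<bar> < \<delta>" using x \<eta> unfolding img by (auto simp: abs_if)
        have "(p s - q t) / q' \<notin> \<real>\<^sub>\<le>\<^sub>0"
          using \<delta>(2)[OF s(2), of t] \<open>t < t0\<close> \<open>t0 - \<delta> < t\<close> by auto
        then show ?thesis unfolding s by simp
      qed
      from winding_number_eq_Ln[OF v _ this] show ?thesis using q0 by (simp add: ends)
    qed
    have sA: "Im (?A t0) * Im (p' / q') > 0"
    proof -
      have "Im (?A t0) * Im (p' / q') * \<eta> > 0" using \<delta>(2)[of "s0 + \<eta>" t0] \<eta> \<delta>(1) by simp
      then show ?thesis using \<eta>(1) by (simp only: zero_less_mult_pos2)
    qed
    have sB: "Im (?B t0) * Im (p' / q') < 0"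
    proof -
      have "Im (?B t0) * Im (p' / q') * (- \<eta>) > 0" using \<delta>(2)[of "s0 - \<eta>" t0] \<eta> \<delta>(1) by simp
      then show ?thesis using \<eta>(1) by (simp add: mult_less_0_iff zero_less_mult_iff)
    qed
    have nr: "?A t0 \<notin> \<real>\<^sub>\<le>\<^sub>0" "?B t0 \<notin> \<real>\<^sub>\<le>\<^sub>0" "- ?A t0 \<notin> \<real>\<^sub>\<le>\<^sub>0" "- ?B t0 \<notin> \<real>\<^sub>\<le>\<^sub>0"
      using sA sB by (auto simp: complex_nonpos_Reals_iff)
    have "isCont q t0"
      using q by (rule has_vector_derivative_continuous)
    then have qlim: "((\<lambda>\<epsilon>. q (t0 + \<epsilon>)) \<longlongrightarrow> q t0) (at_right 0)" "((\<lambda>\<epsilon>. q (t0 - \<epsilon>)) \<longlongrightarrow> q t0) (at_right 0)"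
      by (rule isCont_tendsto_compose, auto intro!: tendsto_eq_intros)+
    have lim: "((\<lambda>\<epsilon>. (Ln (- ?A (t0 + \<epsilon>)) - Ln (- ?B (t0 + \<epsilon>))) / (2 * of_real pi * \<i>) -
        (Ln (?A (t0 - \<epsilon>)) - Ln (?B (t0 - \<epsilon>))) / (2 * of_real pi * \<i>)) \<longlongrightarrow>
        (Ln (- ?A t0) - Ln (- ?B t0)) / (2 * of_real pi * \<i>) -
        (Ln (?A t0) - Ln (?B t0)) / (2 * of_real pi * \<i>)) (at_right 0)"
      by (intro tendsto_intros qlim nr) (use q0 in auto)
    have "(Ln (- ?A t0) - Ln (- ?B t0)) / (2 * of_real pi * \<i>) -
        (Ln (?A t0) - Ln (?B t0)) / (2 * of_real pi * \<i>) =
        ((Ln (- ?A t0) - Ln (?A t0)) - (Ln (- ?B t0) - Ln (?B t0))) / (2 * of_real pi * \<i>)"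
      by (simp add: diff_divide_distrib)
    also have "\<dots> = (if Im (p' / q') < 0 then 1 else - 1)"
    proof (cases "Im (p' / q') < 0")
      case True
      then have "Im (?A t0) < 0" "\<not> Im (?B t0) < 0" "Im (?B t0) \<noteq> 0"
        using sA sB by (auto simp: zero_less_mult_iff mult_less_0_iff)
      then show ?thesis using True by (subst (1 2) Ln_minus_diff) auto
    next
      case False
      then have "\<not> Im (?A t0) < 0" "Im (?A t0) \<noteq> 0" "Im (?B t0) < 0"
        using sA sB by (auto simp: zero_less_mult_iff mult_less_0_iff)
      then show ?thesis using False by (subst (1 2) Ln_minus_diff) auto
    qed
    finally have val: "(Ln (- ?A t0) - Ln (- ?B t0)) / (2 * of_real pi * \<i>) -
        (Ln (?A t0) - Ln (?B t0)) / (2 * of_real pi * \<i>) = (if Im (p' / q') < 0 then 1 else - 1)" .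
    show ?thesis
    proof (rule Lim_transform_eventually[OF lim[unfolded val]])
      show "\<forall>\<^sub>F \<epsilon> in at_right 0. (Ln (- ?A (t0 + \<epsilon>)) - Ln (- ?B (t0 + \<epsilon>))) / (2 * of_real pi * \<i>) -
        (Ln (?A (t0 - \<epsilon>)) - Ln (?B (t0 - \<epsilon>))) / (2 * of_real pi * \<i>) =
        winding_number ?\<gamma> (q (t0 + \<epsilon>)) - winding_number ?\<gamma> (q (t0 - \<epsilon>))"
        unfolding eventually_at_right_field
        using \<delta>(1) by (intro exI[of _ \<delta>]) (auto simp: plus minus)
    qed
  qed
  with \<delta>(1) show ?thesis by blast
qed

abbreviation crossing_sign :: "(real \<Rightarrow> complex) \<Rightarrow> (real \<Rightarrow> complex) \<Rightarrow> real \<times> real \<Rightarrow> int" where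
  "crossing_sign p q x \<equiv> (if crossing_det p q (fst x) (snd x) > 0 then 1 else - 1)"

lemma eventually_off_finite:
  fixes F :: "real set"
  assumes "finite F" "lo < t0" "t0 < hi"
  shows "\<forall>\<^sub>F \<epsilon> in at_right 0. 0 < \<epsilon> \<and> t0 + \<epsilon> \<notin> F \<and> t0 - \<epsilon> \<notin> F \<and> lo < t0 - \<epsilon> \<and> t0 + \<epsilon> < hi"
proof -
  obtain d where d: "d > 0" "\<And>x. x \<in> F \<Longrightarrow> x \<noteq> t0 \<Longrightarrow> d \<le> dist t0 x"
    using finite_set_avoid[OF assms(1), of t0] by blast
  let ?b = "min d (min (t0 - lo) (hi - t0))"
  have "0 < \<epsilon> \<and> t0 + \<epsilon> \<notin> F \<and> t0 - \<epsilon> \<notin> F \<and> lo < t0 - \<epsilon> \<and> t0 + \<epsilon> < hi" if "0 < \<epsilon>" "\<epsilon> < ?b" for \<epsilon>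
    using that d(2)[of "t0 + \<epsilon>"] d(2)[of "t0 - \<epsilon>"] by (auto simp: dist_real_def)
  moreover have "0 < ?b" using d(1) assms by simp
  ultimately show ?thesis unfolding eventually_at_right_field by blast
qed

lemma not_crossing_time:
  assumes "t \<in> {0..1}" "t \<notin> snd ` crossings p q"
  shows "q t \<notin> path_image p"
  using assms by (force simp: crossings_def path_image_def)

text \<open>
  The path \<open>p\<close> may pass through \<open>q t0\<close> several times. Arcs away from these passages do not contribute,
  because their winding number is continuous at \<open>q t0\<close>, and each passage contributes its local jump.
  The difference is taken symmetrically around \<open>t0\<close> because the winding number makes no sense at \<open>t0\<close> itself.
\<close>

lemma winding_number_jump:
  fixes p q :: "real \<Rightarrow> complex"
  assumes tr: "transversal p q" and vp: "valid_path p" and pq: "path q" and t0: "t0 \<in> {0<..<1}"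
  shows "((\<lambda>\<epsilon>. winding_number p (q (t0 + \<epsilon>)) - winding_number p (q (t0 - \<epsilon>))) \<longlongrightarrow>
     of_int (\<Sum>x\<in>{x\<in>crossings p q. snd x = t0}. crossing_sign p q x)) (at_right 0)"
proof -
  have pp: "path p" using vp by (rule valid_path_imp_path)
  have fin: "finite (crossings p q)" by (rule finite_crossings[OF tr pp pq])
  define T where "T = {s. (s, t0) \<in> crossings p q}"
  have finT: "finite T"
    by (rule finite_subset[of _ "fst ` crossings p q"]) (use fin in \<open>force simp: T_def\<close>)+
  let ?g = "\<lambda>s. of_int (crossing_sign p q (s, t0)) :: complex"
  define P where "P = (\<lambda>a b. ((\<lambda>\<epsilon>. winding_number (subpath a b p) (q (t0 + \<epsilon>)) -
      winding_number (subpath a b p) (q (t0 - \<epsilon>))) \<longlongrightarrow> (\<Sum>s\<in>T \<inter> {a..b}. ?g s)) (at_right 0))"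
  have "isCont q t0"
    using pq t0 unfolding path_def by (intro continuous_on_interior) auto
  then have qlim: "((\<lambda>\<epsilon>. q (t0 + \<epsilon>)) \<longlongrightarrow> q t0) (at_right 0)" "((\<lambda>\<epsilon>. q (t0 - \<epsilon>)) \<longlongrightarrow> q t0) (at_right 0)"
    by (rule isCont_tendsto_compose, auto intro!: tendsto_eq_intros)+
  have off: "\<forall>\<^sub>F \<epsilon> in at_right 0. q (t0 + \<epsilon>) \<notin> path_image p \<and> q (t0 - \<epsilon>) \<notin> path_image p"
  proof -
    have "\<forall>\<^sub>F \<epsilon> in at_right 0. 0 < \<epsilon> \<and> t0 + \<epsilon> \<notin> snd ` crossings p q \<and>
        t0 - \<epsilon> \<notin> snd ` crossings p q \<and> 0 < t0 - \<epsilon> \<and> t0 + \<epsilon> < 1"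
      by (rule eventually_off_finite) (use fin t0 in auto)
    then show ?thesis
    proof eventually_elim
      case (elim \<epsilon>)
      then show ?case
        using not_crossing_time[of "t0 + \<epsilon>" p q] not_crossing_time[of "t0 - \<epsilon>" p q] by auto
    qed
  qed
  have "P 0 1"
  proof (rule interval_induct_finite[OF finT, where lo = 0 and hi = 1])
    fix a b :: real assume ab: "0 \<le> a" "a \<le> b" "b \<le> 1" "T \<inter> {a..b} = {}"
    have "q t0 \<notin> p ` {a..b}"
    proof
      assume "q t0 \<in> p ` {a..b}"
      then obtain s where s: "s \<in> {a..b}" "p s = q t0" by auto
      then have "s \<in> T" using ab t0 by (auto simp: T_def crossings_def)
      then show False using ab s by auto
    qed
    then have "q t0 \<notin> path_image (subpath a b p)" using ab by (simp add: path_image_subpath)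
    moreover have "path (subpath a b p)" using ab pp by auto
    ultimately have c: "isCont (winding_number (subpath a b p)) (q t0)"
      by (intro continuous_at_winding_number)
    have "((\<lambda>\<epsilon>. winding_number (subpath a b p) (q (t0 + \<epsilon>)) -
      winding_number (subpath a b p) (q (t0 - \<epsilon>))) \<longlongrightarrow> winding_number (subpath a b p) (q t0) -
      winding_number (subpath a b p) (q t0)) (at_right 0)"
      by (intro tendsto_diff isCont_tendsto_compose[OF c] qlim)
    then show "P a b" using ab(4) by (simp add: P_def)
  next
    fix a b c :: real
    assume abc: "0 \<le> a" "a \<le> b" "b \<le> c" "c \<le> 1" "b \<notin> T" and P: "P a b" "P b c"
    have "(\<Sum>s\<in>T \<inter> {a..c}. ?g s) = (\<Sum>s\<in>T \<inter> {a..b}. ?g s) + (\<Sum>s\<in>T \<inter> {b..c}. ?g s)"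
    proof -
      have "T \<inter> {a..c} = (T \<inter> {a..b}) \<union> (T \<inter> {b..c})" "(T \<inter> {a..b}) \<inter> (T \<inter> {b..c}) = {}"
        using abc by force+
      then show ?thesis using finT by (simp add: sum.union_disjoint)
    qed
    moreover have "((\<lambda>\<epsilon>. winding_number (subpath a c p) (q (t0 + \<epsilon>)) -
      winding_number (subpath a c p) (q (t0 - \<epsilon>))) \<longlongrightarrow> (\<Sum>s\<in>T \<inter> {a..b}. ?g s) + (\<Sum>s\<in>T \<inter> {b..c}. ?g s)) (at_right 0)"
    proof (rule Lim_transform_eventually[OF tendsto_add[OF P[unfolded P_def]]])
      show "\<forall>\<^sub>F \<epsilon> in at_right 0. winding_number (subpath a b p) (q (t0 + \<epsilon>)) -
          winding_number (subpath a b p) (q (t0 - \<epsilon>)) +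
          (winding_number (subpath b c p) (q (t0 + \<epsilon>)) - winding_number (subpath b c p) (q (t0 - \<epsilon>))) =
          winding_number (subpath a c p) (q (t0 + \<epsilon>)) - winding_number (subpath a c p) (q (t0 - \<epsilon>))"
        using off
      proof eventually_elim
        case (elim \<epsilon>)
        have "winding_number (subpath a b p) w + winding_number (subpath b c p) w = winding_number (subpath a c p) w"
          if "w \<notin> path_image p" for w
          using abc by (intro winding_number_subpath_combine[OF pp that]) auto
        from this[of "q (t0 + \<epsilon>)"] this[of "q (t0 - \<epsilon>)"] elim show ?case by (simp add: algebra_simps)
      qed
    qed
    ultimately show "P a c" by (simp add: P_def)
  next
    fix s0 assume s0: "s0 \<in> T" "0 < s0" "s0 < 1"
    then have cr: "(s0, t0) \<in> crossings p q" by (simp add: T_def)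
    obtain p' q' where d: "(p has_vector_derivative p') (at s0)" "(q has_vector_derivative q') (at t0)"
      "q' \<noteq> 0" "Im (p' / q') \<noteq> 0" "p s0 = q t0" "(crossing_det p q s0 t0 > 0) = (Im (p' / q') < 0)"
      using transversal_derivatives[OF tr cr] by metis
    show "\<exists>\<delta>>0. \<forall>\<eta>. 0 < \<eta> \<longrightarrow> \<eta> < \<delta> \<longrightarrow> 0 \<le> s0 - \<eta> \<longrightarrow> s0 + \<eta> \<le> 1 \<longrightarrow>
        T \<inter> {s0 - \<eta>..s0 + \<eta>} = {s0} \<longrightarrow> P (s0 - \<eta>) (s0 + \<eta>)"
    proof -
      obtain \<delta> where \<delta>: "\<delta> > 0" "\<And>\<eta>. 0 < \<eta> \<Longrightarrow> \<eta> < \<delta> \<Longrightarrow> 0 \<le> s0 - \<eta> \<Longrightarrow> s0 + \<eta> \<le> 1 \<Longrightarrow>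
          ((\<lambda>\<epsilon>. winding_number (subpath (s0 - \<eta>) (s0 + \<eta>) p) (q (t0 + \<epsilon>)) -
          winding_number (subpath (s0 - \<eta>) (s0 + \<eta>) p) (q (t0 - \<epsilon>)))
          \<longlongrightarrow> (if Im (p' / q') < 0 then 1 else - 1)) (at_right 0)"
        using winding_number_local_jump[OF vp d(1,2,5,3,4)] by blast
      have "?g s0 = (if Im (p' / q') < 0 then 1 else - 1)" using d(6) by simp
      then have "P (s0 - \<eta>) (s0 + \<eta>)" if "0 < \<eta>" "\<eta> < \<delta>" "0 \<le> s0 - \<eta>" "s0 + \<eta> \<le> 1"
        "T \<inter> {s0 - \<eta>..s0 + \<eta>} = {s0}" for \<eta>
        unfolding P_def that(5) using \<delta>(2)[OF that(1-4)] by simp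
      with \<delta>(1) show ?thesis by blast
    qed
  next
    have "x \<in> {0<..<1}" if "x \<in> T" for x
      using that tr by (auto simp: T_def transversal_def)
    then show "0 \<notin> T" "1 \<notin> T" by force+
  qed auto
  moreover have "(\<Sum>s\<in>T \<inter> {0..1}. ?g s) =
      of_int (\<Sum>x\<in>{x\<in>crossings p q. snd x = t0}. crossing_sign p q x)"
  proof -
    have "{x\<in>crossings p q. snd x = t0} = (\<lambda>s. (s, t0)) ` (T \<inter> {0..1})"
      by (force simp: T_def crossings_def)
    then show ?thesis by (simp add: sum.reindex inj_on_def)
  qed
  ultimately show ?thesis by (simp add: P_def)
qed

section \<open>Winding numbers of cycles and intersection numbers\<close>

definition chain_winding :: "complex chain \<Rightarrow> complex \<Rightarrow> complex" where
  "chain_winding c w = chain_sum c (\<lambda>f. winding_number (simplex_path f) w)"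

lemma smooth_chainD: "smooth_chain c \<Longrightarrow> f \<in> Poly_Mapping.keys c \<Longrightarrow> valid_path (simplex_path f)"
  by (simp add: smooth_chain_def)

lemma chain_sum_Ints:
  assumes "\<And>f. f \<in> Poly_Mapping.keys c \<Longrightarrow> F f \<in> \<int>"
  shows "chain_sum c F \<in> \<int>"
  using assms by (auto simp: chain_sum_def intro!: Ints_sum Ints_mult)

lemma exp_2pi_eq_1_imp_Ints:
  assumes "exp (2 * of_real pi * \<i> * z) = 1"
  shows "z \<in> \<int>"
proof -
  obtain n :: int where "2 * of_real pi * \<i> * z = of_int (2 * n) * pi * \<i>"
    using assms unfolding exp_eq_1 by (auto simp: complex_eq_iff)
  then have "z = of_int n" by simp
  then show ?thesis by simp
qed

text \<open>
  The winding number of a single edge is an increment of \<open>Ln (x - w) / (2 \<pi> \<i>)\<close> up to an integer, and the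
  increments cancel over a cycle.
\<close>

lemma chain_winding_Ints:
  assumes c: "smooth_chain c" "chain_boundary (Suc 0) c = 0"
    and w: "\<And>f. f \<in> Poly_Mapping.keys c \<Longrightarrow> w \<notin> path_image (simplex_path f)"
  shows "chain_winding c w \<in> \<int>"
proof -
  let ?Q = "\<lambda>x. Ln (x - w) / (2 * of_real pi * \<i>)"
  have "chain_winding c w = chain_sum c (\<lambda>f. winding_number (simplex_path f) w) -
      chain_sum c (\<lambda>f. ?Q (simplex_path f 1) - ?Q (simplex_path f 0))"
    unfolding chain_winding_def using chain_sum_ends_cycle[OF c(2), of ?Q] by simp
  also have "\<dots> = chain_sum c (\<lambda>f. winding_number (simplex_path f) w - (?Q (simplex_path f 1) - ?Q (simplex_path f 0)))"
    by (simp only: chain_sum_linear)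
  also have "\<dots> \<in> \<int>"
  proof (rule chain_sum_Ints)
    fix f assume f: "f \<in> Poly_Mapping.keys c"
    let ?p = "simplex_path f"
    have p: "path ?p" using smooth_chainD[OF c(1) f] by (rule valid_path_imp_path)
    have nz: "?p 1 - w \<noteq> 0" "?p 0 - w \<noteq> 0"
      using w[OF f] by (auto simp: path_image_def)
    have "exp (2 * of_real pi * \<i> * (winding_number ?p w - (?Q (?p 1) - ?Q (?p 0)))) =
        exp (2 * of_real pi * \<i> * winding_number ?p w) / (exp (Ln (?p 1 - w)) / exp (Ln (?p 0 - w)))"
    proof -
      have "k * (x - (a / k - b / k)) = k * x - (a - b)" if "k \<noteq> 0" for k x a b :: complex
        using that by (simp add: right_diff_distrib)
      then have "2 * of_real pi * \<i> * (winding_number ?p w - (?Q (?p 1) - ?Q (?p 0))) =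
          2 * of_real pi * \<i> * winding_number ?p w - (Ln (?p 1 - w) - Ln (?p 0 - w))" by simp
      then show ?thesis by (simp only: exp_diff)
    qed
    also have "\<dots> = 1"
      using winding_number_exp_2pi[OF p w[OF f]] nz by (simp add: pathfinish_def pathstart_def)
    finally show "winding_number ?p w - (?Q (?p 1) - ?Q (?p 0)) \<in> \<int>"
      by (rule exp_2pi_eq_1_imp_Ints)
  qed
  finally show ?thesis .
qed

lemma chain_winding_constant_off_crossings:
  fixes a b :: real
  assumes c: "smooth_chain c" "chain_boundary (Suc 0) c = 0" and q: "continuous_on {a..b} q" "a \<le> b"
    and w: "\<And>f t. f \<in> Poly_Mapping.keys c \<Longrightarrow> t \<in> {a..b} \<Longrightarrow> q t \<notin> path_image (simplex_path f)"
  shows "chain_winding c (q a) = chain_winding c (q b)"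
proof -
  have "continuous_on {a..b} (\<lambda>t. winding_number (simplex_path f) (q t))" if f: "f \<in> Poly_Mapping.keys c" for f
  proof -
    have "path (simplex_path f)" using smooth_chainD[OF c(1) f] by (rule valid_path_imp_path)
    then have "continuous_on (- path_image (simplex_path f)) (winding_number (simplex_path f))"
      by (rule continuous_on_winding_number)
    then show ?thesis
      by (rule continuous_on_compose2[OF _ q(1)]) (use w[OF f] in auto)
  qed
  then have cont: "continuous_on {a..b} (\<lambda>t. chain_winding c (q t))"
    unfolding chain_winding_def chain_sum_def by (intro continuous_intros) auto
  have "(\<lambda>t. chain_winding c (q t)) constant_on {a..b}"
  proof (rule continuous_discrete_range_constant[OF _ cont])
    fix x assume x: "x \<in> {a..b}"
    show "\<exists>e>0. \<forall>y. y \<in> {a..b} \<and> chain_winding c (q y) \<noteq> chain_winding c (q x) \<longrightarrow>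
        e \<le> norm (chain_winding c (q y) - chain_winding c (q x))"
    proof (intro exI[of _ 1] conjI allI impI)
      fix y assume y: "y \<in> {a..b} \<and> chain_winding c (q y) \<noteq> chain_winding c (q x)"
      have "chain_winding c (q y) - chain_winding c (q x) \<in> \<int>"
        using x y w by (intro Ints_diff chain_winding_Ints[OF c]) auto
      then obtain n where n: "chain_winding c (q y) - chain_winding c (q x) = of_int n"
        by (auto elim: Ints_cases)
      have "n \<noteq> 0" using n y by auto
      then show "1 \<le> norm (chain_winding c (q y) - chain_winding c (q x))"
        unfolding n norm_of_int by linarith
    qed simp
  qed (rule connected_Icc)
  then show ?thesis using q(2) by (auto simp: constant_on_def)
qed

text \<open>
  Between two crossing times the winding number of the cycle is integral and continuous, hence constant.
  So the difference over a short interval around a crossing time equals its limit, which is known edge by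
  edge.
\<close>

lemma chain_winding_jump:
  assumes c: "smooth_chain c" "chain_boundary (Suc 0) c = 0" and q: "path q"
    and tr: "\<And>f. f \<in> Poly_Mapping.keys c \<Longrightarrow> transversal (simplex_path f) q"
  shows "chain_winding c (q 1) - chain_winding c (q 0) =
     chain_sum c (\<lambda>f. of_int (path_intersection (simplex_path f) q))"
proof -
  define D :: "((nat \<Rightarrow> real) \<Rightarrow> complex) \<Rightarrow> real set \<Rightarrow> complex" where
    "D f S = of_int (\<Sum>x\<in>{x\<in>crossings (simplex_path f) q. snd x \<in> S}. crossing_sign (simplex_path f) q x)" for f S
  define T where "T = (\<Union>f\<in>Poly_Mapping.keys c. snd ` crossings (simplex_path f) q)"
  define P where "P a b \<longleftrightarrow> chain_winding c (q b) - chain_winding c (q a) = chain_sum c (\<lambda>f. D f {a..b})" for a b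
  have vp: "valid_path (simplex_path f)" if "f \<in> Poly_Mapping.keys c" for f
    using smooth_chainD[OF c(1) that] .
  have fin: "finite (crossings (simplex_path f) q)" if "f \<in> Poly_Mapping.keys c" for f
    using finite_crossings[OF tr[OF that] valid_path_imp_path[OF vp[OF that]] q] .
  have finT: "finite T" using fin by (auto simp: T_def)
  have T01: "T \<subseteq> {0<..<1}" using tr by (force simp: T_def transversal_def)
  have qc: "continuous_on {a..b} q" if "0 \<le> a" "b \<le> 1" for a b
    using q that unfolding path_def by (auto elim: continuous_on_subset)
  have const: "chain_winding c (q a) = chain_winding c (q b)"
    if "0 \<le> a" "a \<le> b" "b \<le> 1" "T \<inter> {a..b} = {}" for a b
  proof (rule chain_winding_constant_off_crossings[OF c qc])
    fix f t assume f: "f \<in> Poly_Mapping.keys c" and t: "t \<in> {a..b}"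
    show "q t \<notin> path_image (simplex_path f)"
    proof (rule not_crossing_time)
      show "t \<notin> snd ` crossings (simplex_path f) q"
        using that(4) t f unfolding T_def by blast
    qed (use t that in auto)
  qed (use that in auto)
  have "P 0 1"
  proof (rule interval_induct_finite[OF finT, where lo = 0 and hi = 1])
    fix a b :: real assume ab: "0 \<le> a" "a \<le> b" "b \<le> 1" "T \<inter> {a..b} = {}"
    have "D f {a..b} = 0" if "f \<in> Poly_Mapping.keys c" for f
    proof -
      have "{x\<in>crossings (simplex_path f) q. snd x \<in> {a..b}} = {}"
        using that ab(4) unfolding T_def by blast
      then show ?thesis unfolding D_def by (simp only: sum.empty of_int_0)
    qed
    then have "chain_sum c (\<lambda>f. D f {a..b}) = 0" by (simp add: chain_sum_def)
    then show "P a b" using const[OF ab] by (simp add: P_def)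
  next
    fix a b d :: real assume abd: "a \<le> b" "b \<le> d" "b \<notin> T" and P: "P a b" "P b d"
    have "D f {a..d} = D f {a..b} + D f {b..d}" if f: "f \<in> Poly_Mapping.keys c" for f
    proof -
      let ?X = "\<lambda>S. {x\<in>crossings (simplex_path f) q. snd x \<in> S}"
      have u: "?X {a..d} = ?X {a..b} \<union> ?X {b..d}" using abd by auto
      have dis: "?X {a..b} \<inter> ?X {b..d} = {}" using abd f by (force simp: T_def)
      have fX: "finite (?X S)" for S using fin[OF f] by simp
      show ?thesis unfolding D_def u sum.union_disjoint[OF fX fX dis] of_int_add ..
    qed
    then have "chain_sum c (\<lambda>f. D f {a..d}) = chain_sum c (\<lambda>f. D f {a..b} + D f {b..d})"
      by (rule chain_sum_cong)
    then show "P a d" using P by (simp add: P_def chain_sum_linear algebra_simps)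
  next
    fix t0 assume t0: "t0 \<in> T" "0 < t0" "t0 < 1"
    have "P (t0 - \<eta>) (t0 + \<eta>)" if \<eta>: "0 < \<eta>" "0 \<le> t0 - \<eta>" "t0 + \<eta> \<le> 1"
      "T \<inter> {t0 - \<eta>..t0 + \<eta>} = {t0}" for \<eta>
    proof -
      have Df: "D f {t0 - \<eta>..t0 + \<eta>} = D f {t0}" if f: "f \<in> Poly_Mapping.keys c" for f
      proof -
        have "{x\<in>crossings (simplex_path f) q. snd x \<in> {t0 - \<eta>..t0 + \<eta>}} =
            {x\<in>crossings (simplex_path f) q. snd x \<in> {t0}}"
        proof -
          have "snd x = t0" if "x \<in> crossings (simplex_path f) q" "snd x \<in> {t0 - \<eta>..t0 + \<eta>}" for x
          proof -
            have "snd x \<in> T" using that(1) f unfolding T_def by blast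
            then show ?thesis using that(2) \<eta>(4) by blast
          qed
          then show ?thesis using \<eta>(1) by auto
        qed
        then show ?thesis by (simp only: D_def)
      qed
      have "((\<lambda>\<epsilon>. chain_sum c (\<lambda>f. winding_number (simplex_path f) (q (t0 + \<epsilon>)) -
          winding_number (simplex_path f) (q (t0 - \<epsilon>)))) \<longlongrightarrow> chain_sum c (\<lambda>f. D f {t0})) (at_right 0)"
        unfolding chain_sum_def
      proof (intro tendsto_sum tendsto_mult tendsto_const)
        fix f assume f: "f \<in> Poly_Mapping.keys c"
        show "((\<lambda>\<epsilon>. winding_number (simplex_path f) (q (t0 + \<epsilon>)) -
          winding_number (simplex_path f) (q (t0 - \<epsilon>))) \<longlongrightarrow> D f {t0}) (at_right 0)"
          using winding_number_jump[OF tr[OF f] vp[OF f] q, of t0] t0 by (simp add: D_def)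
      qed
      then have "((\<lambda>\<epsilon>. chain_winding c (q (t0 + \<epsilon>)) - chain_winding c (q (t0 - \<epsilon>)))
          \<longlongrightarrow> chain_sum c (\<lambda>f. D f {t0})) (at_right 0)"
        by (simp add: chain_winding_def chain_sum_linear)
      moreover have "\<forall>\<^sub>F \<epsilon> in at_right 0. chain_winding c (q (t0 + \<epsilon>)) - chain_winding c (q (t0 - \<epsilon>)) =
          chain_winding c (q (t0 + \<eta>)) - chain_winding c (q (t0 - \<eta>))"
      proof -
        have "chain_winding c (q (t0 + \<epsilon>)) = chain_winding c (q (t0 + \<eta>)) \<and>
            chain_winding c (q (t0 - \<eta>)) = chain_winding c (q (t0 - \<epsilon>))" if "0 < \<epsilon>" "\<epsilon> < \<eta>" for \<epsilon>
        proof -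
          have "T \<inter> {t0 + \<epsilon>..t0 + \<eta>} \<subseteq> T \<inter> {t0 - \<eta>..t0 + \<eta>} - {t0}"
            "T \<inter> {t0 - \<eta>..t0 - \<epsilon>} \<subseteq> T \<inter> {t0 - \<eta>..t0 + \<eta>} - {t0}" using that by auto
          then have "T \<inter> {t0 + \<epsilon>..t0 + \<eta>} = {}" "T \<inter> {t0 - \<eta>..t0 - \<epsilon>} = {}"
            unfolding \<eta>(4) by auto
          then show ?thesis using that \<eta> by (auto intro!: const)
        qed
        then show ?thesis unfolding eventually_at_right_field using \<eta>(1) by (metis (lifting))
      qed
      ultimately have "((\<lambda>\<epsilon>::real. chain_winding c (q (t0 + \<eta>)) - chain_winding c (q (t0 - \<eta>)))
          \<longlongrightarrow> chain_sum c (\<lambda>f. D f {t0})) (at_right 0)"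
        by (rule Lim_transform_eventually)
      then have "chain_winding c (q (t0 + \<eta>)) - chain_winding c (q (t0 - \<eta>)) = chain_sum c (\<lambda>f. D f {t0})"
        by (simp add: tendsto_const_iff)
      then show ?thesis
        unfolding P_def using chain_sum_cong[of c "\<lambda>f. D f {t0 - \<eta>..t0 + \<eta>}" "\<lambda>f. D f {t0}"] Df by simp
    qed
    then show "\<exists>\<delta>>0. \<forall>\<eta>. 0 < \<eta> \<longrightarrow> \<eta> < \<delta> \<longrightarrow> 0 \<le> t0 - \<eta> \<longrightarrow> t0 + \<eta> \<le> 1 \<longrightarrow>
        T \<inter> {t0 - \<eta>..t0 + \<eta>} = {t0} \<longrightarrow> P (t0 - \<eta>) (t0 + \<eta>)"
      by (intro exI[of _ 1]) auto
  qed (use T01 in auto)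
  moreover have "D f {0..1} = of_int (path_intersection (simplex_path f) q)" for f
  proof -
    have "{x\<in>crossings (simplex_path f) q. snd x \<in> {0..1}} = crossings (simplex_path f) q"
      by (auto simp: crossings_def)
    then show ?thesis by (simp add: D_def path_intersection_def case_prod_unfold)
  qed
  ultimately show ?thesis by (simp add: P_def)
qed

lemma chain_intersection_eq_winding:
  assumes c: "smooth_chain c" "chain_boundary (Suc 0) c = 0" and d: "smooth_chain d"
    and tr: "transversal_chains c d"
  shows "of_int (chain_intersection c d) =
    chain_sum (chain_boundary (Suc 0) d) (\<lambda>g. chain_winding c (g vertex0))"
proof -
  have "of_int (chain_intersection c d) =
      chain_sum d (\<lambda>g. chain_sum c (\<lambda>f. of_int (path_intersection (simplex_path f) (simplex_path g))))"
    unfolding chain_intersection_def chain_sum_def of_int_sum of_int_mult sum_distrib_left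
    by (subst sum.swap) (simp add: algebra_simps)
  also have "\<dots> = chain_sum d (\<lambda>g. chain_winding c (simplex_path g 1) - chain_winding c (simplex_path g 0))"
  proof (rule chain_sum_cong)
    fix g assume g: "g \<in> Poly_Mapping.keys d"
    have "path (simplex_path g)" using smooth_chainD[OF d g] by (rule valid_path_imp_path)
    moreover have "transversal (simplex_path f) (simplex_path g)" if "f \<in> Poly_Mapping.keys c" for f
      using tr that g by (auto simp: transversal_chains_def)
    ultimately show "chain_sum c (\<lambda>f. of_int (path_intersection (simplex_path f) (simplex_path g))) =
        chain_winding c (simplex_path g 1) - chain_winding c (simplex_path g 0)"
      using chain_winding_jump[OF c, of "simplex_path g"] by simp
  qed
  finally show ?thesis by (simp add: chain_sum_boundary)
qed

section \<open>Boundaries of relative cycles\<close>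

lemma zero_simplex_eq:
  assumes "singular_simplex 0 X g"
  shows "g = restrict (\<lambda>_. g vertex0) (standard_simplex 0)"
proof
  fix x
  show "g x = restrict (\<lambda>_. g vertex0) (standard_simplex 0) x"
    using assms by (cases "x = vertex0") (auto simp: singular_simplex_def standard_simplex_0 extensional_def)
qed

lemma chain_sum_lookup:
  "chain_sum a (\<lambda>g. if g = f then 1 else 0) = of_int (Poly_Mapping.lookup a f)"
proof -
  have "chain_sum a (\<lambda>g. if g = f then 1 else 0) =
      (\<Sum>g\<in>Poly_Mapping.keys a. if g = f then of_int (Poly_Mapping.lookup a f) else 0)"
    unfolding chain_sum_def by (intro sum.cong) auto
  then show ?thesis by (simp add: in_keys_iff)
qed

text \<open>
  Evaluation of all functions of the vertex separates 0-chains, since a 0-simplex is determined by its vertex.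
\<close>

lemma zero_chain_eqI:
  assumes a: "singular_chain 0 X a" "singular_chain 0 X b"
    and eq: "\<And>Q. chain_sum a (\<lambda>g. Q (g vertex0)) = chain_sum b (\<lambda>g. Q (g vertex0))"
  shows "a = b"
proof (rule poly_mapping_eqI)
  fix f
  have "chain_sum c (\<lambda>g. if g = f then 1 else 0) =
      chain_sum c (\<lambda>g. (\<lambda>v. if restrict (\<lambda>_. v) (standard_simplex 0) = f then 1 else 0) (g vertex0))"
    if "singular_chain 0 X c" for c
  proof (rule chain_sum_cong)
    fix g assume "g \<in> Poly_Mapping.keys c"
    then have "singular_simplex 0 X g" using that by (auto simp: singular_chain_def)
    from zero_simplex_eq[OF this]
    show "(if g = f then 1 else 0) =
        (\<lambda>v. if restrict (\<lambda>_. v) (standard_simplex 0) = f then 1 else 0::complex) (g vertex0)"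
      by simp
  qed
  then have "chain_sum a (\<lambda>g. if g = f then 1 else 0) = chain_sum b (\<lambda>g. if g = f then 1 else 0)"
    using a eq[of "\<lambda>v. if restrict (\<lambda>_. v) (standard_simplex 0) = f then 1 else 0"] by simp
  then show "Poly_Mapping.lookup a f = Poly_Mapping.lookup b f"
    by (simp add: chain_sum_lookup)
qed

text \<open>
  The multiplicity of the point \<open>x\<close> in the boundary of \<open>d\<close>. It is an integer (\<open>end_coeff_Ints\<close>), but serves as
  a coefficient of complex numbers.
\<close>

definition end_coeff :: "complex chain \<Rightarrow> complex \<Rightarrow> complex" where
  "end_coeff d x = chain_sum (chain_boundary (Suc 0) d) (\<lambda>g. if g vertex0 = x then 1 else 0)"

lemma end_coeff_Ints: "end_coeff d x \<in> \<int>"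
  unfolding end_coeff_def by (intro chain_sum_Ints) auto

lemma singular_relcycle_boundary_vertex:
  assumes "singular_relcycle (Suc 0) X S d" "g \<in> Poly_Mapping.keys (chain_boundary (Suc 0) d)"
  shows "g vertex0 \<in> S"
proof -
  have "singular_chain 0 (subtopology X S) (chain_boundary (Suc 0) d)"
    using assms(1) by (simp add: singular_relcycle_def mod_subset_def)
  then have "singular_simplex 0 (subtopology X S) g"
    using assms(2) by (auto simp: singular_chain_def)
  then show ?thesis
    by (auto simp: singular_simplex_def continuous_map_in_subtopology standard_simplex_0)
qed

lemma chain_sum_relcycle_boundary:
  fixes z :: "complex ^ 'n::finite"
  assumes z: "z \<in> config" and d: "singular_relcycle (Suc 0) X (marked z) d"
  shows "chain_sum (chain_boundary (Suc 0) d) (\<lambda>g. Q (g vertex0)) = (\<Sum>i\<in>UNIV. end_coeff d (z $ i) * Q (z $ i))"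
proof -
  have "chain_sum (chain_boundary (Suc 0) d) (\<lambda>g. Q (g vertex0)) =
      chain_sum (chain_boundary (Suc 0) d) (\<lambda>g. \<Sum>i\<in>UNIV. (if g vertex0 = z $ i then 1 else 0) * Q (z $ i))"
  proof (rule chain_sum_cong)
    fix g assume "g \<in> Poly_Mapping.keys (chain_boundary (Suc 0) d)"
    from singular_relcycle_boundary_vertex[OF d this]
    obtain k where k: "g vertex0 = z $ k" by (auto simp: marked_def)
    have "(\<Sum>i\<in>UNIV. (if g vertex0 = z $ i then 1 else 0) * Q (z $ i)) = (\<Sum>i\<in>UNIV. if i = k then Q (z $ k) else 0)"
      using z k by (intro sum.cong) (auto simp: config_def)
    then show "Q (g vertex0) = (\<Sum>i\<in>UNIV. (if g vertex0 = z $ i then 1 else 0) * Q (z $ i))"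
      using k by simp
  qed
  also have "\<dots> = (\<Sum>i\<in>UNIV. end_coeff d (z $ i) * Q (z $ i))"
    unfolding end_coeff_def by (simp only: chain_sum_linear)
  finally show ?thesis .
qed

lemma sum_end_coeff:
  fixes z :: "complex ^ 'n::finite"
  assumes z: "z \<in> config" and d: "singular_relcycle (Suc 0) X (marked z) d"
  shows "(\<Sum>i\<in>UNIV. end_coeff d (z $ i)) = 0"
proof -
  have "chain_sum (chain_boundary (Suc 0) d) (\<lambda>g. 1) = chain_sum d (\<lambda>f. 1 - 1)"
    using chain_sum_boundary[of d "\<lambda>_. 1"] by simp
  then show ?thesis
    using chain_sum_relcycle_boundary[OF z d, of "\<lambda>_. 1"] by (simp add: chain_sum_def)
qed

lemma constant_edge_in_finite_set:
  assumes "finite S" "singular_simplex (Suc 0) (subtopology (euclidean::complex topology) S) f"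
  shows "simplex_path f 1 = simplex_path f 0"
proof -
  have "connectedin euclidean (f ` standard_simplex (Suc 0))"
  proof -
    have "connectedin (powertop_real UNIV) (standard_simplex (Suc 0))"
      by (rule connectedin_standard_simplex)
    then have "connectedin (subtopology (powertop_real UNIV) (standard_simplex (Suc 0))) (standard_simplex (Suc 0))"
      by (simp add: connectedin_subtopology)
    moreover have "continuous_map (subtopology (powertop_real UNIV) (standard_simplex (Suc 0))) euclidean f"
      using assms(2) by (simp add: singular_simplex_def continuous_map_in_subtopology)
    ultimately show ?thesis using connectedin_continuous_map_image by blast
  qed
  then have con: "connected (f ` standard_simplex (Suc 0))" by simp
  have "f ` standard_simplex (Suc 0) \<subseteq> S"
    using assms(2) by (auto simp: singular_simplex_def continuous_map_in_subtopology)
  then have "finite (f ` standard_simplex (Suc 0))" using assms(1) finite_subset by blast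
  with con obtain a where "f ` standard_simplex (Suc 0) \<subseteq> {a}"
    using connected_finite_iff_sing by (metis empty_subsetI order_refl)
  then have "simplex_path f ` {0..1} \<subseteq> {a}"
    using simplex_path_image_subset[of f "{a}"] by simp
  then show ?thesis by (auto simp: image_subset_iff)
qed

text \<open>
  Homologous relative cycles differ by a boundary and by a chain inside \<open>S\<close>. The edges of the latter are
  constant because \<open>S\<close> is finite, so they have no increments.
\<close>

lemma chain_sum_boundary_homologous:
  fixes S :: "complex set"
  assumes "finite S" "homologous_rel (Suc 0) euclidean S d d'"
  shows "chain_sum (chain_boundary (Suc 0) d) (\<lambda>g. Q (g vertex0)) =
    chain_sum (chain_boundary (Suc 0) d') (\<lambda>g. Q (g vertex0))"
proof -
  obtain D e where D: "singular_chain (Suc (Suc 0)) euclidean D"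
    "singular_chain (Suc 0) (subtopology euclidean S) e" "chain_boundary (Suc (Suc 0)) D + e = d - d'"
    using assms(2) unfolding homologous_rel_def singular_relboundary by auto
  have "chain_boundary (Suc 0) (d - d') = chain_boundary (Suc 0) e"
    unfolding D(3)[symmetric] chain_boundary_add using chain_boundary_boundary[OF D(1)] by simp
  moreover have "chain_sum (chain_boundary (Suc 0) e) (\<lambda>g. Q (g vertex0)) = chain_sum e (\<lambda>f. 0)"
  proof (rule trans[OF chain_sum_boundary chain_sum_cong])
    fix f assume "f \<in> Poly_Mapping.keys e"
    then have "singular_simplex (Suc 0) (subtopology euclidean S) f"
      using D(2) by (auto simp: singular_chain_def)
    from constant_edge_in_finite_set[OF assms(1) this]
    show "Q (simplex_path f 1) - Q (simplex_path f 0) = 0" by simp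
  qed
  ultimately have "chain_sum (chain_boundary (Suc 0) d - chain_boundary (Suc 0) d') (\<lambda>g. Q (g vertex0)) = 0"
    by (simp add: chain_boundary_diff chain_sum_def)
  then show ?thesis by (simp add: chain_sum_diff)
qed

text \<open>
  The difference is a cycle in the plane, which is convex.
\<close>

lemma homologous_if_same_boundary:
  assumes d: "singular_relcycle (Suc 0) euclidean S d"
    and d': "singular_chain (Suc 0) (euclidean :: complex topology) d'"
    and eq: "\<And>Q. chain_sum (chain_boundary (Suc 0) d) (\<lambda>g. Q (g vertex0)) =
        chain_sum (chain_boundary (Suc 0) d') (\<lambda>g. Q (g vertex0))"
  shows "homologous_rel (Suc 0) euclidean S d d'"
proof -
  have dc: "singular_chain (Suc 0) euclidean d" using d by (simp add: singular_relcycle_def)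
  have "chain_boundary (Suc 0) d = chain_boundary (Suc 0) d'"
  proof (rule zero_chain_eqI[of euclidean])
    show "singular_chain 0 euclidean (chain_boundary (Suc 0) d)" "singular_chain 0 euclidean (chain_boundary (Suc 0) d')"
      using singular_chain_boundary[OF dc] singular_chain_boundary[OF d'] by simp_all
  qed (rule eq)
  then have "singular_relcycle (Suc 0) (top_of_set UNIV) {} (d - d')"
    using dc d' by (simp add: singular_cycle chain_boundary_diff singular_chain_diff)
  then have "singular_relboundary (Suc 0) (top_of_set UNIV) {} (d - d')"
    by (intro cycle_in_convex_is_boundary) auto
  then obtain D where "singular_chain (Suc (Suc 0)) euclidean D" "chain_boundary (Suc (Suc 0)) D = d - d'"
    by (auto simp: singular_boundary)
  then show ?thesis
    unfolding homologous_rel_def singular_relboundary_def by (auto intro!: exI[of _ D])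
qed

section \<open>The intersection number of homology classes\<close>

lemma homology_class_memD:
  assumes "\<kappa> \<in> carrier (relative_homology_group 1 X S)"
  obtains c where "c \<in> \<kappa>" "\<kappa> = homologous_rel_set (Suc 0) X S c" "singular_relcycle (Suc 0) X S c"
proof -
  have "\<kappa> \<in> homologous_rel_set (Suc 0) X S ` singular_relcycle_set (Suc 0) X S"
    using assms carrier_relative_homology_group[of "Suc 0" X S] by simp
  then show ?thesis using that by auto
qed

lemma homology_class_relcycle:
  assumes "\<kappa> \<in> carrier (relative_homology_group 1 X S)" "c \<in> \<kappa>"
  shows "singular_relcycle (Suc 0) X S c"
  using homology_class_memD[OF assms(1)] assms(2) homologous_rel_singular_relcycle[of "Suc 0" X S]
  by (metis mem_Collect_eq)

lemma homology_class_homologous: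
  assumes "\<kappa> \<in> carrier (relative_homology_group 1 X S)" "c \<in> \<kappa>"
  shows "c' \<in> \<kappa> \<longleftrightarrow> homologous_rel (Suc 0) X S c c'"
  using homology_class_memD[OF assms(1)] assms(2)
  by (metis homologous_rel_sym homologous_rel_trans mem_Collect_eq)

definition segment_chain :: "complex chain \<Rightarrow> bool" where
  "segment_chain c \<longleftrightarrow> (\<forall>f\<in>Poly_Mapping.keys c. \<exists>u v. f = segment_simplex u v)"

lemma segment_chain_smooth: "segment_chain c \<Longrightarrow> smooth_chain c"
  using valid_path_segment_simplex by (force simp: segment_chain_def smooth_chain_def)

lemma exists_segment_cycle:
  assumes "\<sigma> \<in> carrier (homology_group 1 (top_of_set S))" "open S"
  obtains c where "c \<in> \<sigma>" "segment_chain c"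
proof -
  obtain c where c: "c \<in> \<sigma>" "singular_relcycle (Suc 0) (top_of_set S) {} c"
    using homology_class_memD[OF assms(1)] by metis
  obtain c' where "homologous_rel (Suc 0) (top_of_set S) {} c c'"
    "\<And>f. f \<in> Poly_Mapping.keys c' \<Longrightarrow> \<exists>u v. f = segment_simplex u v \<and> closed_segment u v \<subseteq> S"
    using cycle_homologous_to_segments[OF assms(2) c(2)] by metis
  then have "c' \<in> \<sigma>" "segment_chain c'"
    using homology_class_homologous[OF assms(1) c(1)] unfolding segment_chain_def by blast+
  then show ?thesis by (rule that)
qed

lemma transversal_segments:
  fixes u v P w :: complex
  assumes w: "w \<notin> closed_segment u v" and P: "P \<notin> closed_segment u v"
    and uv: "u \<notin> closed_segment P w" "v \<notin> closed_segment P w"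
    and par: "Im (cnj (v - u) * (w - P)) \<noteq> 0 \<or> u = v"
  shows "transversal (simplex_path (segment_simplex u v)) (simplex_path (segment_simplex P w))"
  unfolding transversal_def
proof (safe, goal_cases)
  have vd: "(simplex_path (segment_simplex a b) has_vector_derivative b - a) (at s)" if "s \<in> {0<..<1}" for a b s
    by (rule has_vector_derivative_transform_within_open[of "linepath a b" _ _ "{0<..<1}"])
      (use that in \<open>auto simp: simplex_path_segment has_vector_derivative_linepath_within\<close>)
  fix s t
  assume "(s, t) \<in> crossings (simplex_path (segment_simplex u v)) (simplex_path (segment_simplex P w))"
  then have st: "s \<in> {0..1}" "t \<in> {0..1}" and eq: "linepath u v s = linepath P w t"
    by (auto simp: crossings_def simplex_path_segment)
  have 1: "linepath u v s \<in> closed_segment u v" "linepath P w t \<in> closed_segment P w"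
    using st by (auto simp: linepath_in_path)
  have "s \<noteq> 0" "s \<noteq> 1" "t \<noteq> 0" "t \<noteq> 1"
    using 1 eq assms by (auto simp: linepath_0' linepath_1')
  then show s: "s \<in> {0<..<1}" and t: "t \<in> {0<..<1}" using st by auto
  show "simplex_path (segment_simplex u v) differentiable at s" "simplex_path (segment_simplex P w) differentiable at t"
    by (rule differentiableI_vector[OF vd[OF s]], rule differentiableI_vector[OF vd[OF t]])
  have "u \<noteq> v" using 1(2) eq uv by (auto simp: linepath_def)
  then show "crossing_det (simplex_path (segment_simplex u v)) (simplex_path (segment_simplex P w)) s t = 0 \<Longrightarrow> False"
    using par vector_derivative_at[OF vd[OF s]] vector_derivative_at[OF vd[OF t]] by (simp add: crossing_det_def)
qed

lemma exists_point_off_lines: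
  fixes A :: "(complex \<times> complex) set"
  assumes "finite A"
  shows "\<exists>P. \<forall>(a, b)\<in>A. a \<noteq> 0 \<longrightarrow> Im (cnj a * (P - b)) \<noteq> 0"
proof -
  let ?L = "\<lambda>x. {P. Im (cnj (fst x) * (P - snd x)) = 0}"
  have "negligible (?L x)" if "fst x \<noteq> 0" for x
  proof -
    have "?L x = {P. (\<i> * fst x) \<bullet> P = (\<i> * fst x) \<bullet> snd x}"
      by (auto simp: inner_complex_def algebra_simps)
    then show ?thesis using that by (simp add: negligible_hyperplane)
  qed
  then have "negligible (\<Union>x\<in>{x\<in>A. fst x \<noteq> 0}. ?L x)"
    using assms by (intro negligible_Union) auto
  then have "(\<Union>x\<in>{x\<in>A. fst x \<noteq> 0}. ?L x) \<noteq> UNIV"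
    using non_negligible_UNIV by metis
  then obtain P where "P \<notin> (\<Union>x\<in>{x\<in>A. fst x \<noteq> 0}. ?L x)" by blast
  then show ?thesis by (intro exI[of _ P]) auto
qed

lemma closed_segment_on_line:
  assumes "x \<in> closed_segment a b"
  shows "Im (cnj (b - a) * (x - a)) = 0" "Im (cnj (x - b) * (a - b)) = 0"
proof -
  obtain t where t: "x = (1 - t) *\<^sub>R a + t *\<^sub>R b"
    using assms by (auto simp: closed_segment_def)
  have "Im (cnj (t *\<^sub>R y) * y) = 0" "Im (cnj y * (t *\<^sub>R y)) = 0" for y :: complex and t :: real
    by (simp_all add: algebra_simps)
  moreover have "x - b = (1 - t) *\<^sub>R (a - b)" "x - a = t *\<^sub>R (b - a)"
    unfolding t by (simp_all add: algebra_simps)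
  ultimately show "Im (cnj (x - b) * (a - b)) = 0" "Im (cnj (b - a) * (x - a)) = 0" by (simp_all only:)
qed

lemma marked_finite_open: "finite (marked z)" "open (- marked z)"
proof -
  show "finite (marked z)" by (simp add: marked_def)
  then show "open (- marked z)" by (simp add: finite_imp_closed open_Compl)
qed

lemma singular_relcycle_empty:
  assumes "singular_relcycle (Suc 0) (top_of_set S) {} c"
  shows "singular_chain (Suc 0) (top_of_set S) c" "chain_boundary (Suc 0) c = 0"
  using assms by (auto simp: singular_cycle)

text \<open>
  Let \<open>\<Sum> a\<^sub>i z\<^sub>i\<close> be the boundary of a representative of \<open>\<tau>\<close>. Since the \<open>a\<^sub>i\<close> add up to zero, the rays from any
  common point \<open>P\<close> to the \<open>z\<^sub>i\<close>, with multiplicities \<open>a\<^sub>i\<close>, have the same boundary and represent \<open>\<tau>\<close>. They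
  are transversal to the given segments as soon as \<open>P\<close> avoids finitely many lines.
\<close>

lemma exists_transversal_relcycle:
  fixes z :: "complex ^ 'n::finite"
  assumes z: "z \<in> config" and c: "segment_chain c" "singular_chain (Suc 0) (punctured_plane z) c"
    and \<tau>: "\<tau> \<in> carrier (relative_homology_group 1 euclidean (marked z))"
  shows "\<exists>d\<in>\<tau>. smooth_chain d \<and> transversal_chains c d"
proof -
  obtain d where d: "d \<in> \<tau>" "singular_relcycle (Suc 0) euclidean (marked z) d"
    using homology_class_memD[OF \<tau>] by metis
  have "\<forall>i. \<exists>n::int. end_coeff d (z $ i) = of_int n"
    using end_coeff_Ints by (metis Ints_cases)
  then obtain n :: "'n \<Rightarrow> int" where n: "\<And>i. end_coeff d (z $ i) = of_int (n i)" by metis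
  let ?K = "Poly_Mapping.keys c"
  let ?u = "\<lambda>f. simplex_path f 0" and ?v = "\<lambda>f. simplex_path f 1"
  \<comment> \<open>For each marked point the lines through it that are parallel to an edge (against tangency) or contain
    a vertex of \<open>c\<close> (against crossings at vertices), and the lines spanned by the edges (to keep \<open>P\<close> off \<open>c\<close>);
    a pair consists of a direction and a point.\<close>
  define A where "A = (\<lambda>(f, i). (?v f - ?u f, z $ i)) ` (?K \<times> UNIV) \<union> (\<lambda>(f, i). (?u f - z $ i, z $ i)) ` (?K \<times> UNIV) \<union>
      (\<lambda>(f, i). (?v f - z $ i, z $ i)) ` (?K \<times> UNIV) \<union> (\<lambda>f. (?v f - ?u f, ?u f)) ` ?K"
  have "finite A" by (simp add: A_def)
  then obtain P where P: "\<And>a b. (a, b) \<in> A \<Longrightarrow> a \<noteq> 0 \<Longrightarrow> Im (cnj a * (P - b)) \<noteq> 0"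
    using exists_point_off_lines[of A] by blast
  define d0 where "d0 = (\<Sum>i\<in>UNIV. frag_cmul (n i) (frag_of (segment_simplex P (z $ i))))"
  have keys: "\<exists>i. g = segment_simplex P (z $ i)" if "g \<in> Poly_Mapping.keys d0" for g
  proof -
    have "g \<in> (\<Union>i. Poly_Mapping.keys (frag_cmul (n i) (frag_of (segment_simplex P (z $ i)))))"
      using that keys_sum[of "\<lambda>i. frag_cmul (n i) (frag_of (segment_simplex P (z $ i)))" UNIV]
      unfolding d0_def by (rule subsetD[rotated])
    then show ?thesis by (auto simp: keys_frag_of)
  qed
  have ch: "singular_chain (Suc 0) euclidean d0"
    unfolding d0_def using singular_simplex_segment[of _ _ UNIV]
    by (intro singular_chain_sum singular_chain_cmul) (auto simp: singular_chain_of)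
  have bd: "chain_sum (chain_boundary (Suc 0) d) (\<lambda>g. Q (g vertex0)) =
      chain_sum (chain_boundary (Suc 0) d0) (\<lambda>g. Q (g vertex0))" for Q
  proof -
    have "chain_sum (chain_boundary (Suc 0) d0) (\<lambda>g. Q (g vertex0)) =
        (\<Sum>i\<in>UNIV. end_coeff d (z $ i) * (Q (z $ i) - Q P))"
      by (subst chain_sum_boundary[where Q = Q])
        (simp add: d0_def chain_sum_sum chain_sum_cmul simplex_path_segment linepath_def n)
    also have "\<dots> = (\<Sum>i\<in>UNIV. end_coeff d (z $ i) * Q (z $ i)) - (\<Sum>i\<in>UNIV. end_coeff d (z $ i)) * Q P"
      by (simp add: right_diff_distrib sum_subtractf sum_distrib_right)
    finally show ?thesis
      by (simp add: sum_end_coeff[OF z d(2)] chain_sum_relcycle_boundary[OF z d(2)])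
  qed
  have "homologous_rel (Suc 0) euclidean (marked z) d d0"
    by (rule homologous_if_same_boundary[OF d(2) ch]) (rule bd)
  then have "d0 \<in> \<tau>" using homology_class_homologous[OF \<tau> d(1)] by simp
  moreover have "smooth_chain d0"
  proof (rule segment_chain_smooth)
    show "segment_chain d0" unfolding segment_chain_def using keys by blast
  qed
  moreover have "transversal (simplex_path f) (simplex_path g)"
    if f: "f \<in> ?K" and g: "g \<in> Poly_Mapping.keys d0" for f g
  proof -
    obtain i where i: "g = segment_simplex P (z $ i)" using keys[OF g] by blast
    obtain u v where uv: "f = segment_simplex u v" using c(1) f by (auto simp: segment_chain_def)
    have ends: "simplex_path f 0 = u" "simplex_path f 1 = v"
      by (simp_all add: uv simplex_path_segment linepath_def)
    have "path_image (simplex_path f) \<subseteq> - marked z"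
      using simplex_path_image_in_space[of "- marked z" c f] c(2) f by (simp add: punctured_plane_def)
    then have seg: "closed_segment u v \<subseteq> - marked z"
      using simplex_image_eq_path_image[of f] segment_simplex_image[of u v] by (simp add: uv)
    then have zi: "z $ i \<notin> closed_segment u v" "u \<noteq> z $ i" "v \<noteq> z $ i"
      by (auto simp: marked_def)
    have mem: "(v - u, z $ i) \<in> A" "(u - z $ i, z $ i) \<in> A" "(v - z $ i, z $ i) \<in> A" "(v - u, u) \<in> A"
      using f ends unfolding A_def by (force simp: image_iff)+
    have 1: "Im (cnj (u - z $ i) * (P - z $ i)) \<noteq> 0" "Im (cnj (v - z $ i) * (P - z $ i)) \<noteq> 0"
      using P[OF mem(2)] P[OF mem(3)] zi by auto
    show ?thesis unfolding uv i
    proof (rule transversal_segments[OF zi(1)])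
      show "u \<notin> closed_segment P (z $ i)" "v \<notin> closed_segment P (z $ i)"
        using 1 closed_segment_on_line(2) by metis+
      show "P \<notin> closed_segment u v"
      proof
        assume "P \<in> closed_segment u v"
        then have "Im (cnj (v - u) * (P - u)) = 0" by (rule closed_segment_on_line)
        then have "u = v" using P[OF mem(4)] by auto
        then have "P = u" using \<open>P \<in> closed_segment u v\<close> by simp
        then show False using 1(1) by (simp add: algebra_simps)
      qed
      show "Im (cnj (v - u) * (z $ i - P)) \<noteq> 0 \<or> u = v"
      proof -
        have "Im (cnj (v - u) * (z $ i - P)) = - Im (cnj (v - u) * (P - z $ i))"
          by (simp add: algebra_simps)
        moreover have "Im (cnj (v - u) * (P - z $ i)) \<noteq> 0" if "u \<noteq> v"
          by (rule P[OF mem(1)]) (use that in simp)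
        ultimately show ?thesis by (metis neg_equal_0_iff_equal)
      qed
    qed
  qed
  ultimately show ?thesis by (auto simp: transversal_chains_def)
qed

lemma chain_winding_integral:
  assumes "smooth_chain c" "\<And>f. f \<in> Poly_Mapping.keys c \<Longrightarrow> w \<notin> path_image (simplex_path f)"
  shows "chain_winding c w = 1 / (2 * of_real pi * \<i>) * chain_integral c (\<lambda>t. 1 / (t - w))"
  unfolding chain_winding_def chain_integral_chain_sum chain_sum_linear(3)[symmetric]
proof (rule chain_sum_cong)
  fix f assume f: "f \<in> Poly_Mapping.keys c"
  show "winding_number (simplex_path f) w =
      1 / (2 * of_real pi * \<i>) * contour_integral (simplex_path f) (\<lambda>t. 1 / (t - w))"
    using winding_number_valid_path[OF smooth_chainD[OF assms(1) f] assms(2)[OF f]] by simp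
qed

lemma punctured_chain_avoids:
  fixes z :: "complex ^ 'n::finite"
  assumes "singular_chain (Suc 0) (punctured_plane z) c" "f \<in> Poly_Mapping.keys c"
  shows "z $ i \<notin> path_image (simplex_path f)"
  using simplex_path_image_in_space[of "- marked z" c f] assms
  by (auto simp: punctured_plane_def marked_def)

context
  fixes z :: "complex ^ 'n::finite" and \<sigma> c
  assumes \<sigma>: "\<sigma> \<in> carrier (homology_group 1 (punctured_plane z))"
    and c: "c \<in> \<sigma>" "smooth_chain c"
begin

lemma smooth_cycle_integral_eq:
  assumes "c' \<in> \<sigma>" "smooth_chain c'" "g holomorphic_on - marked z"
  shows "chain_integral c' g = chain_integral c g"
  using homologous_smooth_integral_eq[OF marked_finite_open(2) assms(3) _ assms(2) c(2)]
    homology_class_homologous[OF \<sigma> assms(1)] c(1) by (simp add: punctured_plane_def)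

lemma homology_integral_cycle:
  assumes "g holomorphic_on - marked z"
  shows "homology_integral \<sigma> g = chain_integral c g"
  unfolding homology_integral_def
proof (rule the_equality)
  show "\<exists>c'\<in>\<sigma>. smooth_chain c' \<and> chain_integral c g = chain_integral c' g"
    using c by blast
  fix v assume "\<exists>c'\<in>\<sigma>. smooth_chain c' \<and> v = chain_integral c' g"
  then obtain c' where c': "c' \<in> \<sigma>" "smooth_chain c'" "v = chain_integral c' g" by blast
  show "v = chain_integral c g"
    unfolding c'(3) by (rule smooth_cycle_integral_eq[OF c'(1,2) assms])
qed

lemma smooth_cycle_winding_eq:
  assumes "c' \<in> \<sigma>" "smooth_chain c'"
  shows "chain_winding c' (z $ i) = chain_winding c (z $ i)"
proof -
  have rc: "singular_chain (Suc 0) (punctured_plane z) c0" if "c0 \<in> \<sigma>" for c0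
    using homology_class_relcycle[OF \<sigma> that] by (simp add: singular_relcycle_def)
  have "(\<lambda>t. 1 / (t - z $ i)) holomorphic_on - marked z"
    by (intro holomorphic_intros) (auto simp: marked_def)
  from smooth_cycle_integral_eq[OF assms this] show ?thesis
    by (simp add: chain_winding_integral[OF assms(2) punctured_chain_avoids[OF rc[OF assms(1)]]]
        chain_winding_integral[OF c(2) punctured_chain_avoids[OF rc[OF c(1)]]])
qed

text \<open>
  For any transversal representatives the count is determined by the winding numbers of the cycle around
  the marked points, which are integrals and depend only on \<open>\<sigma>\<close>, and by the boundary multiplicities of the
  relative cycle, which depend only on \<open>\<tau>\<close>. So all representatives give the same number, and the definite
  description is meaningful.
\<close>

lemma intersection_number_winding:
  assumes z: "z \<in> config" and \<tau>: "\<tau> \<in> carrier (relative_homology_group 1 euclidean (marked z))"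
    and d: "d \<in> \<tau>"
  shows "of_int (intersection_number \<sigma> \<tau>) = (\<Sum>i\<in>UNIV. end_coeff d (z $ i) * chain_winding c (z $ i))"
proof -
  have rc: "singular_chain (Suc 0) (punctured_plane z) c0 \<and> chain_boundary (Suc 0) c0 = 0" if "c0 \<in> \<sigma>" for c0
    using homology_class_relcycle[OF \<sigma> that] singular_relcycle_empty[of "- marked z" c0]
    by (simp add: punctured_plane_def)
  let ?v = "\<Sum>i\<in>UNIV. end_coeff d (z $ i) * chain_winding c (z $ i)"
  have val: "of_int (chain_intersection c' d') = ?v"
    if c': "c' \<in> \<sigma>" "smooth_chain c'" and d': "d' \<in> \<tau>" "smooth_chain d'" and tr: "transversal_chains c' d'" for c' d'
  proof -
    have "of_int (chain_intersection c' d') =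
        chain_sum (chain_boundary (Suc 0) d') (\<lambda>g. chain_winding c' (g vertex0))"
      using chain_intersection_eq_winding[OF c'(2) _ d'(2) tr] rc[OF c'(1)] by simp
    also have "\<dots> = chain_sum (chain_boundary (Suc 0) d) (\<lambda>g. chain_winding c' (g vertex0))"
      using homology_class_homologous[OF \<tau> d'(1)] d
      by (intro chain_sum_boundary_homologous[OF marked_finite_open(1)[of z]]) simp
    also have "\<dots> = (\<Sum>i\<in>UNIV. end_coeff d (z $ i) * chain_winding c' (z $ i))"
      by (rule chain_sum_relcycle_boundary[OF z homology_class_relcycle[OF \<tau> d]])
    finally show ?thesis by (simp add: smooth_cycle_winding_eq[OF c'])
  qed
  obtain c' where c': "c' \<in> \<sigma>" "segment_chain c'"
    using exists_segment_cycle[of \<sigma> "- marked z"] \<sigma> marked_finite_open(2)[of z]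
    by (auto simp: punctured_plane_def)
  obtain d' where d': "d' \<in> \<tau>" "smooth_chain d'" "transversal_chains c' d'"
    using exists_transversal_relcycle[OF z c'(2) _ \<tau>] rc[OF c'(1)] by blast
  note sm = segment_chain_smooth[OF c'(2)]
  have "intersection_number \<sigma> \<tau> = chain_intersection c' d'"
    unfolding intersection_number_def
  proof (rule the_equality)
    show "\<exists>c\<in>\<sigma>. \<exists>d\<in>\<tau>. smooth_chain c \<and> smooth_chain d \<and> transversal_chains c d \<and>
        chain_intersection c' d' = chain_intersection c d"
      using c' d' sm by blast
    fix n assume "\<exists>c\<in>\<sigma>. \<exists>d\<in>\<tau>. smooth_chain c \<and> smooth_chain d \<and> transversal_chains c d \<and>
        n = chain_intersection c d"
    then have "of_int n = ?v" using val by auto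
    then show "n = chain_intersection c' d'"
      using val[OF c'(1) sm d'] by (metis of_int_eq_iff)
  qed
  then show ?thesis using val[OF c'(1) sm d'] by simp
qed

end

section \<open>Integrals over relative cycles\<close>

lemma countable_isolated_points:
  fixes S :: "'a::second_countable_topology set"
  assumes "\<And>x. x \<in> S \<Longrightarrow> \<exists>U. open U \<and> x \<in> U \<and> U \<inter> S = {x}"
  shows "countable S"
proof -
  obtain B :: "'a set set" where B: "countable B" "topological_basis B"
    using ex_countable_basis by blast
  have "\<exists>V\<in>B. V \<inter> S = {x}" if x: "x \<in> S" for x
  proof -
    obtain U where U: "open U" "x \<in> U" "U \<inter> S = {x}" using assms[OF x] by blast
    obtain V where "V \<in> B" "x \<in> V" "V \<subseteq> U" using topological_basisE[OF B(2) U(1,2)] by blast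
    then show ?thesis using U x by blast
  qed
  then obtain V where V: "\<And>x. x \<in> S \<Longrightarrow> V x \<in> B \<and> V x \<inter> S = {x}" by metis
  have "inj_on V S" by (rule inj_onI) (use V in blast)
  moreover have "countable (V ` S)" using V B(1) by (meson countable_subset image_subsetI)
  ultimately show ?thesis by (rule countable_image_inj_on[rotated])
qed

text \<open>
  A path that passes through \<open>b\<close> with non-zero velocity leaves \<open>b\<close> at once, so these times are isolated.
\<close>

lemma nonstationary_preimage_countable:
  fixes p :: "real \<Rightarrow> complex"
  shows "countable {t. p t = b \<and> (\<exists>p'. p' \<noteq> 0 \<and> (p has_vector_derivative p') (at t))}" (is "countable ?S")
proof (rule countable_isolated_points)
  fix x assume x: "x \<in> ?S"
  then obtain p' where p': "p' \<noteq> 0" "(p has_vector_derivative p') (at x)" and b: "p x = b" by blast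
  obtain d where d: "d > 0" "\<And>y. \<bar>y - x\<bar> < d \<Longrightarrow>
      norm (p y - p x - (y - x) *\<^sub>R p') \<le> norm p' / 2 * \<bar>y - x\<bar>"
  proof -
    have "0 < norm p' / 2" using p'(1) by simp
    then obtain d where "d > 0" "\<forall>y. norm (y - x) < d \<longrightarrow>
        norm (p y - p x - (y - x) *\<^sub>R p') \<le> norm p' / 2 * norm (y - x)"
      using p'(2) unfolding has_vector_derivative_def has_derivative_at_alt by blast
    then show ?thesis using that by simp
  qed
  have "y = x" if y: "y \<in> ball x d" "y \<in> ?S" for y
  proof (rule ccontr)
    assume ne: "y \<noteq> x"
    have "norm (p y - p x - (y - x) *\<^sub>R p') = \<bar>y - x\<bar> * norm p'" using y(2) b by simp
    moreover have "\<bar>y - x\<bar> < d" using y(1) by (simp add: dist_real_def abs_minus_commute)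
    ultimately have "\<bar>y - x\<bar> * norm p' \<le> norm p' / 2 * \<bar>y - x\<bar>" using d(2) by metis
    moreover have "0 < \<bar>y - x\<bar> * norm p'" using ne p'(1) by simp
    ultimately show False by (simp add: mult.commute)
  qed
  then have "ball x d \<inter> ?S \<subseteq> {x}" by blast
  moreover have "x \<in> ball x d" using d(1) by simp
  ultimately have "ball x d \<inter> ?S = {x}" using x by blast
  then show "\<exists>U. open U \<and> x \<in> U \<and> U \<inter> ?S = {x}"
    using \<open>x \<in> ball x d\<close> open_ball by blast
qed

text \<open>
  A path may rest in a point of \<open>B\<close> for a while, but then its velocity is zero and the value of the integrand
  is irrelevant; the remaining visits to \<open>B\<close> form a countable set of times.
\<close>

lemma contour_integral_spike_finite_primitive:
  assumes p: "valid_path p" and Q: "\<And>x. (Q has_field_derivative g x) (at x)"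
    and B: "finite B" "\<And>x. x \<notin> B \<Longrightarrow> g' x = g x"
  shows "contour_integral p g' = Q (p 1) - Q (p 0)"
proof -
  have "(g has_contour_integral (Q (pathfinish p) - Q (pathstart p))) p"
    using Q by (intro contour_integral_primitive[where S = UNIV, OF _ p]) auto
  then have g: "((\<lambda>t. g (p t) * vector_derivative p (at t)) has_integral (Q (p 1) - Q (p 0))) {0..1}"
    by (simp add: has_contour_integral pathfinish_def pathstart_def)
  obtain K where K: "finite K" "p C1_differentiable_on ({0..1} - K)"
    using p by (auto simp: valid_path_def piecewise_C1_differentiable_on_def)
  let ?N = "K \<union> (\<Union>b\<in>B. {t. p t = b \<and> (\<exists>p'. p' \<noteq> 0 \<and> (p has_vector_derivative p') (at t))})"
  have "countable ?N"
    using K(1) B(1) nonstationary_preimage_countable by (intro countable_Un countable_UN) (auto intro: countable_finite)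
  then have "negligible (\<Union> ((\<lambda>t. {t}) ` ?N))"
    by (intro negligible_countable_Union) auto
  then have neg: "negligible ?N" by (simp only: UN_singleton)
  have "((\<lambda>t. g' (p t) * vector_derivative p (at t)) has_integral (Q (p 1) - Q (p 0))) {0..1}"
  proof (rule has_integral_spike[OF neg _ g])
    fix t assume t: "t \<in> {0..1} - ?N"
    then have d: "(p has_vector_derivative vector_derivative p (at t)) (at t)"
      using K(2) by (auto simp: C1_differentiable_on_eq vector_derivative_works)
    show "g' (p t) * vector_derivative p (at t) = g (p t) * vector_derivative p (at t)"
    proof (cases "p t \<in> B")
      case True
      then have "vector_derivative p (at t) = 0" using t d by blast
      then show ?thesis by simp
    qed (simp add: B(2))
  qed
  then show ?thesis
    by (intro contour_integral_unique) (simp add: has_contour_integral)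
qed

lemma homology_integral_relcycle:
  fixes z :: "complex ^ 'n::finite"
  assumes z: "z \<in> config" and \<tau>: "\<tau> \<in> carrier (relative_homology_group 1 euclidean (marked z))"
    and d: "d \<in> \<tau>" and Q: "\<And>x. (Q has_field_derivative g x) (at x)"
    and B: "finite B" "\<And>x. x \<notin> B \<Longrightarrow> g' x = g x"
  shows "homology_integral \<tau> g' = (\<Sum>i\<in>UNIV. end_coeff d (z $ i) * Q (z $ i))"
proof -
  have val: "chain_integral d' g' = (\<Sum>i\<in>UNIV. end_coeff d (z $ i) * Q (z $ i))"
    if d': "d' \<in> \<tau>" "smooth_chain d'" for d'
  proof -
    have "chain_integral d' g' = chain_sum d' (\<lambda>f. Q (simplex_path f 1) - Q (simplex_path f 0))"
      unfolding chain_integral_chain_sum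
      by (intro chain_sum_cong contour_integral_spike_finite_primitive[OF _ Q B] smooth_chainD[OF d'(2)])
    also have "\<dots> = chain_sum (chain_boundary (Suc 0) d') (\<lambda>g. Q (g vertex0))"
      by (rule chain_sum_boundary[symmetric])
    also have "\<dots> = chain_sum (chain_boundary (Suc 0) d) (\<lambda>g. Q (g vertex0))"
      using homology_class_homologous[OF \<tau> d'(1)] d
      by (intro chain_sum_boundary_homologous[OF marked_finite_open(1)[of z]]) simp
    also have "\<dots> = (\<Sum>i\<in>UNIV. end_coeff d (z $ i) * Q (z $ i))"
      by (rule chain_sum_relcycle_boundary[OF z homology_class_relcycle[OF \<tau> d]])
    finally show ?thesis .
  qed
  obtain d' where d': "d' \<in> \<tau>" "smooth_chain d'"
    using exists_transversal_relcycle[OF z _ _ \<tau>, of 0] by (auto simp: segment_chain_def)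
  show ?thesis
    unfolding homology_integral_def
  proof (rule the_equality)
    show "\<exists>c\<in>\<tau>. smooth_chain c \<and> (\<Sum>i\<in>UNIV. end_coeff d (z $ i) * Q (z $ i)) = chain_integral c g'"
      using d' val by metis
  qed (use val in blast)
qed

section \<open>Horizontal families are locally constant\<close>

lemma trivialization_punctured:
  fixes z z0 :: "complex ^ 'n::finite"
  assumes "homeomorphism UNIV UNIV h h'" "\<And>i. h (z0 $ i) = z $ i"
  shows "continuous_map (punctured_plane z0) (punctured_plane z) h"
proof -
  have "continuous_on UNIV h" "inj h"
    using assms(1) by (auto simp: homeomorphism_def intro: inj_on_inverseI)
  then have "h t \<notin> marked z" if "t \<notin> marked z0" for t
    using that assms(2) by (auto simp: marked_def image_iff) (metis injD)
  then show ?thesis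
    using \<open>continuous_on UNIV h\<close>
    by (auto simp: punctured_plane_def intro: continuous_on_subset)
qed

text \<open>
  Trivializations are only continuous, so the transported chain need not be smooth even if \<open>c\<close> is. But on the
  compact support of \<open>c\<close> the map \<open>h z\<close> is close to the identity for \<open>z\<close> near \<open>z0\<close>, and the straight-line
  homotopy between both keeps away from the marked points. Hence \<open>c\<close> itself represents the nearby classes.
\<close>

lemma horizontal_cycle_locally_constant:
  fixes \<sigma> :: "complex ^ 'n::finite \<Rightarrow> complex chain set"
  assumes \<sigma>: "horizontal_cycle U \<sigma>" and z0: "z0 \<in> U" and c: "c \<in> \<sigma> z0"
  obtains W where "open W" "z0 \<in> W" "W \<subseteq> U" "\<And>z. z \<in> W \<Longrightarrow> c \<in> \<sigma> z"
proof -
  have \<sigma>z0: "\<sigma> z0 \<in> carrier (homology_group 1 (punctured_plane z0))"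
    using \<sigma> z0 by (auto simp: horizontal_cycle_def)
  obtain V h where V: "V \<subseteq> U" "local_trivialization V z0 h"
    and h: "\<And>z. z \<in> V \<Longrightarrow> \<sigma> z = hom_induced 1 (punctured_plane z0) {} (punctured_plane z) {} (h z) (\<sigma> z0)"
    using \<sigma> z0 unfolding horizontal_cycle_def by blast
  have lt: "open V" "z0 \<in> V" "continuous_on (V \<times> UNIV) (\<lambda>(z, t). h z t)" "h z0 = id"
    and hz: "\<And>z. z \<in> V \<Longrightarrow> (\<exists>h'. homeomorphism UNIV UNIV (h z) h') \<and> (\<forall>i. h z (z0 $ i) = z $ i)"
    using V(2) unfolding local_trivialization_def by auto
  have rc: "singular_relcycle (Suc 0) (punctured_plane z0) {} c"
    by (rule homology_class_relcycle[OF \<sigma>z0 c])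
  have cls: "\<sigma> z0 = homologous_rel_set (Suc 0) (punctured_plane z0) {} c"
    using homology_class_homologous[OF \<sigma>z0 c] by blast
  have ch: "singular_chain (Suc 0) (punctured_plane z0) c" "chain_boundary (Suc 0) c = 0"
    using rc singular_relcycle_empty[of "- marked z0" c] by (auto simp: punctured_plane_def)
  define K where "K = (\<Union>f\<in>Poly_Mapping.keys c. f ` standard_simplex (Suc 0))"
  have simp1: "singular_simplex (Suc 0) (punctured_plane z0) f" if "f \<in> Poly_Mapping.keys c" for f
    using ch(1) that by (auto simp: singular_chain_def)
  have "compact (f ` standard_simplex (Suc 0))" if f: "f \<in> Poly_Mapping.keys c" for f
  proof -
    have "compactin (subtopology (powertop_real UNIV) (standard_simplex (Suc 0))) (standard_simplex (Suc 0))"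
      using compactin_standard_simplex by (simp add: compactin_subtopology)
    moreover have "continuous_map (subtopology (powertop_real UNIV) (standard_simplex (Suc 0))) euclidean f"
      using simp1[OF f] by (simp add: singular_simplex_def continuous_map_in_subtopology punctured_plane_def)
    ultimately have "compactin euclidean (f ` standard_simplex (Suc 0))"
      by (rule image_compactin)
    then show ?thesis by simp
  qed
  then have K: "compact K" unfolding K_def by (intro compact_UN) auto
  have KS: "K \<inter> marked z0 = {}"
    using simp1 by (force simp: K_def singular_simplex_def continuous_map_in_subtopology punctured_plane_def)
  have cK: "singular_relcycle (Suc 0) (top_of_set K) {} c"
  proof -
    have "singular_simplex (Suc 0) (top_of_set K) f" if "f \<in> Poly_Mapping.keys c" for f
      using simp1[OF that] that
      by (auto simp: K_def singular_simplex_def continuous_map_in_subtopology punctured_plane_def)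
    then show ?thesis using ch(2) by (auto simp: singular_cycle singular_chain_def)
  qed
  obtain e where e: "e > 0" "\<And>t i. t \<in> K \<Longrightarrow> e \<le> dist t (z0 $ i)"
  proof -
    obtain e where "e > 0" "\<forall>x\<in>K. \<forall>y\<in>marked z0. e \<le> dist x y"
      using separate_compact_closed[OF K finite_imp_closed[OF marked_finite_open(1)] KS] by blast
    then show ?thesis using that by (auto simp: marked_def)
  qed
  have "continuous_on (V \<times> K) (\<lambda>(z, t). h z t)"
    using lt(3) by (rule continuous_on_subset) auto
  then obtain X where X: "z0 \<in> X" "open X" "\<forall>z\<in>X \<inter> V. \<forall>t\<in>K. dist (h z t) (h z0 t) \<le> e / 4"
    using continuous_on_prod_compactE[OF _ K lt(2), of "\<lambda>(z, t). h z t" "e / 4"] e(1)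
    by (auto simp: case_prod_unfold)
  define W where "W = V \<inter> X \<inter> ball z0 (e / 2)"
  have "c \<in> \<sigma> z" if z: "z \<in> W" for z
  proof -
    have zV: "z \<in> V" using z by (simp add: W_def)
    obtain h' where h': "homeomorphism UNIV UNIV (h z) h'" "\<And>i. h z (z0 $ i) = z $ i"
      using hz[OF zV] by blast
    have away: "e / 2 < dist t (z $ i)" if "t \<in> K" for t i
    proof -
      have "dist (z0 $ i) (z $ i) < e / 2"
        using z dist_vec_nth_le[of z0 i z] by (auto simp: W_def)
      then show ?thesis using e(2)[OF that, of i] dist_triangle[of t "z0 $ i" "z $ i"]
        by (simp add: dist_commute)
    qed
    have line: "linepath (h z t) t s \<notin> marked z" if "t \<in> K" "s \<in> {0..1}" for s t
    proof
      assume "linepath (h z t) t s \<in> marked z"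
      then obtain i where i: "linepath (h z t) t s = z $ i" by (auto simp: marked_def)
      have "dist t (linepath (h z t) t s) = (1 - s) * dist (h z t) t"
      proof -
        have "linepath (h z t) t s - t = (1 - s) *\<^sub>R (h z t - t)"
          by (simp add: linepath_def algebra_simps)
        then have "norm (linepath (h z t) t s - t) = (1 - s) * norm (h z t - t)"
          using that(2) by simp
        then show ?thesis by (metis dist_commute dist_norm)
      qed
      also have "\<dots> \<le> 1 * dist (h z t) t" using that(2) by (intro mult_right_mono) auto
      also have "\<dots> \<le> e / 4" using X(3) z that(1) lt(4) by (auto simp: W_def)
      finally show False using away[OF that(1), of i] e(1) i by simp
    qed
    have "homotopic_with (\<lambda>h. h \<in> {} \<rightarrow> {}) (top_of_set K) (punctured_plane z) (h z) id"
    proof -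
      have "continuous_on K (h z)"
        using h'(1) by (auto simp: homeomorphism_def intro: continuous_on_subset)
      then have "continuous_on ({0..1} \<times> K) (\<lambda>y. linepath (h z (snd y)) (snd y) (fst y))"
        unfolding linepath_def by (intro continuous_intros) (auto intro!: continuous_on_compose2[OF _ continuous_on_snd])
      then show ?thesis
        unfolding homotopic_with_def punctured_plane_def
        using line
        by (intro exI[of _ "\<lambda>y. linepath (h z (snd y)) (snd y) (fst y)"])
          (auto simp: linepath_def)
    qed
    from homotopic_imp_homologous_rel_chain_maps[OF this cK]
    have "homologous_rel (Suc 0) (punctured_plane z) {} (chain_map (Suc 0) (h z) c) c"
      using cK chain_map_ident[of "Suc 0" "top_of_set K" c] by (simp add: singular_relcycle_def)
    moreover have "\<sigma> z = homologous_rel_set (Suc 0) (punctured_plane z) {} (chain_map (Suc 0) (h z) c)"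
      using hom_induced_chain_map[OF trivialization_punctured[OF h'] _ rc, of "{}"] h[OF zV] cls by simp
    ultimately show ?thesis by simp
  qed
  moreover have "open W" "z0 \<in> W" "W \<subseteq> U"
    using lt X V(1) e(1) by (auto simp: W_def)
  ultimately show ?thesis using that by blast
qed

text \<open>
  The trivialization maps the boundary point \<open>z0\<^sub>i\<close> to \<open>z\<^sub>i\<close> and keeps its multiplicity.
\<close>

lemma end_coeff_chain_map:
  fixes z z0 :: "complex ^ 'n::finite"
  assumes z0: "z0 \<in> config" and z: "z \<in> config" and h: "\<And>i. h (z0 $ i) = z $ i"
    and d: "singular_relcycle (Suc 0) euclidean (marked z0) d"
  shows "end_coeff (chain_map (Suc 0) h d) (z $ i) = end_coeff d (z0 $ i)"
proof -
  have sc: "singular_chain (Suc 0) euclidean d" using d by (simp add: singular_relcycle_def)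
  have "end_coeff (chain_map (Suc 0) h d) (z $ i) =
      chain_sum (chain_boundary (Suc 0) d) (\<lambda>g. (\<lambda>x. if h x = z $ i then 1 else 0) (g vertex0))"
    unfolding end_coeff_def chain_boundary_chain_map[OF sc]
    by (simp add: chain_map_def chain_sum_extend simplex_map_def standard_simplex_0)
  also have "\<dots> = (\<Sum>j\<in>UNIV. end_coeff d (z0 $ j) * (if h (z0 $ j) = z $ i then 1 else 0))"
    by (rule chain_sum_relcycle_boundary[OF z0 d])
  also have "\<dots> = (\<Sum>j\<in>UNIV. if j = i then end_coeff d (z0 $ i) else 0)"
    using z by (intro sum.cong) (auto simp: h config_def)
  finally show ?thesis by simp
qed

lemma horizontal_relcycle_locally_constant:
  fixes \<tau> :: "complex ^ 'n::finite \<Rightarrow> complex chain set"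
  assumes \<tau>: "horizontal_relcycle U \<tau>" and U: "U \<subseteq> config" and z0: "z0 \<in> U" and d: "d \<in> \<tau> z0"
  obtains W where "open W" "z0 \<in> W" "W \<subseteq> U"
    "\<And>z. z \<in> W \<Longrightarrow> \<exists>d'\<in>\<tau> z. \<forall>i. end_coeff d' (z $ i) = end_coeff d (z0 $ i)"
proof -
  have \<tau>z0: "\<tau> z0 \<in> carrier (relative_homology_group 1 euclidean (marked z0))"
    using \<tau> z0 by (auto simp: horizontal_relcycle_def)
  obtain V h where V: "V \<subseteq> U" "local_trivialization V z0 h"
    and h: "\<And>z. z \<in> V \<Longrightarrow> \<tau> z = hom_induced 1 euclidean (marked z0) euclidean (marked z) (h z) (\<tau> z0)"
    using \<tau> z0 unfolding horizontal_relcycle_def by blast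
  have lt: "open V" "z0 \<in> V"
    and hz: "\<And>z. z \<in> V \<Longrightarrow> (\<exists>h'. homeomorphism UNIV UNIV (h z) h') \<and> (\<forall>i. h z (z0 $ i) = z $ i)"
    using V(2) unfolding local_trivialization_def by auto
  have rc: "singular_relcycle (Suc 0) euclidean (marked z0) d"
    by (rule homology_class_relcycle[OF \<tau>z0 d])
  have cls: "\<tau> z0 = homologous_rel_set (Suc 0) euclidean (marked z0) d"
    using homology_class_homologous[OF \<tau>z0 d] by blast
  have "\<exists>d'\<in>\<tau> z. \<forall>i. end_coeff d' (z $ i) = end_coeff d (z0 $ i)" if z: "z \<in> V" for z
  proof (intro bexI[of _ "chain_map (Suc 0) (h z) d"] allI)
    obtain h' where h': "homeomorphism UNIV UNIV (h z) h'" "\<And>i. h z (z0 $ i) = z $ i"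
      using hz[OF z] by blast
    have "continuous_map euclidean euclidean (h z)"
      using h'(1) by (simp add: homeomorphism_def)
    moreover have "h z \<in> marked z0 \<rightarrow> marked z" using h'(2) by (auto simp: marked_def)
    ultimately have "\<tau> z = homologous_rel_set (Suc 0) euclidean (marked z) (chain_map (Suc 0) (h z) d)"
      using hom_induced_chain_map[OF _ _ rc, of euclidean "h z" "marked z"] h[OF z] cls by simp
    then show "chain_map (Suc 0) (h z) d \<in> \<tau> z" by simp
    show "end_coeff (chain_map (Suc 0) (h z) d) (z $ i) = end_coeff d (z0 $ i)" for i
      using U z0 V(1) z by (intro end_coeff_chain_map[OF _ _ h'(2) rc]) auto
  qed
  then show ?thesis using that[of V] lt V(1) by blast
qed

section \<open>Differentiating the integrands\<close>

text \<open>
  All integrands that occur have this form, for exponents that may be negative.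
\<close>

definition root_prod :: "('n \<Rightarrow> int) \<Rightarrow> complex ^ 'n::finite \<Rightarrow> complex \<Rightarrow> complex" where
  "root_prod e z t = (\<Prod>l\<in>UNIV. (t - z $ l) powi e l)"

text \<open>
  The summand for \<open>j\<close> in the derivative of \<open>root_prod e z\<close> with respect to \<open>t\<close>. It is at the same time the
  negative of the derivative with respect to \<open>z\<^sub>j\<close>, as \<open>root_prod\<close> depends on the differences \<open>t - z\<^sub>j\<close>
  only.
\<close>

definition root_dprod :: "'n \<Rightarrow> ('n \<Rightarrow> int) \<Rightarrow> complex ^ 'n::finite \<Rightarrow> complex \<Rightarrow> complex" where
  "root_dprod j e z t = of_int (e j) * (t - z $ j) powi (e j - 1) * (\<Prod>l\<in>UNIV - {j}. (t - z $ l) powi e l)"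

definition regular_at :: "('n \<Rightarrow> int) \<Rightarrow> complex ^ 'n::finite \<Rightarrow> complex \<Rightarrow> bool" where
  "regular_at e z t \<longleftrightarrow> (\<forall>l. t \<noteq> z $ l \<or> e l \<ge> 0)"

text \<open>
  At \<open>x = 0\<close> with \<open>n = 0\<close> the power on the right is meaningless, but its factor \<open>n\<close> is zero.
\<close>

lemma has_field_derivative_power_int:
  fixes x :: complex
  assumes "x \<noteq> 0 \<or> n \<ge> 0"
  shows "((\<lambda>x. x powi n) has_field_derivative of_int n * x powi (n - 1)) (at x)"
proof (cases "n \<ge> 0")
  case True
  then obtain k where k: "n = int k" using nonneg_int_cases by blast
  show ?thesis
  proof (cases k)
    case 0 then show ?thesis by (simp add: k)
  next
    case (Suc k')
    have "((\<lambda>x. x ^ k) has_field_derivative of_nat k * x ^ (k - 1)) (at x)"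
      by (auto intro!: derivative_eq_intros)
    moreover have "(\<lambda>x::complex. x powi n) = (\<lambda>x. x ^ k)" by (simp only: k power_int_of_nat)
    moreover have "of_int n * x powi (n - 1) = of_nat k * x ^ (k - 1)"
    proof -
      have "n - 1 = int (k - 1)" using k Suc by simp
      then have "x powi (n - 1) = x ^ (k - 1)" by (simp only: power_int_of_nat)
      then show ?thesis by (simp add: k)
    qed
    ultimately show ?thesis by (simp only:)
  qed
next
  case False
  then have "x \<noteq> 0" using assms by simp
  then show ?thesis by (auto intro!: derivative_eq_intros)
qed

lemma has_derivative_root_prod:
  fixes z :: "complex ^ 'n::finite"
  assumes ok: "regular_at e z t"
  shows "((\<lambda>x. root_prod e (fst x) (snd x)) has_derivative
     (\<lambda>x. \<Sum>j\<in>UNIV. (snd x - fst x $ j) * root_dprod j e z t)) (at (z, t))"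
proof -
  have 1: "((\<lambda>x::(complex ^ 'n) \<times> complex. snd x - fst x $ l) has_derivative (\<lambda>x. snd x - fst x $ l)) (at (z, t))" for l
    by (rule bounded_linear_imp_has_derivative)
      (intro bounded_linear_sub bounded_linear_snd bounded_linear_compose[OF bounded_linear_vec_nth bounded_linear_fst])
  have "((\<lambda>x::(complex ^ 'n) \<times> complex. (snd x - fst x $ l) powi e l) has_derivative
      (\<lambda>x. of_int (e l) * (t - z $ l) powi (e l - 1) * (snd x - fst x $ l))) (at (z, t))" for l
  proof -
    have "t - z $ l \<noteq> 0 \<or> e l \<ge> 0" using ok by (auto simp: regular_at_def)
    from has_field_derivative_power_int[OF this]
    have "((\<lambda>x. x powi e l) has_derivative (*) (of_int (e l) * (t - z $ l) powi (e l - 1))) (at (t - z $ l))"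
      by (simp add: has_field_derivative_def)
    then show ?thesis using has_derivative_compose[OF 1[of l]] by simp
  qed
  then have "((\<lambda>x::(complex ^ 'n) \<times> complex. \<Prod>l\<in>UNIV. (snd x - fst x $ l) powi e l) has_derivative
      (\<lambda>x. \<Sum>j\<in>UNIV. of_int (e j) * (t - z $ j) powi (e j - 1) * (snd x - fst x $ j) *
         (\<Prod>l\<in>UNIV - {j}. (snd (z, t) - fst (z, t) $ l) powi e l))) (at (z, t))"
    by (intro has_derivative_prod) auto
  then show ?thesis
    unfolding root_prod_def root_dprod_def by (rule has_derivative_eq_rhs) (auto simp: fun_eq_iff algebra_simps intro!: sum.cong)
qed

lemma root_prod_derivative_param:
  assumes "regular_at e z t"
  shows "((\<lambda>z. root_prod e z t) has_derivative (\<lambda>h. \<Sum>j\<in>UNIV. h $ j * (- root_dprod j e z t))) (at z)"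
proof -
  have "((\<lambda>z. (z, t)) has_derivative (\<lambda>h. (h, 0))) (at z)"
    by (auto intro!: derivative_eq_intros)
  from has_derivative_compose[OF this has_derivative_root_prod[OF assms]]
  show ?thesis by simp
qed

lemma root_prod_derivative_var:
  assumes "regular_at e z t"
  shows "(root_prod e z has_field_derivative (\<Sum>j\<in>UNIV. root_dprod j e z t)) (at t)"
proof -
  have "((\<lambda>t. (z, t)) has_derivative (\<lambda>k. (0, k))) (at t)"
    by (auto intro!: derivative_eq_intros)
  from has_derivative_compose[OF this has_derivative_root_prod[OF assms]]
  have "((\<lambda>t. root_prod e z t) has_derivative (\<lambda>k. \<Sum>j\<in>UNIV. k * root_dprod j e z t)) (at t)" by simp
  then show ?thesis
    unfolding has_field_derivative_def
    by (rule has_derivative_eq_rhs) (simp add: fun_eq_iff sum_distrib_left[symmetric] mult.commute)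
qed

lemma continuous_on_power_int_regular:
  fixes f :: "'a::topological_space \<Rightarrow> complex"
  assumes "continuous_on S f" "\<And>x. x \<in> S \<Longrightarrow> f x \<noteq> 0 \<or> n \<ge> 0"
  shows "continuous_on S (\<lambda>x. f x powi n)"
proof (cases "n \<ge> 0")
  case True
  then obtain k where "n = int k" using nonneg_int_cases by blast
  then show ?thesis using assms(1) by (auto intro: continuous_intros)
next
  case False
  then show ?thesis using assms by (intro continuous_on_power_int) auto
qed

lemma continuous_on_root_prod:
  assumes "continuous_on S Z" "continuous_on S T" "\<And>x. x \<in> S \<Longrightarrow> regular_at e (Z x) (T x)"
  shows "continuous_on S (\<lambda>x. root_prod e (Z x) (T x))" "continuous_on S (\<lambda>x. root_dprod j e (Z x) (T x))"
proof -
  have c: "continuous_on S (\<lambda>x. T x - Z x $ l)" for l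
    using assms(1,2) by (intro continuous_intros)
  have f: "continuous_on S (\<lambda>x. (T x - Z x $ l) powi e l)" for l
    using assms(3) by (intro continuous_on_power_int_regular c) (auto simp: regular_at_def)
  then show "continuous_on S (\<lambda>x. root_prod e (Z x) (T x))"
    unfolding root_prod_def by (intro continuous_on_prod)
  have d: "continuous_on S (\<lambda>x. of_int (e j) * (T x - Z x $ j) powi (e j - 1))"
  proof (cases "e j = 0")
    case False
    then show ?thesis using assms(3)
      by (intro continuous_intros continuous_on_power_int_regular c) (force simp: regular_at_def)
  qed auto
  then show "continuous_on S (\<lambda>x. root_dprod j e (Z x) (T x))"
    unfolding root_dprod_def by (intro continuous_on_mult d continuous_on_prod f)
qed

text \<open>
  Exponents of the \<open>b\<close>-th component of the integrand of a solution of the KZ equation with parameter \<open>k\<close>: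
  \<open>k = m\<close> for \<open>psi\<close> and \<open>k = - m\<close> for \<open>phi\<close>.
\<close>

definition expo :: "int \<Rightarrow> 'n \<Rightarrow> 'n \<Rightarrow> int" where
  "expo k b l = (if l = b then - k - 1 else - k)"

text \<open>
  Up to a common factor this is the partial fraction decomposition of \<open>1 / ((t - z\<^sub>j) (t - z\<^sub>b))\<close>. It is proved on
  the level of exponents so that, for negative \<open>k\<close>, it includes the points \<open>t = z\<^sub>j\<close> and \<open>t = z\<^sub>b\<close>.
\<close>

lemma root_dprod_exchange:
  fixes z :: "complex ^ 'n::finite"
  assumes "j \<noteq> b" "z $ j \<noteq> z $ b" "k \<noteq> 0"
  shows "root_dprod j (expo k b) z t = - of_int k * (root_prod (expo k j) z t - root_prod (expo k b) z t) / (z $ j - z $ b)"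
proof -
  define A where "A = (\<Prod>l\<in>UNIV - {j} - {b}. (t - z $ l) powi (- k))"
  let ?x = "t - z $ j" and ?y = "t - z $ b"
  have A: "(\<Prod>l\<in>UNIV - {j} - {b}. (t - z $ l) powi expo k c l) = A" if "c \<in> {j, b}" for c
    unfolding A_def using that by (intro prod.cong) (auto simp: expo_def)
  have split: "root_prod (expo k c) z t = ?x powi expo k c j * (?y powi expo k c b * A)" if "c \<in> {j, b}" for c
    unfolding root_prod_def A[OF that, symmetric] using assms(1) by (simp add: prod.remove[of _ j] prod.remove[of _ b])
  have d: "root_dprod j (expo k b) z t = of_int (expo k b j) * ?x powi (expo k b j - 1) * (?y powi expo k b b * A)"
    unfolding root_dprod_def A[of b, symmetric, simplified] using assms(1) by (simp add: prod.remove[of _ b])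
  have p: "x powi (- k) = x powi (- k - 1) * x" for x :: complex
    using power_int_minus_mult[of x "- k"] assms(3) by simp
  have "root_prod (expo k j) z t - root_prod (expo k b) z t = ?x powi (- k - 1) * ?y powi (- k - 1) * A * (?y - ?x)"
    using assms(1) split[of j] split[of b] by (simp add: expo_def p algebra_simps)
  then show ?thesis
    unfolding d using assms by (simp add: expo_def)
qed

text \<open>
  Thus the sum of all components of the integrand is a \<open>t\<close>-derivative; this is why the solutions have
  coordinate sum zero.
\<close>

lemma root_dprod_const: "root_dprod b (\<lambda>_. - k) z t = - of_int k * root_prod (expo k b) z t"
proof -
  have "(\<Prod>l\<in>UNIV - {b}. (t - z $ l) powi expo k b l) = (\<Prod>l\<in>UNIV - {b}. (t - z $ l) powi (- k))"
    by (intro prod.cong) (auto simp: expo_def)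
  then show ?thesis
    by (simp add: root_dprod_def root_prod_def prod.remove[of UNIV b] expo_def)
qed

text \<open>
  Differentiation under the integral sign. The partial derivatives are assembled to a bounded linear map,
  which depends continuously on all variables because they do.
\<close>

lemma has_derivative_integral_param:
  fixes G :: "complex ^ 'n::finite \<Rightarrow> real \<Rightarrow> complex"
  assumes W: "open W" "z0 \<in> W"
    and der: "\<And>z u. z \<in> W \<Longrightarrow> u \<in> {0..1} \<Longrightarrow>
        ((\<lambda>z. G z u) has_derivative (\<lambda>h. \<Sum>i\<in>UNIV. h $ i * g i z u)) (at z)"
    and cont: "\<And>i. continuous_on (W \<times> {0..1}) (\<lambda>x. g i (fst x) (snd x))"
    and contG: "\<And>z. z \<in> W \<Longrightarrow> continuous_on {0..1} (G z)"
  shows "((\<lambda>z. integral {0..1} (G z)) has_derivative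
     (\<lambda>h. \<Sum>i\<in>UNIV. h $ i * integral {0..1} (g i z0))) (at z0)"
proof -
  obtain r where r: "r > 0" "ball z0 r \<subseteq> W" using W by (auto simp: open_contains_ball)
  define coord :: "'n \<Rightarrow> (complex ^ 'n) \<Rightarrow>\<^sub>L complex" where "coord i = Blinfun (\<lambda>h. h $ i)" for i
  have coord: "blinfun_apply (coord i) h = h $ i" for i h
    unfolding coord_def by (simp add: bounded_linear_Blinfun_apply bounded_linear_vec_nth)
  define fx where "fx z u = (\<Sum>i\<in>UNIV. blinfun_mult_right (g i z u) o\<^sub>L coord i)" for z u
  have app: "blinfun_apply (fx z u) h = (\<Sum>i\<in>UNIV. h $ i * g i z u)" for z u h
    by (simp add: fx_def blinfun.sum_left coord mult.commute)
  have gc: "continuous_on {0..1} (g i z0)" for i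
  proof -
    have "continuous_on {0..1} (\<lambda>u. (\<lambda>x. g i (fst x) (snd x)) (z0, u))"
      by (rule continuous_on_compose2[OF cont[of i]]) (use W in \<open>auto intro!: continuous_intros\<close>)
    then show ?thesis by simp
  qed
  have cfx: "continuous_on (W \<times> {0..1}) (\<lambda>x. fx (fst x) (snd x))"
    unfolding fx_def
    by (intro continuous_intros bounded_bilinear.continuous_on[OF bounded_bilinear_blinfun_compose]
        bounded_linear.continuous_on[OF bounded_linear_blinfun_mult_right] cont)
  have "((\<lambda>z. integral (cbox 0 1) (G z)) has_derivative blinfun_apply (integral (cbox 0 1) (fx z0))) (at z0 within ball z0 r)"
  proof (rule leibniz_rule)
    show "((\<lambda>z. G z u) has_derivative blinfun_apply (fx z u)) (at z within ball z0 r)"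
      if "z \<in> ball z0 r" "u \<in> cbox 0 1" for z u
    proof -
      have "blinfun_apply (fx z u) = (\<lambda>h. \<Sum>i\<in>UNIV. h $ i * g i z u)" by (simp add: fun_eq_iff app)
      moreover have "z \<in> W" "u \<in> {0..1}" using that r(2) by auto
      ultimately show ?thesis using has_derivative_at_withinI[OF der] by simp
    qed
    show "G z integrable_on cbox 0 1" if "z \<in> ball z0 r" for z
      using contG[of z] that r(2) by (intro integrable_continuous) auto
    show "continuous_on (ball z0 r \<times> cbox 0 1) (\<lambda>(z, u). fx z u)"
      using cfx r(2) by (auto simp: case_prod_unfold intro: continuous_on_subset)
  qed (use r in auto)
  then have D: "((\<lambda>z. integral {0..1} (G z)) has_derivative blinfun_apply (integral {0..1} (fx z0))) (at z0)"
    using r(1) by (simp add: at_within_open[of z0 "ball z0 r"])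
  have "blinfun_apply (integral {0..1} (fx z0)) h = (\<Sum>i\<in>UNIV. h $ i * integral {0..1} (g i z0))" for h
  proof -
    have "continuous_on {0..1} (\<lambda>u. (\<lambda>x. fx (fst x) (snd x)) (z0, u))"
      by (rule continuous_on_compose2[OF cfx]) (use W in \<open>auto intro!: continuous_intros\<close>)
    then have "fx z0 integrable_on {0..1}" by (intro integrable_continuous_interval) simp
    then have "blinfun_apply (integral {0..1} (fx z0)) h = integral {0..1} (\<lambda>u. blinfun_apply (fx z0 u) h)"
      using integral_linear[of "fx z0" "{0..1}" "\<lambda>f. blinfun_apply f h"]
      by (simp add: o_def blinfun.bounded_linear_left)
    also have "\<dots> = (\<Sum>i\<in>UNIV. integral {0..1} (\<lambda>u. h $ i * g i z0 u))"
      unfolding app using gc by (intro integral_sum integrable_continuous_interval continuous_intros) auto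
    finally show ?thesis by simp
  qed
  then have "blinfun_apply (integral {0..1} (fx z0)) = (\<lambda>h. \<Sum>i\<in>UNIV. h $ i * integral {0..1} (g i z0))"
    by (rule ext)
  with D show ?thesis by (simp only:)
qed

section \<open>The KZ system for vectors of integrals\<close>

definition disc :: "int \<Rightarrow> complex ^ 'n::{finite,linorder} \<Rightarrow> complex" where
  "disc k z = (\<Prod>(i, j)\<in>{(i, j). i < j}. (z $ i - z $ j) powi (2 * k))"

lemma sum_ordered_pairs:
  fixes f :: "'n::{finite,linorder} \<Rightarrow> 'n \<Rightarrow> complex"
  shows "(\<Sum>x\<in>{(i, j). i < j}. f (fst x) (snd x) + f (snd x) (fst x)) = (\<Sum>i\<in>UNIV. \<Sum>j\<in>UNIV - {i}. f i j)"
proof -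
  let ?P = "{(i, j). i < j} :: ('n \<times> 'n) set" and ?M = "{(i, j). j < i} :: ('n \<times> 'n) set"
  have "(\<Sum>x\<in>?P. f (snd x) (fst x)) = (\<Sum>x\<in>?M. f (fst x) (snd x))"
    by (rule sum.reindex_bij_witness[of _ prod.swap prod.swap]) auto
  then have "(\<Sum>x\<in>?P. f (fst x) (snd x) + f (snd x) (fst x)) = (\<Sum>x\<in>?P \<union> ?M. f (fst x) (snd x))"
    by (subst sum.union_disjoint) (auto simp: sum.distrib)
  also have "?P \<union> ?M = (SIGMA i:UNIV. UNIV - {i})" by auto
  also have "(\<Sum>x\<in>\<dots>. f (fst x) (snd x)) = (\<Sum>i\<in>UNIV. \<Sum>j\<in>UNIV - {i}. f i j)"
    by (subst sum.Sigma) (auto simp: case_prod_unfold)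
  finally show ?thesis .
qed

lemma disc_derivative:
  fixes z :: "complex ^ 'n::{finite,linorder}"
  assumes z: "z \<in> config"
  shows "(disc k has_derivative (\<lambda>h. \<Sum>i\<in>UNIV. h $ i *
     (2 * of_int k * disc k z * (\<Sum>j\<in>UNIV - {i}. 1 / (z $ i - z $ j))))) (at z)"
proof -
  let ?P = "{(i, j). i < j} :: ('n \<times> 'n) set"
  let ?f = "\<lambda>x (z :: complex ^ 'n::{finite,linorder}). (z $ fst x - z $ snd x :: complex)"
  have nz: "?f x z \<noteq> 0" if "x \<in> ?P" for x using z that by (auto simp: config_def)
  have der: "((\<lambda>z. \<Prod>x\<in>?P. ?f x z powi (2 * k)) has_derivative
      (\<lambda>h. \<Sum>x\<in>?P. of_int (2 * k) * ?f x z powi (2 * k - 1) * ?f x h * (\<Prod>y\<in>?P - {x}. ?f y z powi (2 * k)))) (at z)"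
  proof (rule has_derivative_prod)
    fix x assume x: "x \<in> ?P"
    have 1: "(?f x has_derivative ?f x) (at z)"
      by (rule bounded_linear_imp_has_derivative) (intro bounded_linear_sub bounded_linear_vec_nth)
    have "?f x z \<noteq> 0 \<or> 2 * k \<ge> 0" using nz[OF x] by simp
    from has_field_derivative_power_int[OF this]
    have "((\<lambda>y. y powi (2 * k)) has_derivative (*) (of_int (2 * k) * ?f x z powi (2 * k - 1))) (at (?f x z))"
      by (simp only: has_field_derivative_def)
    from has_derivative_compose[OF 1 this]
    show "((\<lambda>z. ?f x z powi (2 * k)) has_derivative (\<lambda>h. of_int (2 * k) * ?f x z powi (2 * k - 1) * ?f x h)) (at z)" .
  qed
  have "(\<Sum>x\<in>?P. of_int (2 * k) * ?f x z powi (2 * k - 1) * ?f x h * (\<Prod>y\<in>?P - {x}. ?f y z powi (2 * k))) =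
     (\<Sum>i\<in>UNIV. h $ i * (2 * of_int k * disc k z * (\<Sum>j\<in>UNIV - {i}. 1 / (z $ i - z $ j))))" for h
  proof -
    have "(\<Sum>x\<in>?P. of_int (2 * k) * ?f x z powi (2 * k - 1) * ?f x h * (\<Prod>y\<in>?P - {x}. ?f y z powi (2 * k))) =
        (\<Sum>x\<in>?P. 2 * of_int k * disc k z * (h $ fst x / (z $ fst x - z $ snd x) + h $ snd x / (z $ snd x - z $ fst x)))"
    proof (rule sum.cong)
      fix x assume x: "x \<in> ?P"
      have "disc k z = ?f x z powi (2 * k) * (\<Prod>y\<in>?P - {x}. ?f y z powi (2 * k))"
        unfolding disc_def case_prod_unfold by (rule prod.remove) (use x in auto)
      moreover have "?f x z powi (2 * k - 1) = ?f x z powi (2 * k) / ?f x z"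
        using nz[OF x] by (simp add: power_int_diff)
      moreover have "h $ snd x / (z $ snd x - z $ fst x) = - (h $ snd x / ?f x z)"
        by (metis minus_diff_eq minus_divide_right)
      ultimately show "of_int (2 * k) * ?f x z powi (2 * k - 1) * ?f x h * (\<Prod>y\<in>?P - {x}. ?f y z powi (2 * k)) =
          2 * of_int k * disc k z * (h $ fst x / (z $ fst x - z $ snd x) + h $ snd x / (z $ snd x - z $ fst x))"
        by (simp add: diff_divide_distrib algebra_simps)
    qed simp
    also have "\<dots> = 2 * of_int k * disc k z * (\<Sum>i\<in>UNIV. \<Sum>j\<in>UNIV - {i}. h $ i / (z $ i - z $ j))"
      unfolding sum_distrib_left[symmetric] using sum_ordered_pairs[of "\<lambda>i j. h $ i / (z $ i - z $ j)"] by simp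
    finally show ?thesis by (simp add: sum_distrib_left algebra_simps)
  qed
  with der show ?thesis by (simp add: disc_def[abs_def] case_prod_unfold)
qed

lemma perm_act_transpose: "perm_act (Transposition.transpose i j) x $ l = x $ Transposition.transpose i j l"
  by (simp add: perm_act_def)

lemma has_derivative_vec_componentwise:
  fixes f :: "'a::real_normed_vector \<Rightarrow> 'n::finite \<Rightarrow> complex"
  assumes "\<And>b. ((\<lambda>x. f x b) has_derivative (\<lambda>h. f' h b)) (at z)"
  shows "((\<lambda>x. \<chi> b. f x b) has_derivative (\<lambda>h. \<chi> b. f' h b)) (at z)"
proof -
  have e: "(\<chi> b. x b) = (\<Sum>b\<in>UNIV. axis b (x b))" for x :: "'n \<Rightarrow> complex"
    by (simp add: vec_eq_iff axis_def if_distrib cong: if_cong)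
  have l: "bounded_linear (axis b :: complex \<Rightarrow> complex ^ 'n)" for b
    by (rule linear_conv_bounded_linear[THEN iffD1], rule linearI) (auto simp: vec_eq_iff axis_def)
  show ?thesis unfolding e
    by (intro has_derivative_sum bounded_linear.has_derivative[OF l] assms)
qed

text \<open>
  Here \<open>L j b\<close> is the derivative of the \<open>b\<close>-th integral with respect to \<open>z\<^sub>j\<close>. The integrals are invariant under
  simultaneous translation of all \<open>z\<^sub>j\<close>, so the derivatives with \<open>j \<noteq> b\<close> determine the one with \<open>j = b\<close>. The
  logarithmic derivative of \<open>disc k\<close> contributes \<open>2 k / (z\<^sub>i - z\<^sub>j)\<close>, which turns the differences \<open>I z i - I z b\<close> and
  \<open>I z j - I z i\<close> into the sums on the right-hand side of the KZ equation.
\<close>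

lemma KZ_equation_at:
  fixes z :: "complex ^ 'n::{finite,linorder}" and I :: "complex ^ 'n::{finite,linorder} \<Rightarrow> 'n \<Rightarrow> complex"
  assumes z: "z \<in> config"
    and der: "\<And>b. ((\<lambda>z. I z b) has_derivative (\<lambda>h. \<Sum>j\<in>UNIV. h $ j * L j b)) (at z)"
    and off: "\<And>j b. j \<noteq> b \<Longrightarrow> L j b = of_int k * (I z j - I z b) / (z $ j - z $ b)"
    and transl: "\<And>b. (\<Sum>j\<in>UNIV. L j b) = 0"
    and W: "open W" "z \<in> W" and F: "\<And>y. y \<in> W \<Longrightarrow> F y = (\<chi> b. disc k y * I y b)"
  shows "\<exists>D. (F has_derivative D) (at z) \<and> (\<forall>a v. D (a *s v) = a *s D v) \<and>
        (\<forall>i. D (axis i 1) = of_int k *s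
           (\<Sum>j\<in>UNIV - {i}. (1 / (z $ i - z $ j)) *s (perm_act (Transposition.transpose i j) (F z) + F z)))"
proof -
  define S where "S i = (\<Sum>j\<in>UNIV - {i}. 1 / (z $ i - z $ j))" for i
  define M where "M i b = disc k z * L i b + 2 * of_int k * disc k z * S i * I z b" for i b
  define D where "D h = (\<chi> b. \<Sum>i\<in>UNIV. h $ i * M i b)" for h
  have "((\<lambda>y. \<chi> b. disc k y * I y b) has_derivative D) (at z)"
    unfolding D_def
  proof (rule has_derivative_vec_componentwise)
    fix b
    show "((\<lambda>y. disc k y * I y b) has_derivative (\<lambda>h. \<Sum>i\<in>UNIV. h $ i * M i b)) (at z)"
      by (rule has_derivative_eq_rhs[OF has_derivative_mult[OF disc_derivative[OF z] der]])
        (simp add: fun_eq_iff M_def S_def sum_distrib_left sum_distrib_right sum.distrib[symmetric] algebra_simps)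
  qed
  then have 1: "(F has_derivative D) (at z)"
    by (rule has_derivative_transform_within_open[OF _ W]) (simp add: F)
  have 2: "D (a *s v) = a *s D v" for a v
    by (simp add: D_def vec_eq_iff sum_distrib_left mult.assoc)
  have 3: "D (axis i 1) $ b = (of_int k *s
           (\<Sum>j\<in>UNIV - {i}. (1 / (z $ i - z $ j)) *s (perm_act (Transposition.transpose i j) (F z) + F z))) $ b" for i b
  proof -
    have "D (axis i 1) $ b = (\<Sum>l\<in>UNIV. (if l = i then 1 else 0) * M l b)"
      by (simp add: D_def axis_def)
    also have "\<dots> = (\<Sum>l\<in>UNIV. if l = i then M i b else 0)"
      by (intro sum.cong) auto
    finally have lhs: "D (axis i 1) $ b = M i b" by simp
    let ?T = "\<lambda>j. (F z $ Transposition.transpose i j b + F z $ b) / (z $ i - z $ j)"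
    have rhs: "(of_int k *s
           (\<Sum>j\<in>UNIV - {i}. (1 / (z $ i - z $ j)) *s (perm_act (Transposition.transpose i j) (F z) + F z))) $ b =
        of_int k * (\<Sum>j\<in>UNIV - {i}. ?T j)"
      by (simp add: perm_act_transpose add_divide_distrib)
    have Fz: "F z $ b = disc k z * I z b" for b using F[OF W(2)] by simp
    have "M i b = of_int k * (\<Sum>j\<in>UNIV - {i}. ?T j)"
    proof (cases "i = b")
      case True
      have "L b b = - (\<Sum>j\<in>UNIV - {b}. L j b)"
        using transl[of b] by (simp add: sum.remove[of UNIV b] add_eq_0_iff)
      also have "(\<Sum>j\<in>UNIV - {b}. L j b) = (\<Sum>j\<in>UNIV - {b}. of_int k * (I z b - I z j) / (z $ b - z $ j))"
      proof (rule sum.cong)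
        fix j assume "j \<in> UNIV - {b}"
        then have "L j b = of_int k * (I z j - I z b) / (z $ j - z $ b)" using off by simp
        also have "\<dots> = (- (of_int k * (I z b - I z j))) / (- (z $ b - z $ j))" by (simp add: algebra_simps)
        finally show "L j b = of_int k * (I z b - I z j) / (z $ b - z $ j)" by (simp only: minus_divide_divide)
      qed simp
      finally have "M b b = (\<Sum>j\<in>UNIV - {b}. - disc k z * (of_int k * (I z b - I z j) / (z $ b - z $ j)) +
          2 * of_int k * disc k z * (1 / (z $ b - z $ j)) * I z b)"
        by (simp add: M_def S_def sum.distrib sum_negf sum_distrib_left sum_distrib_right sum_subtractf)
      also have "\<dots> = (\<Sum>j\<in>UNIV - {b}. of_int k * ?T j)"
      proof (rule sum.cong)
        fix j assume "j \<in> UNIV - {b}"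
        then show "- disc k z * (of_int k * (I z b - I z j) / (z $ b - z $ j)) +
          2 * of_int k * disc k z * (1 / (z $ b - z $ j)) * I z b = of_int k * ?T j"
          unfolding True[symmetric] Fz by (simp add: True diff_divide_distrib add_divide_distrib algebra_simps)
      qed simp
      finally show ?thesis using True by (simp add: sum_distrib_left)
    next
      case False
      have b: "b \<in> UNIV - {i}" using False by simp
      have Si: "S i = 1 / (z $ i - z $ b) + (\<Sum>j\<in>UNIV - {i} - {b}. 1 / (z $ i - z $ j))"
        unfolding S_def by (rule sum.remove[OF _ b]) simp
      have "(\<Sum>j\<in>UNIV - {i}. ?T j) = ?T b + (\<Sum>j\<in>UNIV - {i} - {b}. ?T j)"
        by (rule sum.remove[OF _ b]) simp
      also have "(\<Sum>j\<in>UNIV - {i} - {b}. ?T j) = (\<Sum>j\<in>UNIV - {i} - {b}. 2 * disc k z * I z b * (1 / (z $ i - z $ j)))"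
        using False by (intro sum.cong) (auto simp: Fz transpose_apply_other)
      also have "?T b = disc k z * (I z i + I z b) / (z $ i - z $ b)"
        by (simp add: Fz algebra_simps)
      finally have "of_int k * (\<Sum>j\<in>UNIV - {i}. ?T j) = of_int k * (disc k z * (I z i + I z b) / (z $ i - z $ b) +
          2 * disc k z * I z b * (\<Sum>j\<in>UNIV - {i} - {b}. 1 / (z $ i - z $ j)))"
        by (simp only: sum_distrib_left)
      moreover have "M i b = disc k z * (of_int k * (I z i - I z b) / (z $ i - z $ b)) +
          2 * of_int k * disc k z * (1 / (z $ i - z $ b) + (\<Sum>j\<in>UNIV - {i} - {b}. 1 / (z $ i - z $ j))) * I z b"
        unfolding M_def Si using off[OF False] by simp
      ultimately show ?thesis
        by (simp add: diff_divide_distrib add_divide_distrib algebra_simps)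
    qed
    then show ?thesis unfolding lhs rhs .
  qed
  show ?thesis
    using 1 2 3 by (intro exI[of _ D]) (auto simp: vec_eq_iff)
qed

section \<open>Linearity of integrals over chains\<close>

lemma chain_integral_cong:
  assumes "\<And>f t. f \<in> Poly_Mapping.keys c \<Longrightarrow> t \<in> path_image (simplex_path f) \<Longrightarrow> g t = g' t"
  shows "chain_integral c g = chain_integral c g'"
  unfolding chain_integral_chain_sum
  by (intro chain_sum_cong contour_integral_cong) (use assms in auto)

lemma chain_integral_sum:
  assumes "finite J" "\<And>i f. i \<in> J \<Longrightarrow> f \<in> Poly_Mapping.keys c \<Longrightarrow> g i contour_integrable_on simplex_path f"
  shows "chain_integral c (\<lambda>t. \<Sum>i\<in>J. g i t) = (\<Sum>i\<in>J. chain_integral c (g i))"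
  unfolding chain_integral_chain_sum chain_sum_linear(5)[symmetric]
  by (intro chain_sum_cong contour_integral_sum) (use assms in auto)

lemma chain_integral_lmul:
  assumes "\<And>f. f \<in> Poly_Mapping.keys c \<Longrightarrow> g contour_integrable_on simplex_path f"
  shows "chain_integral c (\<lambda>t. a * g t) = a * chain_integral c g"
  unfolding chain_integral_chain_sum chain_sum_linear(3)[symmetric]
  by (intro chain_sum_cong contour_integral_lmul) (use assms in auto)

lemma chain_integral_diff:
  assumes "\<And>f. f \<in> Poly_Mapping.keys c \<Longrightarrow> g contour_integrable_on simplex_path f"
    "\<And>f. f \<in> Poly_Mapping.keys c \<Longrightarrow> g' contour_integrable_on simplex_path f"
  shows "chain_integral c (\<lambda>t. g t - g' t) = chain_integral c g - chain_integral c g'"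
  unfolding chain_integral_chain_sum chain_sum_linear(2)[symmetric]
  by (intro chain_sum_cong contour_integral_diff) (use assms in auto)

lemma chain_integral_derivative_cycle:
  assumes c: "smooth_chain c" "chain_boundary (Suc 0) c = 0"
    and S: "\<And>f. f \<in> Poly_Mapping.keys c \<Longrightarrow> path_image (simplex_path f) \<subseteq> S"
    and G: "\<And>t. t \<in> S \<Longrightarrow> (G has_field_derivative g t) (at t)"
  shows "chain_integral c g = 0"
proof -
  have "chain_integral c g = chain_sum c (\<lambda>f. G (simplex_path f 1) - G (simplex_path f 0))"
    unfolding chain_integral_chain_sum
  proof (rule chain_sum_cong)
    fix f assume f: "f \<in> Poly_Mapping.keys c"
    have "(g has_contour_integral (G (pathfinish (simplex_path f)) - G (pathstart (simplex_path f)))) (simplex_path f)"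
      by (rule contour_integral_primitive[OF has_field_derivative_at_within[OF G] smooth_chainD[OF c(1) f] S[OF f]])
    then show "contour_integral (simplex_path f) g = G (simplex_path f 1) - G (simplex_path f 0)"
      by (simp add: contour_integral_unique pathstart_def pathfinish_def)
  qed
  then show ?thesis using chain_sum_ends_cycle[OF c(2), of G] by simp
qed

section \<open>Integrals over cycles and the solutions for positive parameter\<close>

lemma configD:
  fixes z :: "complex ^ 'n::finite"
  shows "z \<in> config \<Longrightarrow> i \<noteq> j \<Longrightarrow> z $ i \<noteq> z $ j"
  by (simp add: config_def)

lemma contour_integral_linepath_integral:
  "contour_integral (linepath u v) g = integral {0..1} (\<lambda>x. g (linepath u v x) * (v - u))"
  unfolding contour_integral_integral by simp

lemma segment_integral_derivative:
  fixes z :: "complex ^ 'n::finite"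
  assumes W: "open W" "z \<in> W" and reg: "\<And>y t. y \<in> W \<Longrightarrow> t \<in> closed_segment u v \<Longrightarrow> regular_at e y t"
  shows "((\<lambda>z. contour_integral (linepath u v) (root_prod e z)) has_derivative
     (\<lambda>h. \<Sum>j\<in>UNIV. h $ j * contour_integral (linepath u v) (\<lambda>t. - root_dprod j e z t))) (at z)"
  unfolding contour_integral_linepath_integral
proof (rule has_derivative_integral_param[OF W])
  have seg: "linepath u v x \<in> closed_segment u v" if "x \<in> {0..1}" for x
    using that by (simp add: linepath_in_path)
  fix y x assume y: "y \<in> W" and x: "x \<in> {0..1::real}"
  show "((\<lambda>z. root_prod e z (linepath u v x) * (v - u)) has_derivative
        (\<lambda>h. \<Sum>i\<in>UNIV. h $ i * (- root_dprod i e y (linepath u v x) * (v - u)))) (at y)"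
    by (rule has_derivative_eq_rhs[OF has_derivative_mult_left[OF root_prod_derivative_param[OF reg[OF y seg[OF x]]]]])
      (simp add: fun_eq_iff sum_distrib_right mult.assoc)
next
  fix i
  show "continuous_on (W \<times> {0..1}) (\<lambda>x. - root_dprod i e (fst x) (linepath u v (snd x)) * (v - u))"
  proof -
    have "continuous_on (W \<times> {0..1}) (\<lambda>x. linepath u v (snd x))"
      unfolding linepath_def by (intro continuous_intros)
    then show ?thesis
      by (intro continuous_intros continuous_on_root_prod) (auto intro!: reg linepath_in_path)
  qed
next
  fix y assume "y \<in> W"
  then show "continuous_on {0..1} (\<lambda>x. root_prod e y (linepath u v x) * (v - u))"
    by (intro continuous_intros continuous_on_root_prod) (auto intro!: reg linepath_in_path)
qed

lemma segment_chain_integral_derivative: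
  fixes z :: "complex ^ 'n::finite"
  assumes c: "segment_chain c" and W: "open W" "z \<in> W"
    and reg: "\<And>y t f. y \<in> W \<Longrightarrow> f \<in> Poly_Mapping.keys c \<Longrightarrow> t \<in> path_image (simplex_path f) \<Longrightarrow> regular_at e y t"
  shows "((\<lambda>z. chain_integral c (root_prod e z)) has_derivative
     (\<lambda>h. \<Sum>j\<in>UNIV. h $ j * chain_integral c (\<lambda>t. - root_dprod j e z t))) (at z)"
proof -
  have "((\<lambda>z. contour_integral (simplex_path f) (root_prod e z)) has_derivative
     (\<lambda>h. \<Sum>j\<in>UNIV. h $ j * contour_integral (simplex_path f) (\<lambda>t. - root_dprod j e z t))) (at z)"
    if f: "f \<in> Poly_Mapping.keys c" for f
  proof -
    obtain u v where uv: "f = segment_simplex u v" using c f by (auto simp: segment_chain_def)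
    have "path_image (simplex_path f) = closed_segment u v"
      using simplex_image_eq_path_image[of f] segment_simplex_image[of u v] by (simp add: uv)
    then show ?thesis
      using segment_integral_derivative[OF W, of u v e] reg[OF _ f]
      by (simp add: uv contour_integral_segment_simplex)
  qed
  then have "((\<lambda>z. chain_integral c (root_prod e z)) has_derivative
     (\<lambda>h. \<Sum>f\<in>Poly_Mapping.keys c. of_int (Poly_Mapping.lookup c f) *
        (\<Sum>j\<in>UNIV. h $ j * contour_integral (simplex_path f) (\<lambda>t. - root_dprod j e z t)))) (at z)"
    unfolding chain_integral_def by (intro has_derivative_sum has_derivative_mult_right) auto
  then show ?thesis
  proof (rule has_derivative_eq_rhs)
    have "(\<Sum>f\<in>Poly_Mapping.keys c. of_int (Poly_Mapping.lookup c f) *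
        (\<Sum>j\<in>UNIV. h $ j * contour_integral (simplex_path f) (\<lambda>t. - root_dprod j e z t))) =
      (\<Sum>j\<in>UNIV. h $ j * chain_integral c (\<lambda>t. - root_dprod j e z t))" for h
      unfolding chain_integral_def sum_distrib_left
      by (subst sum.swap) (simp add: algebra_simps)
    then show "(\<lambda>h. \<Sum>f\<in>Poly_Mapping.keys c. of_int (Poly_Mapping.lookup c f) *
        (\<Sum>j\<in>UNIV. h $ j * contour_integral (simplex_path f) (\<lambda>t. - root_dprod j e z t))) =
      (\<lambda>h. \<Sum>j\<in>UNIV. h $ j * chain_integral c (\<lambda>t. - root_dprod j e z t))" by (rule ext)
  qed
qed

lemma regular_off_marked:
  fixes z :: "complex ^ 'n::finite"
  shows "t \<notin> marked z \<Longrightarrow> regular_at e z t"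
  by (auto simp: regular_at_def marked_def)

lemma root_prod_off_marked:
  fixes z :: "complex ^ 'n::finite"
  assumes "t \<notin> marked z"
  shows "(\<Prod>i\<in>UNIV. (t - z $ i) powi (- k)) * (1 / (t - z $ b)) = root_prod (expo k b) z t"
proof -
  have "t - z $ b \<noteq> 0" using assms by (auto simp: marked_def)
  then have "(t - z $ b) powi (- k) * (1 / (t - z $ b)) = (t - z $ b) powi (- k - 1)"
    by (simp add: power_int_diff)
  moreover have "(\<Prod>l\<in>UNIV - {b}. (t - z $ l) powi expo k b l) = (\<Prod>l\<in>UNIV - {b}. (t - z $ l) powi (- k))"
    by (intro prod.cong) (auto simp: expo_def)
  moreover have "(\<Prod>i\<in>UNIV. (t - z $ i) powi (- k)) * (1 / (t - z $ b)) =
      ((t - z $ b) powi (- k) * (1 / (t - z $ b))) * (\<Prod>l\<in>UNIV - {b}. (t - z $ l) powi (- k))"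
    by (simp add: prod.remove[of UNIV b])
  moreover have "root_prod (expo k b) z t =
      (t - z $ b) powi (- k - 1) * (\<Prod>l\<in>UNIV - {b}. (t - z $ l) powi expo k b l)"
    by (simp add: root_prod_def prod.remove[of UNIV b] expo_def)
  ultimately show ?thesis by (simp only:)
qed

lemma root_functions_integrable:
  fixes z :: "complex ^ 'n::finite"
  assumes "segment_chain c" "\<And>t. t \<in> path_image (simplex_path f) \<Longrightarrow> regular_at e z t" "f \<in> Poly_Mapping.keys c"
  shows "root_prod e z contour_integrable_on simplex_path f"
    "root_dprod j e z contour_integrable_on simplex_path f"
proof -
  obtain u v where uv: "f = segment_simplex u v" using assms by (auto simp: segment_chain_def)
  have img: "path_image (simplex_path f) = closed_segment u v"
    using simplex_image_eq_path_image[of f] segment_simplex_image[of u v] by (simp add: uv)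
  have "continuous_on (closed_segment u v) (root_prod e z)" "continuous_on (closed_segment u v) (root_dprod j e z)"
    using continuous_on_root_prod[of "closed_segment u v" "\<lambda>_. z" "\<lambda>t. t" e] assms(2) by (auto simp: img)
  then have "root_prod e z contour_integrable_on linepath u v" "root_dprod j e z contour_integrable_on linepath u v"
    by (auto intro: contour_integrable_continuous_linepath)
  moreover have "g contour_integrable_on simplex_path f \<longleftrightarrow> g contour_integrable_on linepath u v" for g
    unfolding contour_integrable_on_def uv
    using has_contour_integral_path_cong[of "simplex_path (segment_simplex u v)" "linepath u v" g,
        OF simplex_path_segment] by simp
  ultimately show "root_prod e z contour_integrable_on simplex_path f"
    "root_dprod j e z contour_integrable_on simplex_path f" by auto
qed

text \<open>
  The sum of the \<open>root_dprod j\<close> is a \<open>t\<close>-derivative, so its integral over a cycle is zero. For the exponents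
  \<open>expo k b\<close> this is translation invariance, and for constant exponents it is the vanishing of the sum of
  the components.
\<close>

lemma cycle_integrals_relations:
  fixes z :: "complex ^ 'n::finite"
  assumes c: "segment_chain c" "chain_boundary (Suc 0) c = 0" and z: "z \<in> config" and k: "k \<noteq> 0"
    and avoids: "\<forall>f\<in>Poly_Mapping.keys c. path_image (simplex_path f) \<subseteq> - marked z"
  shows "j \<noteq> b \<Longrightarrow> chain_integral c (\<lambda>t. - root_dprod j (expo k b) z t) =
      of_int k * (chain_integral c (root_prod (expo k j) z) - chain_integral c (root_prod (expo k b) z)) / (z $ j - z $ b)"
    and "(\<Sum>j\<in>UNIV. chain_integral c (\<lambda>t. - root_dprod j (expo k b) z t)) = 0"
    and "(\<Sum>b\<in>UNIV. chain_integral c (root_prod (expo k b) z)) = 0"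
proof -
  note sm = segment_chain_smooth[OF c(1)]
  have avoid: "path_image (simplex_path f) \<subseteq> - marked z" if "f \<in> Poly_Mapping.keys c" for f
    using avoids that by blast
  have reg: "regular_at e z t" if "f \<in> Poly_Mapping.keys c" "t \<in> path_image (simplex_path f)" for e f t
    using avoid[OF that(1)] that(2) by (intro regular_off_marked) auto
  have int: "root_prod e z contour_integrable_on simplex_path f" "root_dprod j e z contour_integrable_on simplex_path f"
    if "f \<in> Poly_Mapping.keys c" for e f j
    using root_functions_integrable[OF c(1) reg[OF that] that] by auto
  have neg: "chain_integral c (\<lambda>t. - root_dprod j e z t) = - chain_integral c (root_dprod j e z)" for j e
    using chain_integral_lmul[of c "root_dprod j e z" "-1"] int by simp
  have zero: "(\<Sum>j\<in>UNIV. chain_integral c (root_dprod j e z)) = 0" for e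
  proof -
    have "(\<Sum>j\<in>UNIV. chain_integral c (root_dprod j e z)) = chain_integral c (\<lambda>t. \<Sum>j\<in>UNIV. root_dprod j e z t)"
      by (rule chain_integral_sum[symmetric]) (use int in auto)
    also have "\<dots> = 0"
      by (rule chain_integral_derivative_cycle[OF sm c(2) avoid, of "root_prod e z"])
        (auto intro!: root_prod_derivative_var regular_off_marked)
    finally show ?thesis .
  qed
  show "chain_integral c (\<lambda>t. - root_dprod j (expo k b) z t) =
      of_int k * (chain_integral c (root_prod (expo k j) z) - chain_integral c (root_prod (expo k b) z)) / (z $ j - z $ b)"
    if "j \<noteq> b"
  proof -
    have "- root_dprod j (expo k b) z t =
        of_int k / (z $ j - z $ b) * (root_prod (expo k j) z t - root_prod (expo k b) z t)" for t
      using root_dprod_exchange[OF that configD[OF z that] k, of t] by simp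
    then have "chain_integral c (\<lambda>t. - root_dprod j (expo k b) z t) =
        chain_integral c (\<lambda>t. of_int k / (z $ j - z $ b) * (root_prod (expo k j) z t - root_prod (expo k b) z t))"
      by simp
    also have "\<dots> = of_int k / (z $ j - z $ b) * (chain_integral c (root_prod (expo k j) z) - chain_integral c (root_prod (expo k b) z))"
      using int by (subst chain_integral_lmul) (auto simp: chain_integral_diff contour_integrable_diff)
    finally show ?thesis by simp
  qed
  show "(\<Sum>j\<in>UNIV. chain_integral c (\<lambda>t. - root_dprod j (expo k b) z t)) = 0"
    using zero[of "expo k b"] by (simp add: neg sum_negf)
  have "root_dprod b (\<lambda>_. - k) z = (\<lambda>t. - of_int k * root_prod (expo k b) z t)" for b
    by (simp add: fun_eq_iff root_dprod_const)
  then have "chain_integral c (root_dprod b (\<lambda>_. - k) z) = - of_int k * chain_integral c (root_prod (expo k b) z)" for b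
    using chain_integral_lmul[of c "root_prod (expo k b) z" "- of_int k"] int by simp
  then show "(\<Sum>b\<in>UNIV. chain_integral c (root_prod (expo k b) z)) = 0"
    using zero[of "\<lambda>_. - k"] k by (simp add: sum_negf flip: sum_distrib_left)
qed

lemma root_prod_holomorphic:
  fixes z :: "complex ^ 'n::finite"
  shows "root_prod e z holomorphic_on - marked z"
  by (rule holomorphic_onI, rule field_differentiable_at_within)
    (auto simp: field_differentiable_def intro!: exI root_prod_derivative_var regular_off_marked)

lemma psi_eq_segment_integral:
  fixes z :: "complex ^ 'n::{finite,linorder}"
  assumes \<sigma>: "\<sigma> \<in> carrier (homology_group 1 (punctured_plane z))"
    and c: "c \<in> \<sigma>" "smooth_chain c"
  shows "psi m z \<sigma> = (\<chi> b. disc (int m) z *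
    (1 / (2 * of_real pi * \<i>) * chain_integral c (root_prod (expo (int m) b) z)))"
proof -
  let ?g = "\<lambda>b t. (\<Prod>i\<in>UNIV. (t - z $ i) powi (- int m)) * (1 / (t - z $ b))"
  have rc: "singular_chain (Suc 0) (punctured_plane z) c"
    using homology_class_relcycle[OF \<sigma> c(1)] by (simp add: singular_relcycle_def)
  have "homology_integral \<sigma> (?g b) = chain_integral c (root_prod (expo (int m) b) z)" for b
  proof -
    have "?g b holomorphic_on - marked z"
      by (rule holomorphic_transform[OF root_prod_holomorphic[of "expo (int m) b"]])
        (rule root_prod_off_marked[symmetric], simp)
    then have "homology_integral \<sigma> (?g b) = chain_integral c (?g b)"
      by (rule homology_integral_cycle[OF \<sigma> c])
    also have "\<dots> = chain_integral c (root_prod (expo (int m) b) z)"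
    proof (rule chain_integral_cong)
      fix f t assume "f \<in> Poly_Mapping.keys c" "t \<in> path_image (simplex_path f)"
      then have "t \<notin> marked z"
        using simplex_path_image_in_space[of "- marked z" c f] rc by (auto simp: punctured_plane_def)
      then show "?g b t = root_prod (expo (int m) b) z t" by (rule root_prod_off_marked)
    qed
    finally show ?thesis .
  qed
  then show ?thesis by (simp add: psi_def disc_def vec_eq_iff mult.assoc)
qed

theorem psi_KZ:
  fixes \<sigma> :: "complex ^ 'n::{finite,linorder} \<Rightarrow> complex chain set"
  assumes m: "m > 0" and U: "U \<subseteq> config" and \<sigma>: "horizontal_cycle U \<sigma>"
  shows "(\<lambda>z. psi m z (\<sigma> z)) \<in> KZ U (int m)"
  unfolding KZ_def mem_Collect_eq
proof (intro ballI conjI)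
  fix z assume z: "z \<in> U"
  have car: "\<sigma> y \<in> carrier (homology_group 1 (punctured_plane y))" if "y \<in> U" for y
    using \<sigma> that by (auto simp: horizontal_cycle_def)
  obtain c where c: "c \<in> \<sigma> z" "segment_chain c"
    using exists_segment_cycle[OF car[OF z, unfolded punctured_plane_def] marked_finite_open(2)] .
  note sm = segment_chain_smooth[OF c(2)]
  obtain W where W: "open W" "z \<in> W" "W \<subseteq> U" "\<And>y. y \<in> W \<Longrightarrow> c \<in> \<sigma> y"
  proof (rule horizontal_cycle_locally_constant[OF \<sigma> z c(1)])
    fix W assume "open W" "z \<in> W" "W \<subseteq> U" "\<And>y. y \<in> W \<Longrightarrow> c \<in> \<sigma> y"
    then show ?thesis by (rule that)
  qed
  have rc: "singular_chain (Suc 0) (punctured_plane y) c \<and> chain_boundary (Suc 0) c = 0" if "y \<in> W" for y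
    using homology_class_relcycle[OF car W(4)[OF that]] W(3) that singular_relcycle_empty[of "- marked y" c]
    by (auto simp: punctured_plane_def)
  have avoid: "path_image (simplex_path f) \<subseteq> - marked y" if "y \<in> W" "f \<in> Poly_Mapping.keys c" for y f
    using simplex_path_image_in_space[of "- marked y" c f] rc[OF that(1)] that(2) by (simp add: punctured_plane_def)
  have zc: "z \<in> config" using U z by auto
  have m0: "int m \<noteq> 0" using m by simp
  have cb: "chain_boundary (Suc 0) c = 0" using rc[OF W(2)] by simp
  have "\<forall>f\<in>Poly_Mapping.keys c. path_image (simplex_path f) \<subseteq> - marked z"
    using avoid[OF W(2)] by blast
  note rel = cycle_integrals_relations[OF c(2) cb zc m0 this]
  let ?k = "1 / (2 * of_real pi * \<i>)"
  let ?I = "\<lambda>z b. ?k * chain_integral c (root_prod (expo (int m) b) z)"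
  have psi: "psi m y (\<sigma> y) = (\<chi> b. disc (int m) y * ?I y b)" if "y \<in> W" for y
    using psi_eq_segment_integral[OF car W(4)[OF that] sm] W(3) that by auto
  show "psi m z (\<sigma> z) \<in> refl_rep"
    unfolding psi[OF W(2)] refl_rep_def using rel(3) by (simp flip: sum_distrib_left sum_divide_distrib)
  show "\<exists>D. ((\<lambda>z. psi m z (\<sigma> z)) has_derivative D) (at z) \<and> (\<forall>a v. D (a *s v) = a *s D v) \<and>
        (\<forall>i. D (axis i 1) = of_int (int m) *s
           (\<Sum>j\<in>UNIV - {i}. (1 / (z $ i - z $ j)) *s
             (perm_act (Transposition.transpose i j) (psi m z (\<sigma> z)) + psi m z (\<sigma> z))))"
  proof (rule KZ_equation_at[OF zc _ _ _ W(1,2) psi])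
    fix b
    have "((\<lambda>z. chain_integral c (root_prod (expo (int m) b) z)) has_derivative
     (\<lambda>h. \<Sum>j\<in>UNIV. h $ j * chain_integral c (\<lambda>t. - root_dprod j (expo (int m) b) z t))) (at z)"
    proof (rule segment_chain_integral_derivative[OF c(2) W(1,2)])
      fix y t f assume "y \<in> W" "f \<in> Poly_Mapping.keys c" "t \<in> path_image (simplex_path f)"
      then show "regular_at (expo (int m) b) y t" using avoid by (intro regular_off_marked) auto
    qed
    from has_derivative_mult_right[OF this, of ?k]
    show "((\<lambda>z. ?I z b) has_derivative
      (\<lambda>h. \<Sum>j\<in>UNIV. h $ j * (?k * chain_integral c (\<lambda>t. - root_dprod j (expo (int m) b) z t)))) (at z)"
      by (simp add: sum_distrib_left mult.left_commute)
    show "(\<Sum>j\<in>UNIV. ?k * chain_integral c (\<lambda>t. - root_dprod j (expo (int m) b) z t)) = 0"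
      using rel(2)[of b] by (simp flip: sum_distrib_left sum_divide_distrib)
  next
    fix j b :: 'n assume "j \<noteq> b"
    show "?k * chain_integral c (\<lambda>t. - root_dprod j (expo (int m) b) z t) =
        of_int (int m) * (?I z j - ?I z b) / (z $ j - z $ b)"
      unfolding rel(1)[OF \<open>j \<noteq> b\<close>] by (simp add: diff_divide_distrib algebra_simps)
  qed
qed

section \<open>Integrals along rays and the solutions for negative parameter\<close>

lemma regular_expo_nonneg:
  fixes z :: "complex ^ 'n::finite"
  shows "m > 0 \<Longrightarrow> regular_at (expo (- int m) b) z t" "regular_at (\<lambda>_. int m) z t"
  by (auto simp: regular_at_def expo_def)

text \<open>
  The integral of \<open>root_prod e z\<close> along the segment from \<open>0\<close> to \<open>z\<^sub>i\<close>. The choice of \<open>0\<close> does not matter, because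
  the multiplicities of a relative cycle add up to zero.
\<close>

definition ray_integral :: "('n \<Rightarrow> int) \<Rightarrow> complex ^ 'n::finite \<Rightarrow> 'n \<Rightarrow> complex" where
  "ray_integral e z i = integral {0..1} (\<lambda>u. z $ i * root_prod e z (of_real u * z $ i))"

lemma integral_ray_derivative:
  fixes f :: "complex \<Rightarrow> complex"
  assumes "\<And>x. (f has_field_derivative f' x) (at x)"
  shows "integral {0..1} (\<lambda>u. x * f' (of_real u * x)) = f x - f 0"
proof -
  have "(f' has_contour_integral (f (pathfinish (linepath 0 x)) - f (pathstart (linepath 0 x)))) (linepath 0 x)"
    by (rule contour_integral_primitive[where S = UNIV, OF assms valid_path_linepath subset_UNIV])
  then have "contour_integral (linepath 0 x) f' = f x - f 0" by (simp add: contour_integral_unique)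
  then show ?thesis
    unfolding contour_integral_linepath_integral by (simp add: linepath_def scaleR_conv_of_real mult.commute)
qed

lemma root_prod_primitive:
  fixes z :: "complex ^ 'n::finite"
  assumes "\<And>t. regular_at e z t"
  obtains Q where "\<And>x. (Q has_field_derivative root_prod e z x) (at x)"
proof -
  have "root_prod e z holomorphic_on UNIV"
    by (rule holomorphic_onI) (auto simp: field_differentiable_def intro!: exI root_prod_derivative_var assms)
  then show ?thesis
    by (rule holomorphic_convex_primitive'[OF convex_UNIV open_UNIV]) (rule that, simp)
qed

lemma root_prod_primitives:
  fixes z :: "complex ^ 'n::finite"
  assumes "m > 0"
  shows "\<exists>Q. \<forall>b x. (Q b has_field_derivative root_prod (expo (- int m) b) z x) (at x)"
proof -
  have "\<exists>Q. \<forall>x. (Q has_field_derivative root_prod (expo (- int m) b) z x) (at x)" for b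
    by (rule root_prod_primitive[OF regular_expo_nonneg(1)[OF assms]]) blast
  then show ?thesis by (rule choice[OF allI])
qed

text \<open>
  The integrand in the definition of \<open>phi\<close> and the polynomial \<open>root_prod (expo (- int m) b) z\<close> may differ at
  marked points, where the former involves a division by zero.
\<close>

lemma phi_eq_primitive:
  fixes z :: "complex ^ 'n::{finite,linorder}"
  assumes z: "z \<in> config" and m: "m > 0"
    and \<tau>: "\<tau> \<in> carrier (relative_homology_group 1 euclidean (marked z))" and d: "d \<in> \<tau>"
    and Q: "\<And>b x. (Q b has_field_derivative root_prod (expo (- int m) b) z x) (at x)"
  shows "phi m z \<tau> = (\<chi> b. disc (- int m) z * (\<Sum>i\<in>UNIV. end_coeff d (z $ i) * Q b (z $ i)))"
proof -
  have "homology_integral \<tau> (\<lambda>t. (\<Prod>i\<in>UNIV. (t - z $ i) powi (int m)) * (1 / (t - z $ b))) =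
      (\<Sum>i\<in>UNIV. end_coeff d (z $ i) * Q b (z $ i))" for b
  proof (rule homology_integral_relcycle[OF z \<tau> d Q marked_finite_open(1)[of z]])
    fix t assume "t \<notin> marked z"
    then show "(\<Prod>i\<in>UNIV. (t - z $ i) powi (int m)) * (1 / (t - z $ b)) = root_prod (expo (- int m) b) z t"
      using root_prod_off_marked[of t z "- int m" b] by simp
  qed
  then show ?thesis by (simp add: phi_def disc_def vec_eq_iff)
qed

lemma phi_eq_ray_integral:
  fixes z :: "complex ^ 'n::{finite,linorder}"
  assumes z: "z \<in> config" and m: "m > 0"
    and \<tau>: "\<tau> \<in> carrier (relative_homology_group 1 euclidean (marked z))" and d: "d \<in> \<tau>"
  shows "phi m z \<tau> = (\<chi> b. disc (- int m) z * (\<Sum>i\<in>UNIV. end_coeff d (z $ i) * ray_integral (expo (- int m) b) z i))"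
proof -
  obtain Q where Q: "\<And>b x. (Q b has_field_derivative root_prod (expo (- int m) b) z x) (at x)"
    using root_prod_primitives[OF m] by metis
  have "(\<Sum>i\<in>UNIV. end_coeff d (z $ i) * Q b (z $ i)) =
      (\<Sum>i\<in>UNIV. end_coeff d (z $ i) * ray_integral (expo (- int m) b) z i)" for b
  proof -
    have "(\<Sum>i\<in>UNIV. end_coeff d (z $ i) * ray_integral (expo (- int m) b) z i) =
        (\<Sum>i\<in>UNIV. end_coeff d (z $ i) * Q b (z $ i)) - (\<Sum>i\<in>UNIV. end_coeff d (z $ i)) * Q b 0"
      unfolding ray_integral_def integral_ray_derivative[OF Q]
      by (simp add: right_diff_distrib sum_subtractf sum_distrib_right)
    then show ?thesis by (simp add: sum_end_coeff[OF z homology_class_relcycle[OF \<tau> d]])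
  qed
  then show ?thesis using phi_eq_primitive[OF z m \<tau> d Q] by simp
qed

lemma continuous_on_ray:
  fixes z :: "complex ^ 'n::finite"
  assumes "\<And>y t. regular_at e (y :: complex ^ 'n::finite) t"
  shows "continuous_on S (\<lambda>x. root_prod e (fst x) (of_real (snd x) * fst x $ i))"
    "continuous_on S (\<lambda>x. root_dprod j e (fst x) (of_real (snd x) * fst x $ i))"
    "continuous_on S' (\<lambda>u. root_prod e z (of_real u * x))"
    "continuous_on S' (\<lambda>u. root_dprod j e z (of_real u * x))"
  by (intro continuous_on_root_prod continuous_intros assms)+

text \<open>
  Moving the end point of the ray contributes the value of the integrand there. In the parametrization
  \<open>t = u z\<^sub>i\<close> this value appears as the integral of the derivative of \<open>u * root_prod e z (u z\<^sub>i)\<close>.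
\<close>

lemma ray_integral_derivative:
  fixes z :: "complex ^ 'n::finite"
  assumes reg: "\<And>y t. regular_at e (y :: complex ^ 'n::finite) t"
  shows "((\<lambda>z. ray_integral e z i) has_derivative
    (\<lambda>h. \<Sum>j\<in>UNIV. h $ j * ((if j = i then root_prod e z (z $ i) else 0) -
        integral {0..1} (\<lambda>u. z $ i * root_dprod j e z (of_real u * z $ i))))) (at z)"
proof -
  define g where "g j z u = (if j = i then root_prod e z (of_real u * z $ i) +
      z $ i * (of_real u * (\<Sum>l\<in>UNIV. root_dprod l e z (of_real u * z $ i))) else 0) -
      z $ i * root_dprod j e z (of_real u * z $ i)" for j and z :: "complex ^ 'n::finite" and u
  have "((\<lambda>z. integral {0..1} (\<lambda>u. z $ i * root_prod e z (of_real u * z $ i))) has_derivative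
     (\<lambda>h. \<Sum>j\<in>UNIV. h $ j * integral {0..1} (g j z))) (at z)"
  proof (rule has_derivative_integral_param[of UNIV])
    fix y :: "complex ^ 'n::finite" and u :: real
    let ?t = "of_real u * y $ i"
    have ci: "((\<lambda>z. z $ i) has_derivative (\<lambda>h. h $ i)) (at y)"
      by (rule bounded_linear_imp_has_derivative) (rule bounded_linear_vec_nth)
    have "((\<lambda>z. (z, of_real u * z $ i)) has_derivative (\<lambda>h. (h, of_real u * h $ i))) (at y)"
      by (intro has_derivative_Pair has_derivative_ident has_derivative_mult_right ci)
    from has_derivative_compose[OF this has_derivative_root_prod[OF reg]]
    have 1: "((\<lambda>z. root_prod e z (of_real u * z $ i)) has_derivative
        (\<lambda>h. \<Sum>j\<in>UNIV. (of_real u * h $ i - h $ j) * root_dprod j e y ?t)) (at y)" by simp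
    show "((\<lambda>z. z $ i * root_prod e z (of_real u * z $ i)) has_derivative
        (\<lambda>h. \<Sum>j\<in>UNIV. h $ j * g j y u)) (at y)"
    proof (rule has_derivative_eq_rhs[OF has_derivative_mult[OF ci 1]], rule ext)
      fix h :: "complex ^ 'n::finite"
      have "(\<Sum>j\<in>UNIV. h $ j * g j y u) =
          (\<Sum>j\<in>UNIV. if j = i then h $ i * (root_prod e y ?t + y $ i * (of_real u * (\<Sum>l\<in>UNIV. root_dprod l e y ?t))) else 0)
          - (\<Sum>j\<in>UNIV. h $ j * (y $ i * root_dprod j e y ?t))"
        unfolding sum_subtractf[symmetric] by (intro sum.cong) (auto simp: g_def algebra_simps)
      also have "\<dots> = h $ i * (root_prod e y ?t + y $ i * (of_real u * (\<Sum>l\<in>UNIV. root_dprod l e y ?t)))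
          - (\<Sum>j\<in>UNIV. h $ j * (y $ i * root_dprod j e y ?t))" by simp
      finally show "y $ i * (\<Sum>j\<in>UNIV. (of_real u * h $ i - h $ j) * root_dprod j e y ?t) + h $ i * root_prod e y ?t =
          (\<Sum>j\<in>UNIV. h $ j * g j y u)"
        by (simp add: sum_distrib_left algebra_simps sum_subtractf)
    qed
  next
    fix j
    show "continuous_on (UNIV \<times> {0..1}) (\<lambda>x. g j (fst x) (snd x))"
      unfolding g_def by (cases "j = i") (auto intro!: continuous_intros continuous_on_ray reg)
  next
    fix y :: "complex ^ 'n::finite"
    show "continuous_on {0..1} (\<lambda>u. y $ i * root_prod e y (of_real u * y $ i))"
      by (intro continuous_intros continuous_on_ray reg)
  qed auto
  moreover have "integral {0..1} (g j z) = (if j = i then root_prod e z (z $ i) else 0) -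
        integral {0..1} (\<lambda>u. z $ i * root_dprod j e z (of_real u * z $ i))" for j
  proof -
    let ?A = "\<lambda>u. root_prod e z (of_real u * z $ i) +
      z $ i * (of_real u * (\<Sum>l\<in>UNIV. root_dprod l e z (of_real u * z $ i)))"
    have cA: "continuous_on {0..1} ?A" by (intro continuous_intros continuous_on_ray reg)
    have "(?A has_integral (of_real 1 * root_prod e z (of_real 1 * z $ i) - of_real 0 * root_prod e z (of_real 0 * z $ i))) {0..1}"
    proof (rule fundamental_theorem_of_calculus)
      fix u :: real
      have "((\<lambda>x. x * root_prod e z (x * z $ i)) has_field_derivative
          (root_prod e z (of_real u * z $ i) + (\<Sum>l\<in>UNIV. root_dprod l e z (of_real u * z $ i)) * z $ i * of_real u)) (at (of_real u))"
      proof -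
        have "((\<lambda>x. x * z $ i) has_field_derivative z $ i) (at (of_real u))"
          by (auto intro!: derivative_eq_intros)
        from DERIV_mult[OF DERIV_ident DERIV_chain2[OF root_prod_derivative_var[OF reg] this]]
        show ?thesis by (simp add: algebra_simps)
      qed
      from has_vector_derivative_real_field[OF this]
      show "((\<lambda>u. of_real u * root_prod e z (of_real u * z $ i)) has_vector_derivative ?A u) (at u within {0..1})"
        by (simp add: algebra_simps)
    qed simp
    then have A: "integral {0..1} ?A = root_prod e z (z $ i)" by (simp add: integral_unique)
    have D: "continuous_on {0..1} (\<lambda>u. z $ i * root_dprod j e z (of_real u * z $ i))"
      by (intro continuous_intros continuous_on_ray reg)
    show ?thesis
    proof (cases "j = i")
      case True
      then show ?thesis
        unfolding g_def using A integral_diff[OF integrable_continuous_interval[OF cA] integrable_continuous_interval[OF D]]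
        by simp
    next
      case False
      then show ?thesis unfolding g_def by simp
    qed
  qed
  ultimately show ?thesis unfolding ray_integral_def by simp
qed

text \<open>
  For \<open>j \<noteq> b\<close> the contribution of the moving end point vanishes, since the integrand has a zero of order \<open>m\<close> at
  \<open>z\<^sub>j\<close>. For \<open>m = 1\<close> and \<open>j = b\<close> it does not vanish; in the sum over \<open>j\<close> it cancels the value at the upper end of
  the integral of the \<open>t\<close>-derivative. The values at the lower end \<open>0\<close> cancel because the multiplicities add
  up to zero.
\<close>

lemma ray_integrals_relations:
  fixes z :: "complex ^ 'n::finite"
  assumes z: "z \<in> config" and m: "m > 0" and a: "(\<Sum>i\<in>UNIV. a i) = (0::complex)"
  defines "L \<equiv> \<lambda>j b. \<Sum>i\<in>UNIV. a i * ((if j = i then root_prod (expo (- int m) b) z (z $ i) else 0) -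
        integral {0..1} (\<lambda>u. z $ i * root_dprod j (expo (- int m) b) z (of_real u * z $ i)))"
  defines "I \<equiv> \<lambda>b. \<Sum>i\<in>UNIV. a i * ray_integral (expo (- int m) b) z i"
  shows "j \<noteq> b \<Longrightarrow> L j b = of_int (- int m) * (I j - I b) / (z $ j - z $ b)"
    and "(\<Sum>j\<in>UNIV. L j b) = 0" and "(\<Sum>b\<in>UNIV. I b) = 0"
proof -
  let ?e = "expo (- int m) :: 'n \<Rightarrow> 'n \<Rightarrow> int"
  have reg: "regular_at (?e b) y t" for b t and y :: "complex ^ 'n::finite"
    by (rule regular_expo_nonneg(1)[OF m])
  have ir: "(\<lambda>u. x * root_prod (?e b) z (of_real u * w)) integrable_on {0..1}"
    "(\<lambda>u. x * root_dprod j (?e b) z (of_real u * w)) integrable_on {0..1}" for x w b j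
    by (intro integrable_continuous_interval continuous_intros continuous_on_ray reg)+
  have k: "- int m \<noteq> 0" using m by simp
  show "L j b = of_int (- int m) * (I j - I b) / (z $ j - z $ b)" if jb: "j \<noteq> b"
  proof -
    have v: "root_prod (?e b) z (z $ j) = 0"
      unfolding root_prod_def using jb m by (intro prod_zero) (auto simp: expo_def intro!: bexI[of _ j])
    let ?q = "of_int (- int m) / (z $ j - z $ b)"
    have D: "integral {0..1} (\<lambda>u. z $ i * root_dprod j (?e b) z (of_real u * z $ i)) =
        - ?q * (ray_integral (?e j) z i - ray_integral (?e b) z i)" for i
    proof -
      have "z $ i * root_dprod j (?e b) z t =
          - ?q * (z $ i * root_prod (?e j) z t - z $ i * root_prod (?e b) z t)" for t
        unfolding root_dprod_exchange[OF jb configD[OF z jb] k] by (simp add: algebra_simps diff_divide_distrib)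
      then show ?thesis
        unfolding ray_integral_def by (simp only: integral_mult_right integral_diff[OF ir(1) ir(1)])
    qed
    have "L j b = (\<Sum>i\<in>UNIV. ?q * (a i * ray_integral (?e j) z i - a i * ray_integral (?e b) z i))"
      unfolding L_def D by (intro sum.cong) (auto simp: v algebra_simps)
    also have "\<dots> = ?q * (I j - I b)"
      by (simp only: I_def sum_distrib_left[symmetric] sum_subtractf)
    finally show ?thesis by simp
  qed
  show "(\<Sum>j\<in>UNIV. L j b) = 0"
  proof -
    have "(\<Sum>j\<in>UNIV. L j b) = (\<Sum>i\<in>UNIV. \<Sum>j\<in>UNIV. a i * ((if j = i then root_prod (?e b) z (z $ i) else 0) -
        integral {0..1} (\<lambda>u. z $ i * root_dprod j (?e b) z (of_real u * z $ i))))"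
      unfolding L_def by (rule sum.swap)
    also have "\<dots> = (\<Sum>i\<in>UNIV. a i * root_prod (?e b) z 0)"
    proof (rule sum.cong)
      fix i
      have "(\<Sum>j\<in>UNIV. integral {0..1} (\<lambda>u. z $ i * root_dprod j (?e b) z (of_real u * z $ i))) =
          integral {0..1} (\<lambda>u. \<Sum>j\<in>UNIV. z $ i * root_dprod j (?e b) z (of_real u * z $ i))"
        by (rule integral_sum[symmetric]) (use ir in auto)
      also have "\<dots> = root_prod (?e b) z (z $ i) - root_prod (?e b) z 0"
        unfolding sum_distrib_left[symmetric]
        by (rule integral_ray_derivative) (rule root_prod_derivative_var[OF reg])
      finally show "(\<Sum>j\<in>UNIV. a i * ((if j = i then root_prod (?e b) z (z $ i) else 0) -
        integral {0..1} (\<lambda>u. z $ i * root_dprod j (?e b) z (of_real u * z $ i)))) = a i * root_prod (?e b) z 0"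
        by (simp add: sum_subtractf flip: sum_distrib_left)
    qed simp
    also have "\<dots> = 0" using a by (simp flip: sum_distrib_right)
    finally show ?thesis .
  qed
  show "(\<Sum>b\<in>UNIV. I b) = 0"
  proof -
    let ?R = "\<lambda>_::'n. int m"
    have "of_nat m * (\<Sum>b\<in>UNIV. ray_integral (?e b) z i) = - root_prod ?R z 0" for i
    proof -
      have e: "root_dprod b ?R z t = of_nat m * root_prod (?e b) z t" for b t
        using root_dprod_const[of b "- int m" z t] by simp
      have "of_nat m * (\<Sum>b\<in>UNIV. ray_integral (?e b) z i) =
          integral {0..1} (\<lambda>u. \<Sum>b\<in>UNIV. of_nat m * (z $ i * root_prod (?e b) z (of_real u * z $ i)))"
        unfolding ray_integral_def sum_distrib_left integral_mult_right[symmetric]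
        by (rule integral_sum[symmetric]) (simp, intro integrable_continuous_interval continuous_intros continuous_on_ray(3) reg)
      also have "\<dots> = integral {0..1} (\<lambda>u. z $ i * (\<Sum>b\<in>UNIV. root_dprod b ?R z (of_real u * z $ i)))"
        by (simp add: e sum_distrib_left mult.left_commute)
      also have "\<dots> = root_prod ?R z (z $ i) - root_prod ?R z 0"
        by (rule integral_ray_derivative) (rule root_prod_derivative_var[OF regular_expo_nonneg(2)])
      also have "root_prod ?R z (z $ i) = 0"
        unfolding root_prod_def using m by (intro prod_zero) (auto intro!: bexI[of _ i])
      finally show ?thesis by simp
    qed
    note ray = this
    have "(\<Sum>b\<in>UNIV. I b) = (\<Sum>i\<in>UNIV. a i * (\<Sum>b\<in>UNIV. ray_integral (?e b) z i))"
      unfolding I_def sum_distrib_left by (rule sum.swap)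
    then have "of_nat m * (\<Sum>b\<in>UNIV. I b) =
        (\<Sum>i\<in>UNIV. a i * (of_nat m * (\<Sum>b\<in>UNIV. ray_integral (?e b) z i)))"
      by (simp only: sum_distrib_left mult.left_commute[of "of_nat m"])
    also have "\<dots> = (\<Sum>i\<in>UNIV. a i) * (- root_prod ?R z 0)"
      unfolding ray by (rule sum_distrib_right[symmetric])
    finally have "of_nat m * (\<Sum>b\<in>UNIV. I b) = 0" using a by simp
    then show ?thesis using m by simp
  qed
qed

theorem phi_KZ:
  fixes \<tau> :: "complex ^ 'n::{finite,linorder} \<Rightarrow> complex chain set"
  assumes m: "m > 0" and U: "U \<subseteq> config" and \<tau>: "horizontal_relcycle U \<tau>"
  shows "(\<lambda>z. phi m z (\<tau> z)) \<in> KZ U (- int m)"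
  unfolding KZ_def mem_Collect_eq
proof (intro ballI conjI)
  fix z assume z: "z \<in> U"
  have car: "\<tau> y \<in> carrier (relative_homology_group 1 euclidean (marked y))" if "y \<in> U" for y
    using \<tau> that by (auto simp: horizontal_relcycle_def)
  obtain d where d: "d \<in> \<tau> z" using homology_class_memD[OF car[OF z]] by metis
  have zc: "z \<in> config" using U z by auto
  define a where "a i = end_coeff d (z $ i)" for i
  have a: "(\<Sum>i\<in>UNIV. a i) = 0"
    unfolding a_def by (rule sum_end_coeff[OF zc homology_class_relcycle[OF car[OF z] d]])
  obtain W where W: "open W" "z \<in> W" "W \<subseteq> U"
    "\<And>y. y \<in> W \<Longrightarrow> \<exists>d'\<in>\<tau> y. \<forall>i. end_coeff d' (y $ i) = end_coeff d (z $ i)"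
  proof (rule horizontal_relcycle_locally_constant[OF \<tau> U z d])
    fix W assume "open W" "z \<in> W" "W \<subseteq> U"
      "\<And>y. y \<in> W \<Longrightarrow> \<exists>d'\<in>\<tau> y. \<forall>i. end_coeff d' (y $ i) = end_coeff d (z $ i)"
    then show ?thesis by (rule that)
  qed
  let ?e = "expo (- int m) :: 'n \<Rightarrow> 'n \<Rightarrow> int"
  let ?I = "\<lambda>y b. \<Sum>i\<in>UNIV. a i * ray_integral (?e b) y i"
  have phi: "phi m y (\<tau> y) = (\<chi> b. disc (- int m) y * ?I y b)" if y: "y \<in> W" for y
  proof -
    obtain d' where d': "d' \<in> \<tau> y" "\<And>i. end_coeff d' (y $ i) = a i"
      using W(4)[OF y] by (auto simp: a_def)
    have "y \<in> config" "y \<in> U" using U W(3) y by auto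
    then show ?thesis using phi_eq_ray_integral[OF _ m car d'(1)] d'(2) by simp
  qed
  note rel = ray_integrals_relations[OF zc m a]
  show "phi m z (\<tau> z) \<in> refl_rep"
    unfolding phi[OF W(2)] refl_rep_def using rel(3) by (simp flip: sum_distrib_left)
  show "\<exists>D. ((\<lambda>z. phi m z (\<tau> z)) has_derivative D) (at z) \<and> (\<forall>a v. D (a *s v) = a *s D v) \<and>
        (\<forall>i. D (axis i 1) = of_int (- int m) *s
           (\<Sum>j\<in>UNIV - {i}. (1 / (z $ i - z $ j)) *s
             (perm_act (Transposition.transpose i j) (phi m z (\<tau> z)) + phi m z (\<tau> z))))"
  proof (rule KZ_equation_at[OF zc _ rel(1,2) W(1,2) phi])
    fix b
    have "((\<lambda>y. ?I y b) has_derivative (\<lambda>h. \<Sum>i\<in>UNIV. a i * (\<Sum>j\<in>UNIV. h $ j *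
        ((if j = i then root_prod (?e b) z (z $ i) else 0) -
        integral {0..1} (\<lambda>u. z $ i * root_dprod j (?e b) z (of_real u * z $ i)))))) (at z)"
      by (intro has_derivative_sum has_derivative_mult_right ray_integral_derivative regular_expo_nonneg(1)[OF m])
    then show "((\<lambda>y. ?I y b) has_derivative (\<lambda>h. \<Sum>j\<in>UNIV. h $ j * (\<Sum>i\<in>UNIV. a i *
        ((if j = i then root_prod (?e b) z (z $ i) else 0) -
        integral {0..1} (\<lambda>u. z $ i * root_dprod j (?e b) z (of_real u * z $ i)))))) (at z)"
    proof (rule has_derivative_eq_rhs)
      show "(\<lambda>h. \<Sum>i\<in>UNIV. a i * (\<Sum>j\<in>UNIV. h $ j * X j i)) = (\<lambda>h. \<Sum>j\<in>UNIV. h $ j * (\<Sum>i\<in>UNIV. a i * X j i))"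
        for X :: "'n \<Rightarrow> 'n \<Rightarrow> complex"
        unfolding sum_distrib_left by (rule ext, subst sum.swap) (simp add: algebra_simps)
    qed
  qed
qed

section \<open>Divided differences of a polynomial\<close>

text \<open>
  The quotient \<open>(r s - r t) / (s - t)\<close> as a polynomial in both variables, including the diagonal. The three
  definitions after it are its primitive with respect to \<open>s\<close>, its derivative with respect to \<open>t\<close>, and
  the derivative of the primitive with respect to \<open>t\<close>.
\<close>

definition divdiff :: "complex poly \<Rightarrow> complex \<Rightarrow> complex \<Rightarrow> complex" where
  "divdiff r s t = (\<Sum>n\<le>Polynomial.degree r. poly.coeff r n * (\<Sum>k<n. t ^ (n - Suc k) * s ^ k))"

definition divdiff_prim :: "complex poly \<Rightarrow> complex \<Rightarrow> complex \<Rightarrow> complex" where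
  "divdiff_prim r s t = (\<Sum>n\<le>Polynomial.degree r. poly.coeff r n * (\<Sum>k<n. t ^ (n - Suc k) * (s ^ Suc k / of_nat (Suc k))))"

definition divdiff_dt :: "complex poly \<Rightarrow> complex \<Rightarrow> complex \<Rightarrow> complex" where
  "divdiff_dt r s t = (\<Sum>n\<le>Polynomial.degree r. poly.coeff r n *
     (\<Sum>k<n. of_nat (n - Suc k) * t ^ (n - Suc k - 1) * s ^ k))"

definition divdiff_prim_dt :: "complex poly \<Rightarrow> complex \<Rightarrow> complex \<Rightarrow> complex" where
  "divdiff_prim_dt r s t = (\<Sum>n\<le>Polynomial.degree r. poly.coeff r n *
     (\<Sum>k<n. of_nat (n - Suc k) * t ^ (n - Suc k - 1) * (s ^ Suc k / of_nat (Suc k))))"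

lemma divdiff_mult: "(s - t) * divdiff r s t = poly r s - poly r t"
proof -
  have "(s - t) * divdiff r s t = (\<Sum>n\<le>Polynomial.degree r. poly.coeff r n * ((s - t) * (\<Sum>k<n. t ^ (n - Suc k) * s ^ k)))"
    by (simp add: divdiff_def sum_distrib_left mult.left_commute)
  also have "\<dots> = (\<Sum>n\<le>Polynomial.degree r. poly.coeff r n * (s ^ n - t ^ n))"
    by (simp add: power_diff_sumr2)
  finally show ?thesis by (simp add: poly_altdef sum_subtractf right_diff_distrib)
qed

lemma pow_derivative: "((\<lambda>t::complex. t ^ n) has_field_derivative of_nat n * t ^ (n - 1)) (at t)"
  by (auto intro!: derivative_eq_intros)

lemma power_Suc_div_derivative: "((\<lambda>s::complex. s ^ Suc k / of_nat (Suc k)) has_field_derivative s ^ k) (at s)"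
proof -
  have "((\<lambda>s::complex. s ^ Suc k / of_nat (Suc k)) has_field_derivative (of_nat (Suc k) * s ^ k) / of_nat (Suc k)) (at s)"
    using DERIV_cdivide[OF pow_derivative[of "Suc k" s], of "of_nat (Suc k)"] by simp
  moreover have "(of_nat (Suc k) * s ^ k) / of_nat (Suc k) = s ^ k"
    by (simp del: of_nat_Suc)
  ultimately show ?thesis by simp
qed

lemma divdiff_prim_derivatives:
  "((\<lambda>s. divdiff_prim r s t) has_field_derivative divdiff r s t) (at s)"
  "((\<lambda>s. divdiff_prim_dt r s t) has_field_derivative divdiff_dt r s t) (at s)"
  unfolding divdiff_prim_def divdiff_def divdiff_prim_dt_def divdiff_dt_def
  by (intro DERIV_sum DERIV_cmult power_Suc_div_derivative)+

lemma divdiff_t_derivatives: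
  "((\<lambda>t. divdiff_prim r s t) has_field_derivative divdiff_prim_dt r s t) (at t)"
  "((\<lambda>t. divdiff r s t) has_field_derivative divdiff_dt r s t) (at t)"
  unfolding divdiff_prim_def divdiff_def divdiff_prim_dt_def divdiff_dt_def
  by (intro DERIV_sum DERIV_cmult DERIV_cmult_right pow_derivative)+

lemma divdiff_s_differentiable: "(\<lambda>s. divdiff r s t) field_differentiable (at s)"
  unfolding divdiff_def by (intro derivative_intros)

text \<open>
  The operator \<open>\<partial>\<^sub>s + \<partial>\<^sub>t\<close> annihilates \<open>1 / (s - t)\<close> and so acts on the numerator only.
\<close>

lemma divdiff_total_derivative:
  assumes "((\<lambda>s. divdiff r s t) has_field_derivative Ts) (at s)" "s \<noteq> t"
  shows "Ts + divdiff_dt r s t = (poly (pderiv r) s - poly (pderiv r) t) / (s - t)"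
proof -
  have eq: "divdiff r x y = (poly r x - poly r y) / (x - y)" if "x \<noteq> y" for x y
    using divdiff_mult[of x y r] that by (simp add: field_simps)
  have "((\<lambda>s. (poly r s - poly r t) / (s - t)) has_field_derivative
      (poly (pderiv r) s * (s - t) - (poly r s - poly r t)) / ((s - t) * (s - t))) (at s)"
    using assms(2) by (auto intro!: derivative_eq_intros poly_DERIV)
  then have "((\<lambda>s. divdiff r s t) has_field_derivative
      (poly (pderiv r) s * (s - t) - (poly r s - poly r t)) / ((s - t) * (s - t))) (at s)"
    by (rule has_field_derivative_transform_within_open[of _ _ _ "- {t}"]) (use assms(2) eq in auto)
  then have 1: "Ts = (poly (pderiv r) s * (s - t) - (poly r s - poly r t)) / ((s - t) * (s - t))"
    using DERIV_unique assms(1) by blast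
  have "((\<lambda>t. (poly r s - poly r t) / (s - t)) has_field_derivative
      (- poly (pderiv r) t * (s - t) + (poly r s - poly r t)) / ((s - t) * (s - t))) (at t)"
    using assms(2) by (auto intro!: derivative_eq_intros poly_DERIV simp: algebra_simps)
  then have "((\<lambda>t. divdiff r s t) has_field_derivative
      (- poly (pderiv r) t * (s - t) + (poly r s - poly r t)) / ((s - t) * (s - t))) (at t)"
    by (rule has_field_derivative_transform_within_open[of _ _ _ "- {s}"]) (use assms(2) eq in auto)
  then have 2: "divdiff_dt r s t = (- poly (pderiv r) t * (s - t) + (poly r s - poly r t)) / ((s - t) * (s - t))"
    using DERIV_unique divdiff_t_derivatives(2) by blast
  have "Ts + divdiff_dt r s t = ((poly (pderiv r) s - poly (pderiv r) t) * (s - t)) / ((s - t) * (s - t))"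
    unfolding 1 2 add_divide_distrib[symmetric] by (simp add: algebra_simps)
  then show ?thesis using assms(2) by simp
qed

section \<open>The pairing of the two families\<close>

definition node_poly :: "nat \<Rightarrow> complex ^ 'n::finite \<Rightarrow> complex poly" where
  "node_poly m z = (\<Prod>i\<in>UNIV. [:- z $ i, 1:] ^ m)"

lemma poly_node_poly:
  fixes z :: "complex ^ 'n::finite"
  shows "poly (node_poly m z) t = (\<Prod>i\<in>UNIV. (t - z $ i) ^ m)"
  by (simp add: node_poly_def poly_prod poly_power)

lemma root_prod_node_poly:
  fixes z :: "complex ^ 'n::finite"
  assumes "t \<notin> marked z"
  shows "root_prod (expo (int m) b) z t = 1 / (poly (node_poly m z) t * (t - z $ b))"
    and "root_prod (expo (- int m) b) z t = poly (node_poly m z) t / (t - z $ b)"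
proof -
  have "(\<Prod>i\<in>UNIV. (t - z $ i) powi (- int m)) = inverse (poly (node_poly m z) t)"
    by (simp add: poly_node_poly power_int_minus prod_inversef[symmetric] o_def)
  then show "root_prod (expo (int m) b) z t = 1 / (poly (node_poly m z) t * (t - z $ b))"
    using root_prod_off_marked[OF assms, of "int m" b] by (simp add: divide_inverse)
  show "root_prod (expo (- int m) b) z t = poly (node_poly m z) t / (t - z $ b)"
    using root_prod_off_marked[OF assms, of "- int m" b] by (simp add: poly_node_poly)
qed

lemma node_poly_log_derivative:
  fixes z :: "complex ^ 'n::finite"
  assumes "t \<notin> marked z"
  shows "poly (pderiv (node_poly m z)) t = of_nat m * poly (node_poly m z) t * (\<Sum>b\<in>UNIV. 1 / (t - z $ b))"
proof -
  have R: "root_prod (\<lambda>_::'n. int m) z = poly (node_poly m z)"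
    by (simp add: fun_eq_iff root_prod_def poly_node_poly)
  have "(root_prod (\<lambda>_::'n. int m) z has_field_derivative (\<Sum>j\<in>UNIV. root_dprod j (\<lambda>_. int m) z t)) (at t)"
    by (rule root_prod_derivative_var[OF regular_off_marked[OF assms]])
  then have "poly (pderiv (node_poly m z)) t = (\<Sum>j\<in>UNIV. root_dprod j (\<lambda>_. int m) z t)"
    unfolding R using DERIV_unique poly_DERIV by blast
  also have "\<dots> = (\<Sum>j\<in>UNIV. of_nat m * (poly (node_poly m z) t / (t - z $ j)))"
  proof (rule sum.cong)
    fix j :: 'n
    show "root_dprod j (\<lambda>_. int m) z t = of_nat m * (poly (node_poly m z) t / (t - z $ j))"
      using root_dprod_const[of j "- int m" z t] root_prod_node_poly(2)[OF assms, of m j] by simp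
  qed simp
  finally show ?thesis by (simp add: sum_distrib_left)
qed

lemma node_poly_zero_iff:
  fixes z :: "complex ^ 'n::finite"
  assumes "m > 0"
  shows "poly (node_poly m z) t = 0 \<longleftrightarrow> t \<in> marked z"
  using assms by (auto simp: poly_node_poly marked_def)

text \<open>
  The inner integral over the relative cycle, as a function of \<open>t\<close>, is a derivative (the quotient on the
  right is the derivative of minus \<open>\<Sum>i. a\<^sub>i divdiff_prim r z\<^sub>i t\<close> over \<open>r t\<close>) up to simple poles at the marked
  points. The difference of the two sides, multiplied by \<open>m (r t)\<^sup>2\<close>, is the sum of the \<open>a\<^sub>i X z\<^sub>i\<close> for a
  function \<open>X\<close> whose derivative vanishes for \<open>s \<noteq> t\<close> off the marked points. So \<open>X\<close> is constant, and a
  constant is annihilated by multiplicities with sum zero.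
\<close>

lemma bilinear_integrand_exact:
  fixes z :: "complex ^ 'n::finite"
  assumes m: "m > 0" and a: "(\<Sum>i\<in>UNIV. a i) = (0::complex)" and t: "t \<notin> marked z"
    and Q: "\<And>b x. (Q b has_field_derivative root_prod (expo (- int m) b) z x) (at x)"
  defines "r \<equiv> node_poly m z"
  shows "(\<Sum>b\<in>UNIV. root_prod (expo (int m) b) z t * (\<Sum>i\<in>UNIV. a i * Q b (z $ i))) =
    1 / of_nat m * ((poly (pderiv r) t * (\<Sum>i\<in>UNIV. a i * divdiff_prim r (z $ i) t) -
        (\<Sum>i\<in>UNIV. a i * divdiff_prim_dt r (z $ i) t) * poly r t) / (poly r t)\<^sup>2 -
      (\<Sum>i\<in>UNIV. a i / (t - z $ i)))"
proof -
  have rt: "poly r t \<noteq> 0" using t node_poly_zero_iff[OF m, of z t] by (simp add: r_def)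
  define X where "X s = of_nat m * poly r t * (\<Sum>b\<in>UNIV. Q b s / (t - z $ b)) +
      poly r t * (divdiff_prim_dt r s t + divdiff r s t) - poly (pderiv r) t * divdiff_prim r s t" for s
  obtain Ts where Ts: "\<And>s. ((\<lambda>s. divdiff r s t) has_field_derivative Ts s) (at s)"
    using divdiff_s_differentiable[of r t] unfolding field_differentiable_def by metis
  have dX: "(X has_field_derivative of_nat m * poly r t * (\<Sum>b\<in>UNIV. root_prod (expo (- int m) b) z s / (t - z $ b)) +
      poly r t * (divdiff_dt r s t + Ts s) - poly (pderiv r) t * divdiff r s t) (at s)" for s
    unfolding X_def
    by (intro DERIV_diff DERIV_add DERIV_cmult DERIV_sum DERIV_cdivide Q divdiff_prim_derivatives Ts)
  have "\<exists>c. \<forall>s\<in>UNIV. X s = c"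
  proof (rule DERIV_zero_connected_constant[OF connected_UNIV open_UNIV, of "insert t (marked z)"])
    show "finite (insert t (marked z))" using marked_finite_open(1) by simp
    show "continuous_on UNIV X"
      using dX by (meson DERIV_isCont continuous_at_imp_continuous_on)
    show "\<forall>s\<in>UNIV - insert t (marked z). (X has_field_derivative 0) (at s)"
    proof
      fix s assume s: "s \<in> UNIV - insert t (marked z)"
      then have st: "s \<noteq> t" and sm: "s \<notin> marked z" by auto
      let ?L = "\<lambda>x. \<Sum>b\<in>UNIV. 1 / (x - z $ b)"
      have "root_prod (expo (- int m) b) z s / (t - z $ b) = poly r s * ((1 / (s - z $ b) - 1 / (t - z $ b)) / (t - s))" for b
      proof -
        have "s - z $ b \<noteq> 0" "t - z $ b \<noteq> 0" using sm t by (auto simp: marked_def)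
        then have "1 / (s - z $ b) - 1 / (t - z $ b) = (t - s) / ((s - z $ b) * (t - z $ b))"
          by (simp add: diff_frac_eq)
        then show ?thesis using st by (simp add: root_prod_node_poly(2)[OF sm] r_def)
      qed
      then have S: "(\<Sum>b\<in>UNIV. root_prod (expo (- int m) b) z s / (t - z $ b)) = poly r s * ((?L s - ?L t) / (t - s))"
        by (simp add: sum_subtractf flip: sum_distrib_left sum_divide_distrib)
      have 1: "of_nat m * poly r t * (\<Sum>b\<in>UNIV. root_prod (expo (- int m) b) z s / (t - z $ b)) =
          (poly r t * poly (pderiv r) s - poly r s * poly (pderiv r) t) / (t - s)"
        unfolding S unfolding r_def node_poly_log_derivative[OF sm] node_poly_log_derivative[OF t]
        by (simp add: algebra_simps diff_divide_distrib)
      have 2: "divdiff_dt r s t + Ts s = (poly (pderiv r) s - poly (pderiv r) t) / (s - t)"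
        using divdiff_total_derivative[OF Ts st] by (simp add: add.commute)
      have 3: "divdiff r s t = (poly r s - poly r t) / (s - t)"
        using divdiff_mult[of s t r] st by (simp add: field_simps)
      have 4: "x / (t - s) = - (x / (s - t))" for x by (metis minus_diff_eq minus_divide_right)
      have "of_nat m * poly r t * (\<Sum>b\<in>UNIV. root_prod (expo (- int m) b) z s / (t - z $ b)) +
        poly r t * (divdiff_dt r s t + Ts s) - poly (pderiv r) t * divdiff r s t = 0"
        unfolding 1 2 3 4 by (simp add: algebra_simps diff_divide_distrib)
      then show "(X has_field_derivative 0) (at s)" using dX[of s] by simp
    qed
  qed blast
  then obtain C where C: "\<And>s. X s = C" by auto
  have "(\<Sum>i\<in>UNIV. a i * X (z $ i)) = 0"
    unfolding C using a by (simp flip: sum_distrib_right)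
  moreover have "divdiff r (z $ i) t = poly r t / (t - z $ i)" for i
  proof -
    have "z $ i \<in> marked z" by (simp add: marked_def)
    then have "poly r (z $ i) = 0" "z $ i - t \<noteq> 0" using node_poly_zero_iff[OF m, of z "z $ i"] t by (auto simp: r_def)
    then show ?thesis using divdiff_mult[of "z $ i" t r]
      by (metis (no_types, opaque_lifting) diff_0 minus_diff_eq minus_divide_divide nonzero_mult_div_cancel_left)
  qed
  ultimately have key: "of_nat m * poly r t * (\<Sum>b\<in>UNIV. (\<Sum>i\<in>UNIV. a i * Q b (z $ i)) / (t - z $ b)) +
      poly r t * ((\<Sum>i\<in>UNIV. a i * divdiff_prim_dt r (z $ i) t) + poly r t * (\<Sum>i\<in>UNIV. a i / (t - z $ i))) -
      poly (pderiv r) t * (\<Sum>i\<in>UNIV. a i * divdiff_prim r (z $ i) t) = 0"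
  proof -
    have sw: "(\<Sum>b\<in>UNIV. (\<Sum>i\<in>UNIV. a i * Q b (z $ i)) / (t - z $ b)) = (\<Sum>i\<in>UNIV. a i * (\<Sum>b\<in>UNIV. Q b (z $ i) / (t - z $ b)))"
      unfolding sum_divide_distrib sum_distrib_left by (subst sum.swap) simp
    have "(\<Sum>i\<in>UNIV. a i * X (z $ i)) = (\<Sum>i\<in>UNIV. of_nat m * poly r t * (a i * (\<Sum>b\<in>UNIV. Q b (z $ i) / (t - z $ b))) +
        poly r t * (a i * divdiff_prim_dt r (z $ i) t + poly r t * (a i / (t - z $ i))) -
        poly (pderiv r) t * (a i * divdiff_prim r (z $ i) t))"
      by (intro sum.cong) (auto simp: X_def \<open>\<And>i. divdiff r (z $ i) t = poly r t / (t - z $ i)\<close> algebra_simps)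
    also have "\<dots> = of_nat m * poly r t * (\<Sum>i\<in>UNIV. a i * (\<Sum>b\<in>UNIV. Q b (z $ i) / (t - z $ b))) +
        poly r t * ((\<Sum>i\<in>UNIV. a i * divdiff_prim_dt r (z $ i) t) + poly r t * (\<Sum>i\<in>UNIV. a i / (t - z $ i))) -
        poly (pderiv r) t * (\<Sum>i\<in>UNIV. a i * divdiff_prim r (z $ i) t)"
      by (simp only: sum.distrib sum_subtractf sum_distrib_left[symmetric])
    finally show ?thesis
      unfolding sw using \<open>(\<Sum>i\<in>UNIV. a i * X (z $ i)) = 0\<close> by simp
  qed
  have "(\<Sum>b\<in>UNIV. root_prod (expo (int m) b) z t * (\<Sum>i\<in>UNIV. a i * Q b (z $ i))) =
      (\<Sum>b\<in>UNIV. (\<Sum>i\<in>UNIV. a i * Q b (z $ i)) / (t - z $ b)) / poly r t"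
    by (simp add: root_prod_node_poly(1)[OF t] r_def sum_divide_distrib mult.commute)
  then show ?thesis
    using key rt m by (simp add: field_simps power2_eq_square)
qed

text \<open>
  Over a cycle the exact part of the integrand disappears and the simple poles give winding numbers.
\<close>

lemma pairing_integral:
  fixes z :: "complex ^ 'n::finite"
  assumes m: "m > 0" and a: "(\<Sum>i\<in>UNIV. a i) = (0::complex)"
    and c: "segment_chain c" "chain_boundary (Suc 0) c = 0"
    and avoids: "\<forall>f\<in>Poly_Mapping.keys c. path_image (simplex_path f) \<subseteq> - marked z"
    and Q: "\<And>b x. (Q b has_field_derivative root_prod (expo (- int m) b) z x) (at x)"
  shows "(\<Sum>b\<in>UNIV. chain_integral c (root_prod (expo (int m) b) z) * (\<Sum>i\<in>UNIV. a i * Q b (z $ i))) =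
    - (2 * of_real pi * \<i>) / of_nat m * (\<Sum>i\<in>UNIV. a i * chain_winding c (z $ i))"
proof -
  let ?r = "node_poly m z"
  let ?U = "\<lambda>t. \<Sum>i\<in>UNIV. a i * divdiff_prim ?r (z $ i) t" and ?Ut = "\<lambda>t. \<Sum>i\<in>UNIV. a i * divdiff_prim_dt ?r (z $ i) t"
  let ?Y = "\<lambda>t. (poly (pderiv ?r) t * ?U t - ?Ut t * poly ?r t) / (poly ?r t)\<^sup>2"
  let ?\<Phi> = "\<lambda>b. \<Sum>i\<in>UNIV. a i * Q b (z $ i)"
  note sm = segment_chain_smooth[OF c(1)]
  have off: "t \<notin> marked z" if "f \<in> Poly_Mapping.keys c" "t \<in> path_image (simplex_path f)" for f t
    using avoids that by blast
  have int: "root_prod e z contour_integrable_on simplex_path f" if "f \<in> Poly_Mapping.keys c" for e f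
    using root_functions_integrable(1)[OF c(1) regular_off_marked[OF off[OF that]] that] .
  have int1: "(\<lambda>t. 1 / (t - z $ i)) contour_integrable_on simplex_path f" if f: "f \<in> Poly_Mapping.keys c" for i f
    by (rule contour_integrable_holomorphic_simple[OF _ marked_finite_open(2)[of z] smooth_chainD[OF sm f]])
      (use off[OF f] in \<open>auto simp: marked_def intro!: holomorphic_intros\<close>)
  have "(\<Sum>b\<in>UNIV. chain_integral c (root_prod (expo (int m) b) z) * ?\<Phi> b) =
      (\<Sum>b\<in>UNIV. chain_integral c (\<lambda>t. ?\<Phi> b * root_prod (expo (int m) b) z t))"
    by (intro sum.cong refl) (subst chain_integral_lmul, use int in \<open>auto simp: mult.commute\<close>)
  also have "\<dots> = chain_integral c (\<lambda>t. \<Sum>b\<in>UNIV. ?\<Phi> b * root_prod (expo (int m) b) z t)"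
    by (rule chain_integral_sum[symmetric]) (simp, intro contour_integrable_lmul int)
  finally have "(\<Sum>b\<in>UNIV. chain_integral c (root_prod (expo (int m) b) z) * ?\<Phi> b) =
      chain_integral c (\<lambda>t. \<Sum>b\<in>UNIV. ?\<Phi> b * root_prod (expo (int m) b) z t)" .
  moreover have "of_nat m * chain_integral c (\<lambda>t. \<Sum>b\<in>UNIV. ?\<Phi> b * root_prod (expo (int m) b) z t) +
      chain_integral c (\<lambda>t. \<Sum>i\<in>UNIV. a i * (1 / (t - z $ i))) = 0"
  proof -
    have i1: "(\<lambda>t. of_nat m * (\<Sum>b\<in>UNIV. ?\<Phi> b * root_prod (expo (int m) b) z t)) contour_integrable_on simplex_path f"
      and i2: "(\<lambda>t. - (\<Sum>i\<in>UNIV. a i * (1 / (t - z $ i)))) contour_integrable_on simplex_path f"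
      and i3: "(\<lambda>t. \<Sum>b\<in>UNIV. ?\<Phi> b * root_prod (expo (int m) b) z t) contour_integrable_on simplex_path f"
      and i4: "(\<lambda>t. \<Sum>i\<in>UNIV. a i * (1 / (t - z $ i))) contour_integrable_on simplex_path f"
      if "f \<in> Poly_Mapping.keys c" for f
      by (intro contour_integrable_lmul contour_integrable_sum contour_integrable_neg finite
          int[OF that] int1[OF that])+
    have "of_nat m * chain_integral c (\<lambda>t. \<Sum>b\<in>UNIV. ?\<Phi> b * root_prod (expo (int m) b) z t) +
        chain_integral c (\<lambda>t. \<Sum>i\<in>UNIV. a i * (1 / (t - z $ i))) =
        chain_integral c (\<lambda>t. of_nat m * (\<Sum>b\<in>UNIV. ?\<Phi> b * root_prod (expo (int m) b) z t) -
          (- (\<Sum>i\<in>UNIV. a i * (1 / (t - z $ i)))))"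
    proof -
      have "chain_integral c (\<lambda>t. - (\<Sum>i\<in>UNIV. a i * (1 / (t - z $ i)))) =
          - chain_integral c (\<lambda>t. \<Sum>i\<in>UNIV. a i * (1 / (t - z $ i)))"
        using chain_integral_lmul[of c "\<lambda>t. \<Sum>i\<in>UNIV. a i * (1 / (t - z $ i))" "-1"] i4 by simp
      then show ?thesis
        using chain_integral_diff[of c, OF i1 i2] chain_integral_lmul[of c, OF i3, of "of_nat m"] by simp
    qed
    also have "\<dots> = chain_integral c ?Y"
    proof (rule chain_integral_cong)
      fix f t assume "f \<in> Poly_Mapping.keys c" "t \<in> path_image (simplex_path f)"
      then have t: "t \<notin> marked z" by (rule off)
      show "of_nat m * (\<Sum>b\<in>UNIV. ?\<Phi> b * root_prod (expo (int m) b) z t) -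
          (- (\<Sum>i\<in>UNIV. a i * (1 / (t - z $ i)))) = ?Y t"
        using bilinear_integrand_exact[OF m a t Q] m by (simp add: mult.commute)
    qed
    also have "\<dots> = 0"
    proof (rule chain_integral_derivative_cycle[OF sm c(2), of "- marked z" "\<lambda>t. - (?U t / poly ?r t)"])
      fix f assume "f \<in> Poly_Mapping.keys c"
      then show "path_image (simplex_path f) \<subseteq> - marked z" using avoids by blast
    next
      fix t assume "t \<in> - marked z"
      then have rt: "poly ?r t \<noteq> 0" using node_poly_zero_iff[OF m, of z t] by simp
      have "(?U has_field_derivative ?Ut t) (at t)"
        by (intro DERIV_sum DERIV_cmult divdiff_t_derivatives)
      from DERIV_minus[OF DERIV_divide[OF this poly_DERIV rt]]
      have "((\<lambda>t. - (?U t / poly ?r t)) has_field_derivative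
          - ((?Ut t * poly ?r t - ?U t * poly (pderiv ?r) t) / (poly ?r t * poly ?r t))) (at t)" .
      moreover have "- ((?Ut t * poly ?r t - ?U t * poly (pderiv ?r) t) / (poly ?r t * poly ?r t)) = ?Y t"
        unfolding minus_divide_left power2_eq_square by (simp add: mult.commute)
      ultimately show "((\<lambda>t. - (?U t / poly ?r t)) has_field_derivative ?Y t) (at t)" by simp
    qed
    finally show ?thesis .
  qed
  moreover have "chain_integral c (\<lambda>t. \<Sum>i\<in>UNIV. a i * (1 / (t - z $ i))) =
      2 * of_real pi * \<i> * (\<Sum>i\<in>UNIV. a i * chain_winding c (z $ i))"
  proof -
    have "chain_integral c (\<lambda>t. \<Sum>i\<in>UNIV. a i * (1 / (t - z $ i))) =
        (\<Sum>i\<in>UNIV. chain_integral c (\<lambda>t. a i * (1 / (t - z $ i))))"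
      by (rule chain_integral_sum) (simp, intro contour_integrable_lmul int1)
    also have "\<dots> = (\<Sum>i\<in>UNIV. 2 * of_real pi * \<i> * (a i * chain_winding c (z $ i)))"
    proof (rule sum.cong)
      fix i :: 'n
      have "chain_winding c (z $ i) = 1 / (2 * of_real pi * \<i>) * chain_integral c (\<lambda>t. 1 / (t - z $ i))"
        by (rule chain_winding_integral[OF sm]) (use off in \<open>auto simp: marked_def\<close>)
      moreover have "chain_integral c (\<lambda>t. a i * (1 / (t - z $ i))) = a i * chain_integral c (\<lambda>t. 1 / (t - z $ i))"
        by (rule chain_integral_lmul) (rule int1)
      ultimately show "chain_integral c (\<lambda>t. a i * (1 / (t - z $ i))) = 2 * of_real pi * \<i> * (a i * chain_winding c (z $ i))"
        by simp
    qed simp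
    finally show ?thesis by (simp add: sum_distrib_left)
  qed
  ultimately show ?thesis using m by (simp add: field_simps add_eq_0_iff)
qed

section \<open>Invariant pairings on the reflection representation\<close>

text \<open>
  The orthogonal projection of the basis vector \<open>\<epsilon>\<^sub>i\<close>. These vectors span \<open>refl_rep\<close> and are permuted by the
  symmetric group.
\<close>

definition refl_proj :: "'n \<Rightarrow> complex ^ 'n::finite" where
  "refl_proj i = (\<chi> l. (if l = i then 1 else 0) - 1 / of_nat CARD('n))"

lemma refl_rep_closed:
  fixes x y :: "complex ^ 'n::finite"
  shows "x \<in> refl_rep \<Longrightarrow> y \<in> refl_rep \<Longrightarrow> x + y \<in> refl_rep"
    and "x \<in> refl_rep \<Longrightarrow> a *s x \<in> refl_rep" and "0 \<in> (refl_rep :: (complex ^ 'n::finite) set)"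
  by (simp_all add: refl_rep_def sum.distrib flip: sum_distrib_left)

lemma refl_proj_mem: "refl_proj (i :: 'n::finite) \<in> refl_rep"
  by (simp add: refl_rep_def refl_proj_def sum_subtractf)

lemma refl_rep_expansion:
  fixes x :: "complex ^ 'n::finite"
  assumes "x \<in> refl_rep"
  shows "x = (\<Sum>i\<in>UNIV. (x $ i) *s refl_proj i)"
proof -
  have "(\<Sum>i\<in>UNIV. (x $ i) *s refl_proj i) $ l = x $ l" for l
  proof -
    have "(\<Sum>i\<in>UNIV. (x $ i) *s refl_proj i) $ l =
        (\<Sum>i\<in>UNIV. (if i = l then x $ l else 0) - x $ i * (1 / of_nat CARD('n)))"
      unfolding sum_component by (intro sum.cong) (auto simp: refl_proj_def right_diff_distrib)
    also have "\<dots> = x $ l - (\<Sum>i\<in>UNIV. x $ i) * (1 / of_nat CARD('n))"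
      by (simp add: sum_subtractf sum_divide_distrib)
    finally show ?thesis using assms by (simp add: refl_rep_def)
  qed
  then show ?thesis by (simp add: vec_eq_iff)
qed

lemma perm_act_refl_proj:
  assumes "\<pi> permutes (UNIV :: 'n::finite set)"
  shows "perm_act \<pi> (refl_proj i) = refl_proj (\<pi> i)"
proof -
  have b: "bij \<pi>" using permutes_bij[OF assms] .
  then have "inv_into UNIV \<pi> l = i \<longleftrightarrow> l = \<pi> i" for l
    by (metis bij_inv_eq_iff)
  then show ?thesis by (simp add: perm_act_def refl_proj_def vec_eq_iff)
qed

lemma two_transitive:
  fixes i j i' j' :: "'n"
  assumes "i \<noteq> j" "i' \<noteq> j'"
  shows "\<exists>\<pi>. \<pi> permutes UNIV \<and> \<pi> i = i' \<and> \<pi> j = j'"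
proof -
  let ?p = "Transposition.transpose i i'"
  let ?q = "Transposition.transpose (?p j) j'"
  have "?p j \<noteq> i'"
    using assms(1) by (auto simp: Transposition.transpose_def)
  then have "(?q \<circ> ?p) i = i'" "(?q \<circ> ?p) j = j'"
    using assms(2) by (simp_all add: transpose_apply_other)
  moreover have "(?q \<circ> ?p) permutes UNIV"
    by (intro permutes_compose permutes_swap_id) auto
  ultimately show ?thesis by blast
qed

text \<open>
  By double transitivity \<open>B\<close> takes only two values on pairs of projected basis vectors: \<open>p\<close> on equal and \<open>q\<close> on
  distinct ones. On vectors with coordinate sum zero this gives \<open>p - q\<close> times the dot product.
\<close>

lemma invariant_pairing_proportional:
  fixes B :: "complex ^ 'n::finite \<Rightarrow> complex ^ 'n::finite \<Rightarrow> complex"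
  assumes N: "CARD('n) \<ge> 2" and B: "invariant_pairing B"
  shows "\<exists>\<beta>. \<beta> \<noteq> 0 \<and> (\<forall>x\<in>refl_rep. \<forall>y\<in>refl_rep. B x y = \<beta> * (\<Sum>i\<in>UNIV. x $ i * y $ i))"
proof -
  have add: "B (x + y) u = B x u + B y u" "B u (x + y) = B u x + B u y"
    and scale: "B (a *s x) y = a * B x y" "B x (a *s y) = a * B x y"
    and inv: "\<pi> permutes UNIV \<Longrightarrow> B (perm_act \<pi> x) (perm_act \<pi> y) = B x y"
    and nondeg: "(\<And>y. y \<in> refl_rep \<Longrightarrow> B x y = 0) \<Longrightarrow> x = 0"
    if "x \<in> refl_rep" "y \<in> refl_rep" "u \<in> refl_rep" for x y u a \<pi>
    using B that unfolding invariant_pairing_def by blast+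
  have zero: "B 0 y = 0" "B y 0 = 0" if "y \<in> refl_rep" for y
    using scale[of 0 y y 0] scale[of y 0 y 0] that refl_rep_closed(3) by auto
  have sl: "B (\<Sum>i\<in>J. c i *s refl_proj i) y = (\<Sum>i\<in>J. c i * B (refl_proj i) y) \<and>
      (\<Sum>i\<in>J. c i *s refl_proj i) \<in> refl_rep"
    if "y \<in> refl_rep" for J :: "'n set" and c y
  proof (induction J rule: infinite_finite_induct)
    case (insert i J)
    have m: "c i *s refl_proj i \<in> refl_rep" by (intro refl_rep_closed refl_proj_mem)
    show ?case
      using insert add(1)[of "c i *s refl_proj i" _ y] scale(1)[of "refl_proj i" y y] that m refl_proj_mem[of i]
      by (simp add: refl_rep_closed)
  qed (use zero that refl_rep_closed in auto)
  have sr: "B y (\<Sum>i\<in>J. c i *s refl_proj i) = (\<Sum>i\<in>J. c i * B y (refl_proj i)) \<and>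
      (\<Sum>i\<in>J. c i *s refl_proj i) \<in> refl_rep"
    if "y \<in> refl_rep" for J :: "'n set" and c y
  proof (induction J rule: infinite_finite_induct)
    case (insert i J)
    have m: "c i *s refl_proj i \<in> refl_rep" by (intro refl_rep_closed refl_proj_mem)
    show ?case
      using insert add(2)[of "c i *s refl_proj i" _ y] scale(2)[of y "refl_proj i" y] that m refl_proj_mem[of i]
      by (simp add: refl_rep_closed)
  qed (use zero that refl_rep_closed in auto)
  let ?b = "\<lambda>i j. B (refl_proj i) (refl_proj j)"
  have binv: "?b (\<pi> i) (\<pi> j) = ?b i j" if "\<pi> permutes UNIV" for \<pi> i j
    using inv[OF refl_proj_mem refl_proj_mem refl_proj_mem that, of i j] perm_act_refl_proj[OF that] by simp
  obtain i0 j0 :: 'n where ij0: "i0 \<noteq> j0"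
    using N by (metis card_2_iff' ex_card UNIV_I)
  define p where "p = ?b i0 i0"
  define q where "q = ?b i0 j0"
  have diag: "?b i i = p" for i
    using binv[OF permutes_swap_id[of i0 UNIV i], of i0 i0] by (simp add: p_def)
  have offd: "?b i j = q" if "i \<noteq> j" for i j
    using two_transitive[OF ij0 that] binv by (auto simp: q_def)
  have form: "B x y = (p - q) * (\<Sum>i\<in>UNIV. x $ i * y $ i)" if x: "x \<in> refl_rep" and y: "y \<in> refl_rep" for x y
  proof -
    have "B x y = (\<Sum>i\<in>UNIV. x $ i * B (refl_proj i) y)"
      using sl[OF y, of "\<lambda>i. x $ i" UNIV] refl_rep_expansion[OF x] by simp
    also have "\<dots> = (\<Sum>i\<in>UNIV. x $ i * (\<Sum>j\<in>UNIV. y $ j * ?b i j))"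
      using sr[OF refl_proj_mem, of _ "\<lambda>j. y $ j" UNIV] refl_rep_expansion[OF y] by simp
    also have "\<dots> = (\<Sum>i\<in>UNIV. x $ i * (\<Sum>j\<in>UNIV. q * y $ j + (if j = i then (p - q) * y $ i else 0)))"
      by (intro sum.cong refl arg_cong2[of _ _ _ _ "(*)"]) (auto simp: diag offd algebra_simps)
    also have "\<dots> = (\<Sum>i\<in>UNIV. x $ i * ((p - q) * y $ i))"
      using y by (simp add: sum.distrib refl_rep_def flip: sum_distrib_left)
    finally show ?thesis by (simp add: sum_distrib_left algebra_simps)
  qed
  have "p - q \<noteq> 0"
  proof
    assume 0: "p - q = 0"
    have m: "refl_proj i0 + (-1) *s refl_proj j0 \<in> refl_rep"
      by (intro refl_rep_closed refl_proj_mem)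
    have "refl_proj i0 + (-1) *s refl_proj j0 = 0"
    proof (rule nondeg[OF m m m])
      fix y :: "complex ^ 'n::finite" assume y: "y \<in> refl_rep"
      show "B (refl_proj i0 + (-1) *s refl_proj j0) y = 0"
        unfolding form[OF m y] 0 by simp
    qed
    then have "(refl_proj i0 + (-1) *s refl_proj j0) $ i0 = 0" by simp
    then show False using ij0 by (simp add: refl_proj_def)
  qed
  then show ?thesis using form by blast
qed

section \<open>The canonical pairing is the intersection pairing\<close>

lemma disc_inverse:
  fixes z :: "complex ^ 'n::{finite,linorder}"
  assumes "z \<in> config"
  shows "disc k z * disc (- k) z = 1"
proof -
  have "disc k z * disc (- k) z = (\<Prod>(i, j)\<in>{(i, j). i < j}. (z $ i - z $ j) powi (2 * k) * (z $ i - z $ j) powi (2 * - k))"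
    unfolding disc_def prod.distrib[symmetric] by (simp add: case_prod_unfold)
  also have "\<dots> = 1"
    using assms by (intro prod.neutral) (auto simp: config_def power_int_minus)
  finally show ?thesis .
qed

lemma psi_phi_dot_product:
  fixes z :: "complex ^ 'n::{finite,linorder}"
  assumes z: "z \<in> config" and m: "m > 0"
    and \<sigma>: "\<sigma> \<in> carrier (homology_group 1 (punctured_plane z))"
    and \<tau>: "\<tau> \<in> carrier (relative_homology_group 1 euclidean (marked z))"
  shows "(\<Sum>b\<in>UNIV. psi m z \<sigma> $ b * phi m z \<tau> $ b) = - 1 / of_nat m * of_int (intersection_number \<sigma> \<tau>)"
proof -
  obtain c where c: "c \<in> \<sigma>" "segment_chain c"
    using exists_segment_cycle[OF \<sigma>[unfolded punctured_plane_def] marked_finite_open(2)] .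
  note sm = segment_chain_smooth[OF c(2)]
  have rc: "singular_chain (Suc 0) (punctured_plane z) c" "chain_boundary (Suc 0) c = 0"
    using homology_class_relcycle[OF \<sigma> c(1)] singular_relcycle_empty[of "- marked z" c]
    by (auto simp: punctured_plane_def)
  have avoids: "\<forall>f\<in>Poly_Mapping.keys c. path_image (simplex_path f) \<subseteq> - marked z"
    using simplex_path_image_in_space[of "- marked z" c] rc(1) by (simp add: punctured_plane_def)
  obtain d where d: "d \<in> \<tau>" using homology_class_memD[OF \<tau>] by metis
  define a where "a i = end_coeff d (z $ i)" for i
  have a: "(\<Sum>i\<in>UNIV. a i) = 0"
    unfolding a_def by (rule sum_end_coeff[OF z homology_class_relcycle[OF \<tau> d]])
  obtain Q where Q: "\<And>b x. (Q b has_field_derivative root_prod (expo (- int m) b) z x) (at x)"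
    using root_prod_primitives[OF m] by metis
  let ?J = "\<lambda>b. chain_integral c (root_prod (expo (int m) b) z)" and ?P = "\<lambda>b. \<Sum>i\<in>UNIV. a i * Q b (z $ i)"
  let ?k = "1 / (2 * of_real pi * \<i>) :: complex"
  have "(\<Sum>b\<in>UNIV. psi m z \<sigma> $ b * phi m z \<tau> $ b) =
      (\<Sum>b\<in>UNIV. (disc (int m) z * disc (- int m) z) * (?k * (?J b * ?P b)))"
    unfolding psi_eq_segment_integral[OF \<sigma> c(1) sm] phi_eq_primitive[OF z m \<tau> d Q] a_def
    by (simp add: mult_ac)
  also have "\<dots> = ?k * (\<Sum>b\<in>UNIV. ?J b * ?P b)"
    unfolding disc_inverse[OF z] by (simp flip: sum_distrib_left sum_divide_distrib)
  also have "\<dots> = - 1 / of_nat m * (\<Sum>i\<in>UNIV. a i * chain_winding c (z $ i))"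
    unfolding pairing_integral[OF m a c(2) rc(2) avoids Q] using m by (simp add: field_simps)
  also have "\<dots> = - 1 / of_nat m * of_int (intersection_number \<sigma> \<tau>)"
    unfolding a_def using intersection_number_winding[OF \<sigma> c(1) sm z \<tau> d] by simp
  finally show ?thesis .
qed

theorem proposition4p4:
  fixes B :: "complex ^ 'n::{finite,linorder} \<Rightarrow> complex ^ 'n::{finite,linorder} \<Rightarrow> complex"
  assumes "CARD('n) \<ge> 2"
    and "invariant_pairing B"
  shows "\<exists>C::complex. C \<noteq> 0 \<and>
    (\<forall>(m::nat) (U :: (complex ^ 'n::{finite,linorder}) set) \<sigma> \<tau>.
       m > 0 \<longrightarrow> open U \<longrightarrow> U \<subseteq> config \<longrightarrow> horizontal_cycle U \<sigma> \<longrightarrow> horizontal_relcycle U \<tau> \<longrightarrow>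
       (\<lambda>z. psi m z (\<sigma> z)) \<in> KZ U (int m) \<and>
       (\<lambda>z. phi m z (\<tau> z)) \<in> KZ U (- int m) \<and>
       (\<forall>z\<in>U. B (psi m z (\<sigma> z)) (phi m z (\<tau> z)) =
          C * (1 / of_nat m) * of_int (intersection_number (\<sigma> z) (\<tau> z))))"
proof -
  obtain \<beta> where \<beta>: "\<beta> \<noteq> 0"
    "\<And>x y. x \<in> refl_rep \<Longrightarrow> y \<in> refl_rep \<Longrightarrow> B x y = \<beta> * (\<Sum>i\<in>UNIV. x $ i * y $ i)"
    using invariant_pairing_proportional[OF assms] by blast
  show ?thesis
  proof (intro exI[of _ "- \<beta>"] conjI allI impI ballI)
    show "- \<beta> \<noteq> 0" using \<beta>(1) by simp
  next
    fix m :: nat and U :: "(complex ^ 'n::{finite,linorder}) set" and \<sigma> \<tau>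
    assume m: "m > 0" and U: "U \<subseteq> config" and \<sigma>: "horizontal_cycle U \<sigma>" and \<tau>: "horizontal_relcycle U \<tau>"
    show psi: "(\<lambda>z. psi m z (\<sigma> z)) \<in> KZ U (int m)" by (rule psi_KZ[OF m U \<sigma>])
    show phi: "(\<lambda>z. phi m z (\<tau> z)) \<in> KZ U (- int m)" by (rule phi_KZ[OF m U \<tau>])
    fix z assume z: "z \<in> U"
    have "psi m z (\<sigma> z) \<in> refl_rep" "phi m z (\<tau> z) \<in> refl_rep"
      using psi phi z by (auto simp: KZ_def)
    from \<beta>(2)[OF this] have "B (psi m z (\<sigma> z)) (phi m z (\<tau> z)) =
        \<beta> * (- 1 / of_nat m * of_int (intersection_number (\<sigma> z) (\<tau> z)))"
      using psi_phi_dot_product[of z m "\<sigma> z" "\<tau> z"] z U \<sigma> \<tau> m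
      by (auto simp: horizontal_cycle_def horizontal_relcycle_def)
    then show "B (psi m z (\<sigma> z)) (phi m z (\<tau> z)) =
        - \<beta> * (1 / of_nat m) * of_int (intersection_number (\<sigma> z) (\<tau> z))" by simp
  qed
qed

end
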